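(* Let $H=H_{n,q,N,\nu}$ be the Hopf algebra over a field $k$ defined in the context, with $H\ne k\mathbb Z_N$, and let $B\subseteq H$ be a Hopf subalgebra. Then either $B=kG(B)$, where $G(B)$ is a subgroup of the cyclic group $(a)$, or there exists an integer $1\le s\le N$ such that $s\mid N$, $(N/s)\mid\nu$ and $B$ is the subalgebra $k\langle a^{N/s},x\rangle$ generated by $a^{N/s}$ and $x$, which equals (i.e. is isomorphic, with these generators, to) $H_{\frac{n}{(n,N/s)},\,q^{N/s},\,s,\,\frac{\nu}{N/s}}$.
   Context: $(b,c)$ denotes the greatest common divisor of integers $b,c$. $G(B)$ is the group of grouplike elements of $B$. Let $n,\nu,N$ be positive integers with $n\mid N$, $1\le\nu<N$; let $q\in k$ be a primitive $n$th root of unity and $r=|q^\nu|$ the multiplicative order of $q^\nu$. $H_{n,q,N,\nu}$ is the Hopf algebra over $k$ generated as an algebra by $a,x$ with relations $a^N=1$, $x^r=0$, $xa=qax$, and with $\Delta(a)=a\otimes a$, $\Delta(x)=x\otimes a^\nu+1\otimes x$, $\varepsilon(a)=1$, $\varepsilon(x)=0$, antipode $s(a)=a^{-1}$, $s(x)=-q^{-\nu}a^{-\nu}x$. The condition $H_{n,q,N,\nu}\neq k\mathbb Z_N$ means $x\ne0$, i.e. $r>1$ (equivalently $n\nmid\nu$). *)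

theory Defs
  imports "HOL-Algebra.Algebra" "HOL-Algebra.Algebraic_Closure_Type" "HOL-Library.Poly_Mapping"
begin

text \<open>
  The ground field is a type \<open>'k\<close> of class \<^class>\<open>field\<close>; algebras over it are records of type
  \<open>('k, 'a) module\<close>.  The locale \<open>algebra\<close> of HOL-Algebra is not used since it requires
  commutativity.
\<close>

definition k_subspace :: "'h set \<Rightarrow> ('k::field, 'h, 'm) module_scheme \<Rightarrow> bool" where
  "k_subspace V A \<longleftrightarrow> submodule V (ring_of_type_algebra :: 'k ring) A"

definition k_span :: "('k::field, 'h, 'm) module_scheme \<Rightarrow> 'h set \<Rightarrow> 'h set" where
  "k_span A S = \<Inter>{V. k_subspace V A \<and> S \<subseteq> V}"

definition k_subalgebra :: "'h set \<Rightarrow> ('k::field, 'h, 'm) module_scheme \<Rightarrow> bool" where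
  "k_subalgebra V A \<longleftrightarrow> subring V A \<and> k_subspace V A"

definition k_subalgebra_generated :: "('k::field, 'h, 'm) module_scheme \<Rightarrow> 'h set \<Rightarrow> 'h set" where
  "k_subalgebra_generated A S = \<Inter>{V. k_subalgebra V A \<and> S \<subseteq> V}"

text \<open>The quotient algebra; only the scalar action has to be added to \<^const>\<open>FactRing\<close>.\<close>

definition quot_algebra ::
    "('k::field, 'h, 'm) module_scheme \<Rightarrow> 'h set \<Rightarrow> ('k, 'h set) module" where
  "quot_algebra A I =
    \<lparr>carrier = carrier (A Quot I), monoid.mult = monoid.mult (A Quot I), one = one (A Quot I),
     ring.zero = ring.zero (A Quot I), ring.add = ring.add (A Quot I),
     module.smult = (\<lambda>c C. \<Union>f\<in>C. I +>\<^bsub>A\<^esub> (c \<odot>\<^bsub>A\<^esub> f))\<rparr>"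

definition monoid_algebra :: "('w, 'm) monoid_scheme \<Rightarrow> ('k::field, 'w \<Rightarrow>\<^sub>0 'k) module" where
  "monoid_algebra M =
    \<lparr>carrier = {f. Poly_Mapping.keys f \<subseteq> carrier M},
     monoid.mult = (\<lambda>f g. \<Sum>u\<in>Poly_Mapping.keys f. \<Sum>v\<in>Poly_Mapping.keys g.
        Poly_Mapping.single (u \<otimes>\<^bsub>M\<^esub> v) (Poly_Mapping.lookup f u * Poly_Mapping.lookup g v)),
     one = Poly_Mapping.single \<one>\<^bsub>M\<^esub> 1,
     ring.zero = 0,
     ring.add = (+),
     module.smult = (\<lambda>c. Poly_Mapping.map ((*) c))\<rparr>"

definition free_algebra :: "('k::field, 'g list \<Rightarrow>\<^sub>0 'k) module" where
  "free_algebra = monoid_algebra \<lparr>carrier = UNIV, monoid.mult = (@), one = []\<rparr>"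

text \<open>
  Linear extension of a map given on the basis elements \<open>w\<close> of a free vector space, and the
  map induced on a quotient.  As \<^const>\<open>the_elem\<close> is used, \<open>quot_map g C\<close> is meaningful only
  if \<open>g\<close> is constant on the coset \<open>C\<close>; this holds in all uses below.
\<close>

definition lin_ext ::
    "('k::field, 'h, 'm) module_scheme \<Rightarrow> ('w \<Rightarrow> 'h) \<Rightarrow> ('w \<Rightarrow>\<^sub>0 'k) \<Rightarrow> 'h" where
  "lin_ext A b f = (\<Oplus>\<^bsub>A\<^esub>w\<in>Poly_Mapping.keys f. Poly_Mapping.lookup f w \<odot>\<^bsub>A\<^esub> b w)"

definition free_ext ::
    "('k::field, 'h, 'm) module_scheme \<Rightarrow> ('g \<Rightarrow> 'h) \<Rightarrow> ('g list \<Rightarrow>\<^sub>0 'k) \<Rightarrow> 'h" where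
  "free_ext A \<phi> = lin_ext A (\<lambda>w. foldr (\<lambda>g y. \<phi> g \<otimes>\<^bsub>A\<^esub> y) w \<one>\<^bsub>A\<^esub>)"

definition quot_map :: "('f \<Rightarrow> 'b) \<Rightarrow> 'f set \<Rightarrow> 'b" where
  "quot_map g C = the_elem (g ` C)"

definition ground_algebra :: "('k::field, 'k) module" where
  "ground_algebra = \<lparr>carrier = UNIV, monoid.mult = (*), one = 1, ring.zero = 0, ring.add = (+), module.smult = (*)\<rparr>"

definition opposite_algebra ::
    "('k::field, 'h, 'm) module_scheme \<Rightarrow> ('k, 'h, 'm) module_scheme" where
  "opposite_algebra A = A\<lparr>monoid.mult := (\<lambda>u v. v \<otimes>\<^bsub>A\<^esub> u)\<rparr>"

text \<open>
  The tensor product of two algebras is the free vector space on \<open>A \<times> B\<close> modulo the span of the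
  bilinearity relations.  The product \<open>(u \<otimes> v) (u' \<otimes> v') = uu' \<otimes> vv'\<close> comes from regarding that
  free vector space as the algebra of the multiplicative monoid \<open>A \<times> B\<close>, in which this span is
  a two-sided ideal.
\<close>

definition tensor_null ::
    "('k::field, 'a, 'm) module_scheme \<Rightarrow> ('k, 'b, 'n) module_scheme \<Rightarrow> ('a \<times> 'b \<Rightarrow>\<^sub>0 'k) set" where
  "tensor_null A B = k_span (monoid_algebra (A \<times>\<times> B))
    ({Poly_Mapping.single (u \<oplus>\<^bsub>A\<^esub> u', v) 1 - Poly_Mapping.single (u, v) 1
        - Poly_Mapping.single (u', v) 1 | u u' v.
        u \<in> carrier A \<and> u' \<in> carrier A \<and> v \<in> carrier B} \<union>
     {Poly_Mapping.single (u, v \<oplus>\<^bsub>B\<^esub> v') 1 - Poly_Mapping.single (u, v) 1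
        - Poly_Mapping.single (u, v') 1 | u v v'.
        u \<in> carrier A \<and> v \<in> carrier B \<and> v' \<in> carrier B} \<union>
     {Poly_Mapping.single (c \<odot>\<^bsub>A\<^esub> u, v) 1 - Poly_Mapping.single (u, v) c | c u v.
        u \<in> carrier A \<and> v \<in> carrier B} \<union>
     {Poly_Mapping.single (u, c \<odot>\<^bsub>B\<^esub> v) 1 - Poly_Mapping.single (u, v) c | c u v.
        u \<in> carrier A \<and> v \<in> carrier B})"

definition tensor_algebra ::
    "('k::field, 'a, 'm) module_scheme \<Rightarrow> ('k, 'b, 'n) module_scheme \<Rightarrow>
      ('k, ('a \<times> 'b \<Rightarrow>\<^sub>0 'k) set) module" where
  "tensor_algebra A B = quot_algebra (monoid_algebra (A \<times>\<times> B)) (tensor_null A B)"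

definition pure_tensor ::
    "('k::field, 'a, 'm) module_scheme \<Rightarrow> ('k, 'b, 'n) module_scheme \<Rightarrow>
      'a \<Rightarrow> 'b \<Rightarrow> ('a \<times> 'b \<Rightarrow>\<^sub>0 'k) set" where
  "pure_tensor A B u v =
    tensor_null A B +>\<^bsub>monoid_algebra (A \<times>\<times> B)\<^esub> Poly_Mapping.single (u, v) (1::'k)"

record (overloaded) ('k::zero, 'h) hopf = "('k, 'h) module" +
  comult :: "'h \<Rightarrow> ('h \<times> 'h \<Rightarrow>\<^sub>0 'k) set"
  counit :: "'h \<Rightarrow> 'k"
  antipode :: "'h \<Rightarrow> 'h"

definition grouplikes :: "('k::field, 'h, 'm) hopf_scheme \<Rightarrow> 'h set \<Rightarrow> 'h set" where
  "grouplikes H B = {g \<in> B. comult H g = pure_tensor H H g g \<and> counit H g = 1}"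

text \<open>\<open>B \<otimes> B\<close> is identified with its image in \<open>H \<otimes> H\<close>, which is legitimate over a field.\<close>

definition hopf_subalgebra :: "'h set \<Rightarrow> ('k::field, 'h, 'm) hopf_scheme \<Rightarrow> bool" where
  "hopf_subalgebra B H \<longleftrightarrow>
    k_subalgebra B H \<and>
    (\<forall>b\<in>B. comult H b \<in> k_span (tensor_algebra H H) {pure_tensor H H u v | u v. u \<in> B \<and> v \<in> B}) \<and>
    (\<forall>b\<in>B. antipode H b \<in> B)"

definition hopf_hom ::
    "('k::field, 'h, 'm) hopf_scheme \<Rightarrow> ('k, 'g, 'n) hopf_scheme \<Rightarrow> ('h \<Rightarrow> 'g) set" where
  "hopf_hom H L = {\<phi> \<in> ring_hom H L. \<forall>h\<in>carrier H.
    (\<forall>c. \<phi> (c \<odot>\<^bsub>H\<^esub> h) = c \<odot>\<^bsub>L\<^esub> \<phi> h) \<and>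
    comult L (\<phi> h) =
      quot_map (lin_ext (tensor_algebra L L) (\<lambda>(u, v). pure_tensor L L (\<phi> u) (\<phi> v))) (comult H h) \<and>
    counit L (\<phi> h) = counit H h \<and>
    antipode L (\<phi> h) = \<phi> (antipode H h)}"

text \<open>
  Isomorphisms from \<open>H\<close> onto a Hopf subalgebra \<open>B\<close> of \<open>L\<close>: as the structure of \<open>B\<close> is the
  restriction of that of \<open>L\<close>, these are the injective Hopf algebra maps into \<open>L\<close> with image \<open>B\<close>.
\<close>

definition hopf_iso_onto ::
    "('k::field, 'h, 'm) hopf_scheme \<Rightarrow> ('k, 'g, 'n) hopf_scheme \<Rightarrow> 'g set \<Rightarrow> ('h \<Rightarrow> 'g) set" where
  "hopf_iso_onto H L B = {\<phi> \<in> hopf_hom H L. bij_betw \<phi> (carrier H) B}"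

definition mult_order :: "'k::field \<Rightarrow> nat" where
  "mult_order z = group.ord (units_of (ring_of_type_algebra :: 'k ring)) z"

definition primitive_root_of_unity :: "nat \<Rightarrow> 'k::field \<Rightarrow> bool" where
  "primitive_root_of_unity n q \<longleftrightarrow> 0 < n \<and> q ^ n = 1 \<and> (\<forall>m. 0 < m \<and> m < n \<longrightarrow> q ^ m \<noteq> 1)"

definition H_params :: "nat \<Rightarrow> 'k::field \<Rightarrow> nat \<Rightarrow> nat \<Rightarrow> bool" where
  "H_params n q N \<nu> \<longleftrightarrow>
    0 < n \<and> 0 < N \<and> n dvd N \<and> 1 \<le> \<nu> \<and> \<nu> < N \<and> primitive_root_of_unity n q"

datatype gen = Gen_a | Gen_x

type_synonym 'k H_elem = "(gen list \<Rightarrow>\<^sub>0 'k) set"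

text \<open>
  The constants below do not take the index \<open>n\<close> of \<open>H\<^bsub>n,q,N,\<nu>\<^esub>\<close> as an argument: it is the order
  of \<open>q\<close>, and does not otherwise occur in the presentation.  That the indices are admissible is
  expressed by \<open>H_params n q N \<nu>\<close>.
\<close>

definition H_relations :: "'k::field \<Rightarrow> nat \<Rightarrow> nat \<Rightarrow> (gen list \<Rightarrow>\<^sub>0 'k) set" where
  "H_relations q N \<nu> =
    {Poly_Mapping.single (replicate N Gen_a) 1 - Poly_Mapping.single [] 1,
     Poly_Mapping.single (replicate (mult_order (q ^ \<nu>)) Gen_x) 1,
     Poly_Mapping.single [Gen_x, Gen_a] 1 - Poly_Mapping.single [Gen_a, Gen_x] q}"

definition H_ideal :: "'k::field \<Rightarrow> nat \<Rightarrow> nat \<Rightarrow> (gen list \<Rightarrow>\<^sub>0 'k) set" where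
  "H_ideal q N \<nu> = Idl\<^bsub>(free_algebra :: ('k, gen list \<Rightarrow>\<^sub>0 'k) module)\<^esub> (H_relations q N \<nu>)"

definition H_algebra :: "'k::field \<Rightarrow> nat \<Rightarrow> nat \<Rightarrow> ('k, 'k H_elem) module" where
  "H_algebra q N \<nu> = quot_algebra free_algebra (H_ideal q N \<nu>)"

definition H_gen :: "'k::field \<Rightarrow> nat \<Rightarrow> nat \<Rightarrow> gen \<Rightarrow> 'k H_elem" where
  "H_gen q N \<nu> g =
    H_ideal q N \<nu> +>\<^bsub>(free_algebra :: ('k, gen list \<Rightarrow>\<^sub>0 'k) module)\<^esub> Poly_Mapping.single [g] 1"

abbreviation H_a :: "'k::field \<Rightarrow> nat \<Rightarrow> nat \<Rightarrow> 'k H_elem" where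
  "H_a q N \<nu> \<equiv> H_gen q N \<nu> Gen_a"

abbreviation H_x :: "'k::field \<Rightarrow> nat \<Rightarrow> nat \<Rightarrow> 'k H_elem" where
  "H_x q N \<nu> \<equiv> H_gen q N \<nu> Gen_x"

text \<open>
  \<open>\<Delta>\<close> and \<open>\<epsilon>\<close> are the algebra maps, and \<open>s\<close> is the algebra antihomomorphism, with the prescribed
  values on the generators.
\<close>

definition H_hopf :: "'k::field \<Rightarrow> nat \<Rightarrow> nat \<Rightarrow> ('k, 'k H_elem) hopf" where
  "H_hopf q N \<nu> =
    (let A = H_algebra q N \<nu>; a = H_a q N \<nu>; x = H_x q N \<nu>; T = tensor_algebra A A
     in \<lparr>carrier = carrier A, monoid.mult = monoid.mult A, one = one A, ring.zero = ring.zero A,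
         ring.add = ring.add A, module.smult = module.smult A,
         comult = quot_map (free_ext T
           (case_gen (pure_tensor A A a a)
                     (pure_tensor A A x (a [^]\<^bsub>A\<^esub> \<nu>) \<oplus>\<^bsub>T\<^esub> pure_tensor A A \<one>\<^bsub>A\<^esub> x))),
         counit = quot_map (free_ext ground_algebra (case_gen 1 0)),
         antipode = quot_map (free_ext (opposite_algebra A)
           (case_gen (inv\<^bsub>A\<^esub> a)
                     ((- inverse (q ^ \<nu>)) \<odot>\<^bsub>A\<^esub> ((inv\<^bsub>A\<^esub> a) [^]\<^bsub>A\<^esub> \<nu> \<otimes>\<^bsub>A\<^esub> x))))\<rparr>)"

end

theory Submission
  imports Defs
begin

text \<open>
  \<open>H\<close> has the basis \<open>a\<^sup>j x\<^sup>i\<close> with \<open>0 \<le> j < N\<close>, \<open>0 \<le> i < r\<close>, and \<open>\<Delta>(a\<^sup>j x\<^sup>i)\<close> is a combination of the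
  \<open>a\<^sup>j x\<^sup>t \<otimes> a\<^bsup>j + \<nu> t\<^esup> x\<^bsup>i - t\<^esup>\<close> with the \<open>q\<^sup>\<nu>\<close>-binomial coefficients.  Applying coordinate functionals to
  either tensor factor of \<open>\<Delta>(b)\<close>, \<open>b \<in> B\<close>, stays inside \<open>B\<close>.  The functional of \<open>a\<^sup>j\<close> on the left cuts out
  the terms of \<open>b\<close> in \<open>a\<^sup>j x\<^sup>i\<close>, \<open>i\<close> arbitrary, and that of \<open>a\<^bsup>j + \<nu> i\<^esup>\<close> on the right then cuts out a single
  term, because \<open>\<nu> i\<close> modulo \<open>N\<close> determines \<open>i < r\<close>.  So \<open>B\<close> is spanned by the monomials it contains.
  If all of them are powers of \<open>a\<close>, then \<open>B = kG(B)\<close>.  Otherwise some \<open>a\<^sup>j x\<^sup>i \<in> B\<close> with \<open>0 < i\<close>, and the same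
  functionals give \<open>a\<^sup>j, a\<^sup>j x \<in> B\<close>, hence \<open>x \<in> B\<close> and \<open>a\<^sup>\<nu> \<in> B\<close>; the exponents \<open>j\<close> with \<open>a\<^sup>j \<in> B\<close> form a
  subgroup \<open>d\<int>\<close> containing \<open>N\<close> and \<open>\<nu>\<close>, and \<open>s = N / d\<close>.
\<close>

section \<open>Monoid algebras\<close>

text \<open>\<open>H\<close> is given as a quotient of a free algebra, so the obstacle is the linear
  independence of the monomials, in \<open>H\<close> and again in the tensor square. One device
  settles both: a multiplicative map into functions on a finite index set, with a product given by
  structure constants, is shown to have exactly the defining ideal (or the span of the bilinearity
  relations) as its kernel. Cosets are then fibres, and later claims are identities between
  functions.

  The arithmetic rests on \<open>p = q ^ \<nu>\<close> having order exactly \<open>r\<close>. As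
  \<open>q ^ N = 1\<close>, the power \<open>p^i\<close> depends only on \<open>\<nu> i\<close>
  modulo \<open>N\<close>, and \<open>p^i\<close> determines \<open>i < r\<close>. The Gaussian
  binomials at \<open>p\<close> vanish in row \<open>r\<close> except at both ends, so
  \<open>\<Delta>\<close> respects \<open>x^r = 0\<close>; in column 1 they are nonzero in the rows
  \<open>0 < i < r\<close>, which is how \<open>a^j x\<close> is extracted from
  \<open>a^j x^i\<close> in any characteristic. On the side of the subalgebra,
  \<open>(q ^ d) ^ (\<nu> div d)\<close> is the same \<open>p\<close>, so \<open>r\<close> and all
  binomials agree, and \<open>a \<mapsto> a^d\<close> matches the structure constants
  exactly.\<close>

definition lin_comb :: "('w \<Rightarrow> 'i \<Rightarrow> 'k::field) \<Rightarrow> ('w \<Rightarrow>\<^sub>0 'k) \<Rightarrow> 'i \<Rightarrow> 'k" where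
  "lin_comb \<beta> f = (\<lambda>i. \<Sum>w\<in>Poly_Mapping.keys f. Poly_Mapping.lookup f w * \<beta> w i)"

text \<open>Supports shrink under cancellation, so sums with different supports are compared over a
  common finite set containing all of them.\<close>

lemma lin_comb_superset:
  assumes "finite W" "Poly_Mapping.keys f \<subseteq> W"
  shows "lin_comb \<beta> f i = (\<Sum>w\<in>W. Poly_Mapping.lookup f w * \<beta> w i)"
  unfolding lin_comb_def using assms
  by (intro sum.mono_neutral_left) (auto simp: in_keys_iff)

lemma lin_comb_zero [simp]: "lin_comb \<beta> 0 = (\<lambda>_. 0)"
  by (simp add: lin_comb_def)

lemma lin_comb_add: "lin_comb \<beta> (f + g) = (\<lambda>i. lin_comb \<beta> f i + lin_comb \<beta> g i)"
proof
  fix i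
  let ?W = "Poly_Mapping.keys f \<union> Poly_Mapping.keys g"
  have "lin_comb \<beta> (f + g) i = (\<Sum>w\<in>?W. Poly_Mapping.lookup (f + g) w * \<beta> w i)"
    by (intro lin_comb_superset) (use Poly_Mapping.keys_add[of f g] in auto)
  also have "\<dots> = lin_comb \<beta> f i + lin_comb \<beta> g i"
    by (simp add: lin_comb_superset[of ?W f] lin_comb_superset[of ?W g] lookup_add
        algebra_simps sum.distrib)
  finally show "lin_comb \<beta> (f + g) i = lin_comb \<beta> f i + lin_comb \<beta> g i" .
qed

lemma keys_uminus: "Poly_Mapping.keys (- f) = Poly_Mapping.keys (f :: 'w \<Rightarrow>\<^sub>0 'k::ab_group_add)"
  by (auto simp: in_keys_iff)

lemma lin_comb_uminus: "lin_comb \<beta> (- f) = (\<lambda>i. - lin_comb \<beta> f i)"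
  by (simp add: lin_comb_def keys_uminus sum_negf)

lemma lin_comb_diff: "lin_comb \<beta> (f - g) = (\<lambda>i. lin_comb \<beta> f i - lin_comb \<beta> g i)"
  using lin_comb_add[of \<beta> f "- g"] by (simp add: lin_comb_uminus)

lemma lin_comb_single [simp]: "lin_comb \<beta> (Poly_Mapping.single w c) = (\<lambda>i. c * \<beta> w i)"
  by (auto simp: lin_comb_def fun_eq_iff)

lemma lookup_scale: "Poly_Mapping.lookup (Poly_Mapping.map ((*) (c::'k::field)) f) w = c * Poly_Mapping.lookup f w"
  by (simp add: Poly_Mapping.map.rep_eq when_def)

lemma keys_scale: "Poly_Mapping.keys (Poly_Mapping.map ((*) (c::'k::field)) f) \<subseteq> Poly_Mapping.keys f"
  by (auto simp: in_keys_iff lookup_scale)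

lemma lin_comb_scale: "lin_comb \<beta> (Poly_Mapping.map ((*) c) f) = (\<lambda>i. c * lin_comb \<beta> f i)"
proof
  fix i
  have "lin_comb \<beta> (Poly_Mapping.map ((*) c) f) i =
      (\<Sum>w\<in>Poly_Mapping.keys f. Poly_Mapping.lookup (Poly_Mapping.map ((*) c) f) w * \<beta> w i)"
    by (rule lin_comb_superset[OF finite_keys keys_scale])
  then show "lin_comb \<beta> (Poly_Mapping.map ((*) c) f) i = c * lin_comb \<beta> f i"
    by (simp add: lookup_scale lin_comb_def sum_distrib_left mult.assoc)
qed

lemma lin_comb_sum: "lin_comb \<beta> (\<Sum>w\<in>W. F w) = (\<lambda>i. \<Sum>w\<in>W. lin_comb \<beta> (F w) i)"
  by (induction W rule: infinite_finite_induct) (auto simp: lin_comb_add)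

lemma scale_diff: "Poly_Mapping.map ((*) (k::'k::field)) (f - g) = Poly_Mapping.map ((*) k) f - Poly_Mapping.map ((*) k) g"
  by (rule poly_mapping_eqI) (simp add: lookup_scale lookup_minus algebra_simps)

lemma scale_sum: "Poly_Mapping.map ((*) (k::'k::field)) (\<Sum>w\<in>W. F w) = (\<Sum>w\<in>W. Poly_Mapping.map ((*) k) (F w))"
  by (rule poly_mapping_eqI) (simp add: lookup_scale lookup_sum sum_distrib_left)

lemma scale_single [simp]:
  "Poly_Mapping.map ((*) (k::'k::field)) (Poly_Mapping.single w a) = Poly_Mapping.single w (k * a)"
  by (rule poly_mapping_eqI) (simp add: lookup_scale lookup_single when_def)

lemma single_sum: "Poly_Mapping.single w (\<Sum>i\<in>S. a i) = (\<Sum>i\<in>S. Poly_Mapping.single w (a i))"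
  by (rule poly_mapping_eqI) (simp add: lookup_sum lookup_single when_def)

lemma poly_mapping_sum_single:
  "f = (\<Sum>w\<in>Poly_Mapping.keys f. Poly_Mapping.single w (Poly_Mapping.lookup f w))"
  by (rule poly_mapping_eqI)
    (auto simp: lookup_sum lookup_single when_def in_keys_iff sum.delta')

text \<open>Naming the product apart from the record makes it bilinear on all finitely supported
  functions, with no carrier conditions to carry along.\<close>

definition monoid_algebra_mult ::
    "('w, 'm) monoid_scheme \<Rightarrow> ('w \<Rightarrow>\<^sub>0 'k::field) \<Rightarrow> ('w \<Rightarrow>\<^sub>0 'k) \<Rightarrow> ('w \<Rightarrow>\<^sub>0 'k)" where
  "monoid_algebra_mult M f g = (\<Sum>u\<in>Poly_Mapping.keys f. \<Sum>v\<in>Poly_Mapping.keys g.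
        Poly_Mapping.single (u \<otimes>\<^bsub>M\<^esub> v) (Poly_Mapping.lookup f u * Poly_Mapping.lookup g v))"

lemma monoid_algebra_simps [simp]:
  "carrier (monoid_algebra M) = {f. Poly_Mapping.keys f \<subseteq> carrier M}"
  "f \<otimes>\<^bsub>monoid_algebra M\<^esub> g = monoid_algebra_mult M f g"
  "\<one>\<^bsub>monoid_algebra M\<^esub> = Poly_Mapping.single \<one>\<^bsub>M\<^esub> 1"
  "\<zero>\<^bsub>monoid_algebra M\<^esub> = 0"
  "f \<oplus>\<^bsub>monoid_algebra M\<^esub> g = f + g"
  "c \<odot>\<^bsub>monoid_algebra M\<^esub> f = Poly_Mapping.map ((*) c) f"
  by (simp_all add: monoid_algebra_def monoid_algebra_mult_def)

lemma monoid_algebra_mult_superset: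
  assumes "finite U" "Poly_Mapping.keys f \<subseteq> U" "finite V" "Poly_Mapping.keys g \<subseteq> V"
  shows "monoid_algebra_mult M f g = (\<Sum>u\<in>U. \<Sum>v\<in>V.
        Poly_Mapping.single (u \<otimes>\<^bsub>M\<^esub> v) (Poly_Mapping.lookup f u * Poly_Mapping.lookup g v))"
proof -
  have "monoid_algebra_mult M f g = (\<Sum>u\<in>Poly_Mapping.keys f. \<Sum>v\<in>V.
        Poly_Mapping.single (u \<otimes>\<^bsub>M\<^esub> v) (Poly_Mapping.lookup f u * Poly_Mapping.lookup g v))"
    unfolding monoid_algebra_mult_def using assms
    by (intro sum.cong refl sum.mono_neutral_left) (auto simp: in_keys_iff)
  also have "\<dots> = (\<Sum>u\<in>U. \<Sum>v\<in>V.
        Poly_Mapping.single (u \<otimes>\<^bsub>M\<^esub> v) (Poly_Mapping.lookup f u * Poly_Mapping.lookup g v))"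
    using assms by (intro sum.mono_neutral_left) (auto simp: in_keys_iff)
  finally show ?thesis .
qed

lemma monoid_algebra_mult_add_left:
  "monoid_algebra_mult M (f + f') g = monoid_algebra_mult M f g + monoid_algebra_mult M f' g"
proof -
  let ?U = "Poly_Mapping.keys f \<union> Poly_Mapping.keys f'"
  note * = monoid_algebra_mult_superset[of ?U _ "Poly_Mapping.keys g" g M]
  show ?thesis using Poly_Mapping.keys_add[of f f']
    by (subst (1 2 3) *) (auto simp: lookup_add algebra_simps single_add sum.distrib)
qed

lemma monoid_algebra_mult_add_right:
  "monoid_algebra_mult M g (f + f') = monoid_algebra_mult M g f + monoid_algebra_mult M g f'"
proof -
  let ?U = "Poly_Mapping.keys f \<union> Poly_Mapping.keys f'"
  note * = monoid_algebra_mult_superset[of "Poly_Mapping.keys g" g ?U _ M]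
  show ?thesis using Poly_Mapping.keys_add[of f f']
    by (subst (1 2 3) *) (auto simp: lookup_add algebra_simps single_add sum.distrib)
qed

lemma monoid_algebra_mult_diff_left:
  "monoid_algebra_mult M (f - g) h = monoid_algebra_mult M f h - monoid_algebra_mult M g h"
  using monoid_algebra_mult_add_left[of M "f - g" g h] by simp

lemma monoid_algebra_mult_diff_right:
  "monoid_algebra_mult M h (f - g) = monoid_algebra_mult M h f - monoid_algebra_mult M h g"
  using monoid_algebra_mult_add_right[of M h "f - g" g] by simp

lemma monoid_algebra_mult_zero [simp]:
  "monoid_algebra_mult M 0 g = 0" "monoid_algebra_mult M g 0 = 0"
  by (simp_all add: monoid_algebra_mult_def)

lemma monoid_algebra_mult_single [simp]:
  "monoid_algebra_mult M (Poly_Mapping.single u a) (Poly_Mapping.single v b) =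
    Poly_Mapping.single (u \<otimes>\<^bsub>M\<^esub> v) (a * b)"
  by (simp add: monoid_algebra_mult_def)

lemma monoid_algebra_mult_sum_left:
  "monoid_algebra_mult M (\<Sum>w\<in>W. F w) g = (\<Sum>w\<in>W. monoid_algebra_mult M (F w) g)"
  by (induction W rule: infinite_finite_induct) (auto simp: monoid_algebra_mult_add_left)

lemma monoid_algebra_mult_sum_right:
  "monoid_algebra_mult M g (\<Sum>w\<in>W. F w) = (\<Sum>w\<in>W. monoid_algebra_mult M g (F w))"
  by (induction W rule: infinite_finite_induct) (auto simp: monoid_algebra_mult_add_right)

lemma keys_sum_subset:
  assumes "\<And>w. w \<in> W \<Longrightarrow> Poly_Mapping.keys (F w) \<subseteq> S"
  shows "Poly_Mapping.keys (\<Sum>w\<in>W. F w) \<subseteq> S"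
  using assms
proof (induction W rule: infinite_finite_induct)
  case (insert w W)
  then show ?case using Poly_Mapping.keys_add[of "F w" "\<Sum>w\<in>W. F w"] by fastforce
qed auto

lemma keys_monoid_algebra_mult:
  assumes "Poly_Mapping.keys f \<subseteq> carrier M" "Poly_Mapping.keys g \<subseteq> carrier M"
    "\<And>u v. u \<in> carrier M \<Longrightarrow> v \<in> carrier M \<Longrightarrow> u \<otimes>\<^bsub>M\<^esub> v \<in> carrier M"
  shows "Poly_Mapping.keys (monoid_algebra_mult M f g) \<subseteq> carrier M"
  unfolding monoid_algebra_mult_def
  by (intro keys_sum_subset) (use assms in auto)

lemma abelian_group_monoid_algebra:
  "abelian_group (monoid_algebra M :: ('k::field, 'w \<Rightarrow>\<^sub>0 'k) module)"
proof (rule abelian_groupI)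
  fix f :: "'w \<Rightarrow>\<^sub>0 'k" assume "f \<in> carrier (monoid_algebra M)"
  then show "\<exists>g\<in>carrier (monoid_algebra M). g \<oplus>\<^bsub>monoid_algebra M\<^esub> f = \<zero>\<^bsub>monoid_algebra M\<^esub>"
    by (intro bexI[of _ "- f"]) (auto simp: keys_uminus)
qed (auto simp: add_ac dest!: set_mp[OF Poly_Mapping.keys_add])

lemma a_inv_monoid_algebra:
  assumes "f \<in> carrier (monoid_algebra M)"
  shows "\<ominus>\<^bsub>monoid_algebra M\<^esub> f = - f"
proof -
  interpret abelian_group "monoid_algebra M" by (rule abelian_group_monoid_algebra)
  show ?thesis using assms by (intro minus_equality) (auto simp: keys_uminus)
qed

lemma ring_monoid_algebra:
  assumes "Group.monoid M"
  shows "ring (monoid_algebra M :: ('k::field, 'w \<Rightarrow>\<^sub>0 'k) module)"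
proof -
  interpret Group.monoid M by fact
  have assoc: "monoid_algebra_mult M (monoid_algebra_mult M f g) h =
      monoid_algebra_mult M f (monoid_algebra_mult M g h)"
    if "Poly_Mapping.keys f \<subseteq> carrier M" "Poly_Mapping.keys g \<subseteq> carrier M"
      "Poly_Mapping.keys h \<subseteq> carrier M" for f g h :: "'w \<Rightarrow>\<^sub>0 'k"
  proof -
    let ?s = "\<lambda>f u. Poly_Mapping.single u (Poly_Mapping.lookup f u :: 'k)"
    have "monoid_algebra_mult M (monoid_algebra_mult M f g) h =
      monoid_algebra_mult M (monoid_algebra_mult M f g) (\<Sum>w\<in>Poly_Mapping.keys h. ?s h w)"
      by (simp flip: poly_mapping_sum_single)
    also have "\<dots> = (\<Sum>w\<in>Poly_Mapping.keys h. \<Sum>u\<in>Poly_Mapping.keys f. \<Sum>v\<in>Poly_Mapping.keys g.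
       Poly_Mapping.single ((u \<otimes>\<^bsub>M\<^esub> v) \<otimes>\<^bsub>M\<^esub> w)
         (Poly_Mapping.lookup f u * Poly_Mapping.lookup g v * Poly_Mapping.lookup h w))"
      unfolding monoid_algebra_mult_def[of M f g]
      by (simp add: monoid_algebra_mult_sum_left monoid_algebra_mult_sum_right)
    also have "\<dots> = (\<Sum>u\<in>Poly_Mapping.keys f. \<Sum>v\<in>Poly_Mapping.keys g. \<Sum>w\<in>Poly_Mapping.keys h. 
       Poly_Mapping.single ((u \<otimes>\<^bsub>M\<^esub> v) \<otimes>\<^bsub>M\<^esub> w)
         (Poly_Mapping.lookup f u * Poly_Mapping.lookup g v * Poly_Mapping.lookup h w))"
      by (subst sum.swap, rule sum.cong[OF refl], rule sum.swap)
    also have "\<dots> = (\<Sum>u\<in>Poly_Mapping.keys f. \<Sum>v\<in>Poly_Mapping.keys g. \<Sum>w\<in>Poly_Mapping.keys h. 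
       Poly_Mapping.single (u \<otimes>\<^bsub>M\<^esub> (v \<otimes>\<^bsub>M\<^esub> w))
         (Poly_Mapping.lookup f u * (Poly_Mapping.lookup g v * Poly_Mapping.lookup h w)))"
      using that by (intro sum.cong refl arg_cong2[of _ _ _ _ Poly_Mapping.single]) (auto intro!: m_assoc)
    also have "\<dots> = (\<Sum>u\<in>Poly_Mapping.keys f. monoid_algebra_mult M (?s f u) (monoid_algebra_mult M g h))"
      unfolding monoid_algebra_mult_def[of M g h]
      by (simp add: monoid_algebra_mult_sum_right)
    also have "\<dots> = monoid_algebra_mult M (\<Sum>u\<in>Poly_Mapping.keys f. ?s f u) (monoid_algebra_mult M g h)"
      by (simp only: monoid_algebra_mult_sum_left)
    finally show ?thesis by (simp flip: poly_mapping_sum_single)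
  qed
  have one: "monoid_algebra_mult M (Poly_Mapping.single \<one>\<^bsub>M\<^esub> 1) f = f"
    "monoid_algebra_mult M f (Poly_Mapping.single \<one>\<^bsub>M\<^esub> 1) = f"
    if "Poly_Mapping.keys f \<subseteq> carrier M" for f :: "'w \<Rightarrow>\<^sub>0 'k"
  proof -
    have "(\<Sum>w\<in>Poly_Mapping.keys f. Poly_Mapping.single (\<one>\<^bsub>M\<^esub> \<otimes>\<^bsub>M\<^esub> w) (Poly_Mapping.lookup f w)) = f"
      "(\<Sum>w\<in>Poly_Mapping.keys f. Poly_Mapping.single (w \<otimes>\<^bsub>M\<^esub> \<one>\<^bsub>M\<^esub>) (Poly_Mapping.lookup f w)) = f"
      using that by (subst (3) poly_mapping_sum_single, intro sum.cong; auto)+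
    then show "monoid_algebra_mult M (Poly_Mapping.single \<one>\<^bsub>M\<^esub> 1) f = f"
     "monoid_algebra_mult M f (Poly_Mapping.single \<one>\<^bsub>M\<^esub> 1) = f"
      by (simp_all add: monoid_algebra_mult_def)
  qed
  have "Group.monoid (monoid_algebra M :: ('k, 'w \<Rightarrow>\<^sub>0 'k) module)"
    by (rule monoidI) (simp_all add: assoc one keys_monoid_algebra_mult)
  then show ?thesis
    by (intro ringI abelian_group_monoid_algebra)
      (auto simp: monoid_algebra_mult_add_left monoid_algebra_mult_add_right)
qed

section \<open>Algebras in coordinates\<close>

text \<open>Total functions vanishing off \<open>J\<close> instead of functions on \<open>J\<close>:
  coordinate vectors are then compared by plain equality of functions.\<close>

definition coords :: "'i set \<Rightarrow> ('i \<Rightarrow> 'k::field) set" where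
  "coords J = {c. \<forall>i. i \<notin> J \<longrightarrow> c i = 0}"

definition unit_coord :: "'i \<Rightarrow> 'i \<Rightarrow> 'k::field" where
  "unit_coord i = (\<lambda>j. if j = i then 1 else 0)"

definition struct_mult ::
    "'i set \<Rightarrow> ('i \<Rightarrow> 'i \<Rightarrow> 'i \<Rightarrow> 'k::field) \<Rightarrow> ('i \<Rightarrow> 'k) \<Rightarrow> ('i \<Rightarrow> 'k) \<Rightarrow> 'i \<Rightarrow> 'k" where
  "struct_mult J st c d = (\<lambda>w. \<Sum>u\<in>J. \<Sum>v\<in>J. c u * d v * st u v w)"

lemma coords_zero [simp]: "(\<lambda>_. 0) \<in> coords J"
  by (simp add: coords_def)

lemma coords_add: "c \<in> coords J \<Longrightarrow> d \<in> coords J \<Longrightarrow> (\<lambda>i. c i + d i) \<in> coords J"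
  by (simp add: coords_def)

lemma coords_scale: "c \<in> coords J \<Longrightarrow> (\<lambda>i. k * c i) \<in> coords J"
  by (simp add: coords_def)

lemma coords_uminus: "c \<in> coords J \<Longrightarrow> (\<lambda>i. - c i) \<in> coords J"
  by (simp add: coords_def)

lemma coords_sum: "(\<And>w. w \<in> W \<Longrightarrow> F w \<in> coords J) \<Longrightarrow> (\<lambda>i. \<Sum>w\<in>W. F w i) \<in> coords J"
  by (auto simp: coords_def intro!: sum.neutral)

lemma coords_lin_comb:
  "(\<And>w. w \<in> Poly_Mapping.keys f \<Longrightarrow> \<beta> w \<in> coords J) \<Longrightarrow> lin_comb \<beta> f \<in> coords J"
  unfolding lin_comb_def by (intro coords_sum coords_scale)

lemma unit_coord_coords [simp]: "i \<in> J \<Longrightarrow> unit_coord i \<in> coords J"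
  by (auto simp: coords_def unit_coord_def)

lemma coords_sum_unit:
  assumes "finite J" "c \<in> coords J"
  shows "c = (\<lambda>j. \<Sum>i\<in>J. c i * unit_coord i j)"
proof
  fix j
  have "(\<Sum>i\<in>J. c i * unit_coord i j) = (\<Sum>i\<in>J. if j = i then c i else 0)"
    by (rule sum.cong) (auto simp: unit_coord_def)
  then show "c j = (\<Sum>i\<in>J. c i * unit_coord i j)"
    using assms by (auto simp: coords_def)
qed

text \<open>By bilinearity, a product identity for all vectors follows from the one for the values
  of \<open>\<beta>\<close> and \<open>\<gamma>\<close>; this is how multiplicativity comes to be
  checked on words only.\<close>

lemma struct_mult_lin_comb:
  "struct_mult J st (lin_comb \<beta> f) (lin_comb \<gamma> g) w =
    (\<Sum>u\<in>Poly_Mapping.keys f. \<Sum>v\<in>Poly_Mapping.keys g.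
      Poly_Mapping.lookup f u * Poly_Mapping.lookup g v * struct_mult J st (\<beta> u) (\<gamma> v) w)"
proof -
  let ?F = "Poly_Mapping.keys f" and ?G = "Poly_Mapping.keys g"
  let ?t = "\<lambda>i j u v. Poly_Mapping.lookup f u * Poly_Mapping.lookup g v * (\<beta> u i * \<gamma> v j * st i j w)"
  have "struct_mult J st (lin_comb \<beta> f) (lin_comb \<gamma> g) w = (\<Sum>i\<in>J. \<Sum>j\<in>J. \<Sum>u\<in>?F. \<Sum>v\<in>?G. ?t i j u v)"
    unfolding struct_mult_def lin_comb_def
    by (intro sum.cong refl, subst sum_product, subst sum_distrib_right, intro sum.cong refl,
        subst sum_distrib_right, intro sum.cong refl) (simp add: algebra_simps)
  also have "\<dots> = (\<Sum>i\<in>J. \<Sum>u\<in>?F. \<Sum>v\<in>?G. \<Sum>j\<in>J. ?t i j u v)"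
    by (intro sum.cong refl, subst sum.swap, intro sum.cong refl, rule sum.swap)
  also have "\<dots> = (\<Sum>u\<in>?F. \<Sum>v\<in>?G. \<Sum>i\<in>J. \<Sum>j\<in>J. ?t i j u v)"
    by (subst sum.swap, intro sum.cong refl, rule sum.swap)
  also have "\<dots> = (\<Sum>u\<in>?F. \<Sum>v\<in>?G. Poly_Mapping.lookup f u * Poly_Mapping.lookup g v * struct_mult J st (\<beta> u) (\<gamma> v) w)"
    unfolding struct_mult_def by (simp add: sum_distrib_left)
  finally show ?thesis .
qed

lemma struct_mult_scale:
  "struct_mult J st (\<lambda>i. k * c i) d = (\<lambda>i. k * struct_mult J st c d i)"
  "struct_mult J st c (\<lambda>i. k * d i) = (\<lambda>i. k * struct_mult J st c d i)"
  by (simp_all add: struct_mult_def sum_distrib_left mult_ac fun_eq_iff)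

lemma struct_mult_unit:
  assumes "finite J" "u \<in> J" "v \<in> J"
  shows "struct_mult J st (unit_coord u) (unit_coord v) = st u v"
proof
  fix w
  have "struct_mult J st (unit_coord u) (unit_coord v) w =
      (\<Sum>u'\<in>J. \<Sum>v'\<in>J. if v' = v then (if u' = u then st u v w else 0) else 0)"
    unfolding struct_mult_def by (intro sum.cong) (auto simp: unit_coord_def)
  also have "\<dots> = st u v w"
    using assms by simp
  finally show "struct_mult J st (unit_coord u) (unit_coord v) w = st u v w" .
qed

lemma struct_mult_zero [simp]:
  "struct_mult J st (\<lambda>_. 0) d = (\<lambda>_. 0)" "struct_mult J st c (\<lambda>_. 0) = (\<lambda>_. 0)"
  by (simp_all add: struct_mult_def)

lemma struct_mult_add_left:
  "struct_mult J st (\<lambda>i. c i + c' i) d = (\<lambda>i. struct_mult J st c d i + struct_mult J st c' d i)"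
  by (simp add: struct_mult_def sum.distrib algebra_simps fun_eq_iff)

lemma struct_mult_sum_right:
  "struct_mult J st c (\<lambda>i. \<Sum>w\<in>W. k w * F w i) = (\<lambda>i. \<Sum>w\<in>W. k w * struct_mult J st c (F w) i)"
proof
  fix i
  have "struct_mult J st c (\<lambda>i. \<Sum>w\<in>W. k w * F w i) i =
     (\<Sum>u\<in>J. \<Sum>v\<in>J. \<Sum>w\<in>W. k w * (c u * F w v * st u v i))"
    unfolding struct_mult_def by (simp add: sum_distrib_left sum_distrib_right mult_ac)
  also have "\<dots> = (\<Sum>u\<in>J. \<Sum>w\<in>W. \<Sum>v\<in>J. k w * (c u * F w v * st u v i))"
    by (intro sum.cong refl sum.swap)
  also have "\<dots> = (\<Sum>w\<in>W. \<Sum>u\<in>J. \<Sum>v\<in>J. k w * (c u * F w v * st u v i))"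
    by (rule sum.swap)
  finally show "struct_mult J st c (\<lambda>i. \<Sum>w\<in>W. k w * F w i) i = (\<Sum>w\<in>W. k w * struct_mult J st c (F w) i)"
    by (simp add: struct_mult_def sum_distrib_left)
qed

text \<open>\<open>the_elem\<close> is meaningful only on a singleton: the coset must be nonempty
  and \<open>g\<close> constant on it.\<close>

lemma quot_map_eqI:
  assumes "C \<noteq> {}" "\<And>f. f \<in> C \<Longrightarrow> g f = y"
  shows "quot_map g C = y"
proof -
  have "g ` C = {y}" using assms by auto
  then show ?thesis by (simp add: quot_map_def)
qed

lemma k_subspace_iff:
  fixes A :: "('k::field, 'h, 'm) module_scheme"
  assumes "abelian_group A"
  shows "k_subspace V A \<longleftrightarrow> V \<subseteq> carrier A \<and> \<zero>\<^bsub>A\<^esub> \<in> V \<and> (\<forall>u\<in>V. \<forall>v\<in>V. u \<oplus>\<^bsub>A\<^esub> v \<in> V) \<and>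
    (\<forall>v\<in>V. \<ominus>\<^bsub>A\<^esub> v \<in> V) \<and> (\<forall>c. \<forall>v\<in>V. c \<odot>\<^bsub>A\<^esub> v \<in> V)"
  by (auto simp: k_subspace_def submodule_def subgroup_def submodule_axioms_def
      ring_of_type_algebra_def a_inv_def)

lemma k_subspace_monoid_algebra_iff:
  fixes M :: "('w, 'm) monoid_scheme" and V :: "('w \<Rightarrow>\<^sub>0 'k::field) set"
  shows "k_subspace V (monoid_algebra M) \<longleftrightarrow>
    (\<forall>f\<in>V. Poly_Mapping.keys f \<subseteq> carrier M) \<and> 0 \<in> V \<and> (\<forall>u\<in>V. \<forall>v\<in>V. u + v \<in> V) \<and>
    (\<forall>c. \<forall>v\<in>V. Poly_Mapping.map ((*) c) v \<in> V)" (is "?l \<longleftrightarrow> ?r")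
proof
  assume ?r
  \<comment> \<open>Closure under negatives comes from scaling by -1.\<close>
  have "- f = Poly_Mapping.map ((*) (-1)) f" for f :: "'w \<Rightarrow>\<^sub>0 'k"
    by (rule poly_mapping_eqI) (simp add: lookup_scale)
  with \<open>?r\<close> show ?l
    by (auto simp: k_subspace_iff[OF abelian_group_monoid_algebra] a_inv_monoid_algebra)
qed (auto simp: k_subspace_iff[OF abelian_group_monoid_algebra])

lemma closed_sum:
  fixes F :: "'s \<Rightarrow> 'w \<Rightarrow>\<^sub>0 'k::field"
  assumes "0 \<in> V" "\<And>u v. u \<in> V \<Longrightarrow> v \<in> V \<Longrightarrow> u + v \<in> V" "\<And>w. w \<in> W \<Longrightarrow> F w \<in> V"
  shows "(\<Sum>w\<in>W. F w) \<in> V"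
  using assms(3) by (induction W rule: infinite_finite_induct) (use assms in auto)

text \<open>\<open>fib\<close> identifies \<open>Q\<close> with the functions supported on the finite set \<open>J\<close>; \<open>st u v w\<close> is the
  coefficient of the basis element \<open>w\<close> in the product of the basis elements \<open>u\<close> and \<open>v\<close>.\<close>

locale coord_algebra =
  fixes Q :: "('k::field, 'h, 'm) module_scheme" and J :: "'i set"
    and st :: "'i \<Rightarrow> 'i \<Rightarrow> 'i \<Rightarrow> 'k" and e :: "'i \<Rightarrow> 'k" and fib :: "('i \<Rightarrow> 'k) \<Rightarrow> 'h"
  assumes finite_J: "finite J"
    and st_outside: "\<And>u v w. w \<notin> J \<Longrightarrow> st u v w = 0"
    and one_coords: "e \<in> coords J"
    and carrier_eq: "carrier Q = fib ` coords J"
    and fib_inj: "inj_on fib (coords J)"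
    and fib_zero: "\<zero>\<^bsub>Q\<^esub> = fib (\<lambda>_. 0)"
    and fib_one: "\<one>\<^bsub>Q\<^esub> = fib e"
    and fib_add: "\<And>c d. c \<in> coords J \<Longrightarrow> d \<in> coords J \<Longrightarrow> fib c \<oplus>\<^bsub>Q\<^esub> fib d = fib (\<lambda>i. c i + d i)"
    and fib_mult: "\<And>c d. c \<in> coords J \<Longrightarrow> d \<in> coords J \<Longrightarrow> fib c \<otimes>\<^bsub>Q\<^esub> fib d = fib (struct_mult J st c d)"
    and fib_smult: "\<And>k c. c \<in> coords J \<Longrightarrow> k \<odot>\<^bsub>Q\<^esub> fib c = fib (\<lambda>i. k * c i)"
begin

definition crd :: "'h \<Rightarrow> 'i \<Rightarrow> 'k" where
  "crd = inv_into (coords J) fib"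

lemma crd_fib [simp]: "c \<in> coords J \<Longrightarrow> crd (fib c) = c"
  by (simp add: crd_def fib_inj)

lemma fib_crd [simp]: "h \<in> carrier Q \<Longrightarrow> fib (crd h) = h"
  by (simp add: crd_def carrier_eq f_inv_into_f)

lemma crd_coords [simp]: "h \<in> carrier Q \<Longrightarrow> crd h \<in> coords J"
  by (auto simp: carrier_eq)

lemma fib_carrier [simp]: "c \<in> coords J \<Longrightarrow> fib c \<in> carrier Q"
  by (simp add: carrier_eq)

lemma fib_eq_iff: "c \<in> coords J \<Longrightarrow> d \<in> coords J \<Longrightarrow> fib c = fib d \<longleftrightarrow> c = d"
  using fib_inj by (auto simp: inj_on_def)

lemma struct_mult_coords [simp]: "struct_mult J st c d \<in> coords J"
  by (auto simp: struct_mult_def coords_def st_outside)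

lemma abelian_group: "abelian_group Q"
proof (rule abelian_groupI)
  fix h assume "h \<in> carrier Q"
  then obtain c where c: "c \<in> coords J" "h = fib c" by (auto simp: carrier_eq)
  then show "\<exists>g\<in>carrier Q. g \<oplus>\<^bsub>Q\<^esub> h = \<zero>\<^bsub>Q\<^esub>"
    by (intro bexI[of _ "fib (\<lambda>i. - c i)"]) (auto simp: fib_add coords_uminus fib_zero)
qed (auto simp: carrier_eq fib_zero fib_add coords_add add_ac)

lemma a_inv_fib:
  assumes "c \<in> coords J"
  shows "\<ominus>\<^bsub>Q\<^esub> fib c = fib (\<lambda>i. - c i)"
proof -
  interpret abelian_group Q by (rule abelian_group)
  show ?thesis using assms
    by (intro minus_equality) (auto simp: fib_add coords_uminus fib_zero)
qed

lemma finsum_fib: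
  assumes "finite W" "\<And>w. w \<in> W \<Longrightarrow> F w \<in> coords J"
  shows "(\<Oplus>\<^bsub>Q\<^esub>w\<in>W. fib (F w)) = fib (\<lambda>i. \<Sum>w\<in>W. F w i)"
proof -
  interpret abelian_group Q by (rule abelian_group)
  show ?thesis using assms
  proof (induction W rule: finite_induct)
    case (insert w W)
    then have "(\<Oplus>\<^bsub>Q\<^esub>w\<in>insert w W. fib (F w)) = fib (F w) \<oplus>\<^bsub>Q\<^esub> (\<Oplus>\<^bsub>Q\<^esub>w\<in>W. fib (F w))"
      by (intro finsum_insert) auto
    then show ?case using insert by (simp add: fib_add coords_sum)
  qed (simp add: fib_zero)
qed

lemma lin_ext_fib:
  assumes "\<And>w. w \<in> Poly_Mapping.keys f \<Longrightarrow> \<beta> w \<in> coords J"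
    and "\<And>w. w \<in> Poly_Mapping.keys f \<Longrightarrow> b w = fib (\<beta> w)"
  shows "lin_ext Q b f = fib (lin_comb \<beta> f)"
proof -
  interpret abelian_group Q by (rule abelian_group)
  have "lin_ext Q b f = (\<Oplus>\<^bsub>Q\<^esub>w\<in>Poly_Mapping.keys f. fib (\<lambda>i. Poly_Mapping.lookup f w * \<beta> w i))"
    unfolding lin_ext_def
    by (intro finsum_cong') (use assms in \<open>auto simp: fib_smult coords_scale\<close>)
  also have "\<dots> = fib (lin_comb \<beta> f)"
    unfolding lin_comb_def by (intro finsum_fib) (use assms in \<open>auto simp: coords_scale\<close>)
  finally show ?thesis .
qed

lemma k_subspace_fibI:
  assumes "W \<subseteq> coords J" "(\<lambda>_. 0) \<in> W" "\<And>c d. c \<in> W \<Longrightarrow> d \<in> W \<Longrightarrow> (\<lambda>i. c i + d i) \<in> W"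
    "\<And>k c. c \<in> W \<Longrightarrow> (\<lambda>i. k * c i) \<in> W"
  shows "k_subspace (fib ` W) Q"
proof -
  have "(\<lambda>i. - c i) \<in> W" if "c \<in> W" for c
    using assms(4)[OF that, of "-1"] by simp
  with assms show ?thesis
    by (subst k_subspace_iff[OF abelian_group])
      (auto simp: fib_zero fib_add fib_smult a_inv_fib subset_iff)
qed

lemma k_subspaceD:
  assumes "k_subspace V Q"
  shows "V \<subseteq> carrier Q" "fib (\<lambda>_. 0) \<in> V"
    and "\<And>c d. c \<in> coords J \<Longrightarrow> d \<in> coords J \<Longrightarrow> fib c \<in> V \<Longrightarrow> fib d \<in> V \<Longrightarrow> fib (\<lambda>i. c i + d i) \<in> V"
    and "\<And>k c. c \<in> coords J \<Longrightarrow> fib c \<in> V \<Longrightarrow> fib (\<lambda>i. k * c i) \<in> V"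
  using assms by (auto simp: k_subspace_iff[OF abelian_group] fib_zero simp flip: fib_add fib_smult)

lemma k_subspace_sum:
  assumes "k_subspace V Q" "\<And>w. w \<in> W \<Longrightarrow> F w \<in> coords J" "\<And>w. w \<in> W \<Longrightarrow> fib (F w) \<in> V"
  shows "fib (\<lambda>i. \<Sum>w\<in>W. F w i) \<in> V"
  using assms(2,3)
proof (induction W rule: infinite_finite_induct)
  case (insert w W)
  then show ?case using k_subspaceD(3)[OF assms(1), of "F w" "\<lambda>i. \<Sum>w\<in>W. F w i"]
    by (simp add: coords_sum)
qed (use k_subspaceD(2)[OF assms(1)] in auto)

text \<open>Nested to the right like the \<open>foldr\<close> in \<open>free_ext\<close>, so that a
  word is evaluated by induction on its first letter without associativity.\<close>

definition word_prod :: "('g \<Rightarrow> 'i \<Rightarrow> 'k) \<Rightarrow> 'g list \<Rightarrow> 'i \<Rightarrow> 'k" where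
  "word_prod \<delta> w = foldr (\<lambda>g y. struct_mult J st (\<delta> g) y) w e"

lemma word_prod_simps [simp]:
  "word_prod \<delta> [] = e" "word_prod \<delta> (g # w) = struct_mult J st (\<delta> g) (word_prod \<delta> w)"
  by (simp_all add: word_prod_def)

lemma word_prod_coords: "word_prod \<delta> w \<in> coords J"
  by (cases w) (auto simp: one_coords)

lemma free_ext_fib:
  assumes "\<And>g. \<delta> g \<in> coords J" "\<And>g. \<psi> g = fib (\<delta> g)"
  shows "free_ext Q \<psi> f = fib (lin_comb (word_prod \<delta>) f)"
proof -
  have "foldr (\<lambda>g y. \<psi> g \<otimes>\<^bsub>Q\<^esub> y) w \<one>\<^bsub>Q\<^esub> = fib (word_prod \<delta> w)" for w
    by (induction w) (use assms in \<open>simp_all add: fib_one fib_mult word_prod_coords\<close>)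
  then show ?thesis
    unfolding free_ext_def by (intro lin_ext_fib) (auto simp: word_prod_coords)
qed

text \<open>An antihomomorphism is a homomorphism into the opposite algebra; this makes
  \<open>free_ext_fib\<close> available for the antipode.\<close>

lemma coord_algebra_opposite: "coord_algebra (opposite_algebra Q) J (\<lambda>u v. st v u) e fib"
proof
  show "fib c \<otimes>\<^bsub>opposite_algebra Q\<^esub> fib d = fib (struct_mult J (\<lambda>u v. st v u) c d)"
    if "c \<in> coords J" "d \<in> coords J" for c d
  proof -
    have "struct_mult J (\<lambda>u v. st v u) c d = struct_mult J st d c"
      unfolding struct_mult_def by (subst sum.swap) (simp add: mult_ac)
    then show ?thesis using that by (simp add: opposite_algebra_def fib_mult)
  qed
qed (use finite_J st_outside one_coords carrier_eq fib_inj fib_zero fib_one fib_add fib_smult in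
    \<open>auto simp: opposite_algebra_def\<close>)

end

lemma lin_comb_monoid_algebra_mult:
  assumes "\<And>u v. u \<in> carrier M \<Longrightarrow> v \<in> carrier M \<Longrightarrow> \<beta> (u \<otimes>\<^bsub>M\<^esub> v) = struct_mult J st (\<beta> u) (\<beta> v)"
    and "Poly_Mapping.keys f \<subseteq> carrier M" "Poly_Mapping.keys g \<subseteq> carrier M"
  shows "lin_comb \<beta> (monoid_algebra_mult M f g) = struct_mult J st (lin_comb \<beta> f) (lin_comb \<beta> g)"
proof
  fix w
  show "lin_comb \<beta> (monoid_algebra_mult M f g) w = struct_mult J st (lin_comb \<beta> f) (lin_comb \<beta> g) w"
    unfolding struct_mult_lin_comb monoid_algebra_mult_def lin_comb_sum
    using assms by (intro sum.cong refl) (auto simp: subset_iff)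
qed

text \<open>The homomorphism theorem in coordinates: the cosets of the kernel of
  \<open>lin_comb \<beta>\<close> are its fibres. Applied to words it describes \<open>H\<close>,
  applied to pairs it describes the tensor product.\<close>

lemma coord_algebra_quot:
  fixes M :: "('w, 'm) monoid_scheme" and \<beta> :: "'w \<Rightarrow> 'i \<Rightarrow> 'k::field"
  assumes "finite J" "\<And>u v w. w \<notin> J \<Longrightarrow> st u v w = 0"
    and closed: "\<And>u v. u \<in> carrier M \<Longrightarrow> v \<in> carrier M \<Longrightarrow> u \<otimes>\<^bsub>M\<^esub> v \<in> carrier M" "\<one>\<^bsub>M\<^esub> \<in> carrier M"
    and \<beta>: "\<And>w. w \<in> carrier M \<Longrightarrow> \<beta> w \<in> coords J"
    and \<beta>_mult: "\<And>u v. u \<in> carrier M \<Longrightarrow> v \<in> carrier M \<Longrightarrow> \<beta> (u \<otimes>\<^bsub>M\<^esub> v) = struct_mult J st (\<beta> u) (\<beta> v)"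
    and \<beta>_surj: "\<And>i. i \<in> J \<Longrightarrow> \<exists>w\<in>carrier M. \<beta> w = unit_coord i"
    and I: "I = {f. Poly_Mapping.keys f \<subseteq> carrier M \<and> lin_comb \<beta> f = (\<lambda>_. 0)}"
  shows "coord_algebra (quot_algebra (monoid_algebra M) I) J st (\<beta> \<one>\<^bsub>M\<^esub>)
    (\<lambda>c. {f. Poly_Mapping.keys f \<subseteq> carrier M \<and> lin_comb \<beta> f = c})"
    and "\<And>f. Poly_Mapping.keys f \<subseteq> carrier M \<Longrightarrow>
      I +>\<^bsub>monoid_algebra M\<^esub> f = {g. Poly_Mapping.keys g \<subseteq> carrier M \<and> lin_comb \<beta> g = lin_comb \<beta> f}"
    and "\<And>c. c \<in> coords J \<Longrightarrow> {f. Poly_Mapping.keys f \<subseteq> carrier M \<and> lin_comb \<beta> f = c} \<noteq> {}"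
proof -
  define fib where "fib = (\<lambda>c. {f. Poly_Mapping.keys f \<subseteq> carrier M \<and> lin_comb \<beta> f = c})"
  let ?A = "monoid_algebra M :: ('k, 'w \<Rightarrow>\<^sub>0 'k) module"
  have coset: "I +>\<^bsub>?A\<^esub> f = fib (lin_comb \<beta> f)" if "Poly_Mapping.keys f \<subseteq> carrier M" for f
  proof -
    have "g \<in> I +>\<^bsub>?A\<^esub> f" if g: "g \<in> fib (lin_comb \<beta> f)" for g
    proof -
      have "g - f \<in> I"
        using g \<open>Poly_Mapping.keys f \<subseteq> carrier M\<close> keys_add[of g "-f"]
        by (auto simp: I fib_def lin_comb_diff keys_uminus)
      then show ?thesis by (auto simp: a_r_coset_def' intro!: bexI[of _ "g - f"])
    qed
    then show ?thesis using that
      by (auto simp: a_r_coset_def' I fib_def lin_comb_add dest!: set_mp[OF Poly_Mapping.keys_add])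
  qed
  have ex: "\<exists>f. Poly_Mapping.keys f \<subseteq> carrier M \<and> lin_comb \<beta> f = c" if "c \<in> coords J" for c
  proof -
    obtain b where b: "\<And>i. i \<in> J \<Longrightarrow> b i \<in> carrier M" "\<And>i. i \<in> J \<Longrightarrow> \<beta> (b i) = unit_coord i"
      using \<beta>_surj by metis
    \<comment> \<open>A preimage of \<open>c\<close>: each unit vector is hit by some
      \<open>b i\<close>, which is weighted by \<open>c i\<close>.\<close>
    have "lin_comb \<beta> (\<Sum>i\<in>J. Poly_Mapping.single (b i) (c i)) = c"
      by (subst (2) coords_sum_unit[OF \<open>finite J\<close> that])
        (simp add: lin_comb_sum b cong: sum.cong)
    moreover have "Poly_Mapping.keys (\<Sum>i\<in>J. Poly_Mapping.single (b i) (c i)) \<subseteq> carrier M"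
      by (rule keys_sum_subset) (use b in auto)
    ultimately show ?thesis by blast
  qed
  have fib_ne: "fib c \<noteq> {}" if "c \<in> coords J" for c
    using ex[OF that] by (auto simp: fib_def)
  have fib_coset: "fib c = I +>\<^bsub>?A\<^esub> f" if "f \<in> fib c" for c f
    using that coset[of f] by (auto simp: fib_def)
  have I_fib: "I = fib (\<lambda>_. 0)" by (simp add: I fib_def)
  have lin: "lin_comb \<beta> f \<in> coords J" if "Poly_Mapping.keys f \<subseteq> carrier M" for f
    using that \<beta> by (intro coords_lin_comb) auto
  have "coord_algebra (quot_algebra ?A I) J st (\<beta> \<one>\<^bsub>M\<^esub>) fib"
  proof
    show "carrier (quot_algebra ?A I) = fib ` coords J"
      using ex lin by (force simp: quot_algebra_def FactRing_def A_RCOSETS_def' coset)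
    show "inj_on fib (coords J)"
    proof
      fix c d assume *: "c \<in> coords J" "d \<in> coords J" "fib c = fib d"
      then obtain f where "f \<in> fib c" using fib_ne by blast
      with * show "c = d" by (auto simp: fib_def)
    qed
    show "\<zero>\<^bsub>quot_algebra ?A I\<^esub> = fib (\<lambda>_. 0)"
      by (simp add: quot_algebra_def FactRing_def I_fib)
    show "\<one>\<^bsub>quot_algebra ?A I\<^esub> = fib (\<beta> \<one>\<^bsub>M\<^esub>)"
      by (simp add: quot_algebra_def FactRing_def coset closed)
    show "fib c \<oplus>\<^bsub>quot_algebra ?A I\<^esub> fib d = fib (\<lambda>i. c i + d i)"
      if "c \<in> coords J" "d \<in> coords J" for c d
    proof -
      obtain f g where f: "f \<in> fib c" and g: "g \<in> fib d" using fib_ne \<open>c \<in> coords J\<close> \<open>d \<in> coords J\<close> by blast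
      have "h \<in> fib c <+>\<^bsub>?A\<^esub> fib d" if h: "h \<in> fib (\<lambda>i. c i + d i)" for h
      proof -
        have "h - f \<in> fib d" using h f keys_add[of h "-f"]
          by (auto simp: fib_def lin_comb_diff keys_uminus)
        moreover have "h = f + (h - f)" by simp
        ultimately show ?thesis using f unfolding set_add_def' by force
      qed
      then show ?thesis
        by (auto simp: quot_algebra_def FactRing_def set_add_def' fib_def lin_comb_add dest!: set_mp[OF Poly_Mapping.keys_add])
    qed
    show "fib c \<otimes>\<^bsub>quot_algebra ?A I\<^esub> fib d = fib (struct_mult J st c d)"
      if cd: "c \<in> coords J" "d \<in> coords J" for c d
    proof -
      \<comment> \<open>The quotient product is a union over representatives. All cosets in it
        agree, and as the fibres are nonempty the union is that coset.\<close>
      have "I +>\<^bsub>?A\<^esub> monoid_algebra_mult M f g = fib (struct_mult J st c d)"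
        if "f \<in> fib c" "g \<in> fib d" for f g
        using that by (subst coset)
         (auto simp: fib_def lin_comb_monoid_algebra_mult[of M \<beta> J st, OF \<beta>_mult]
            dest!: subsetD[OF keys_monoid_algebra_mult, rotated -1] intro: closed)
      then show ?thesis using fib_ne[OF cd(1)] fib_ne[OF cd(2)]
        by (auto simp: quot_algebra_def FactRing_def rcoset_mult_def)
    qed
    show "k \<odot>\<^bsub>quot_algebra ?A I\<^esub> fib c = fib (\<lambda>i. k * c i)" if "c \<in> coords J" for k c
    proof -
      have "I +>\<^bsub>?A\<^esub> Poly_Mapping.map ((*) k) f = fib (\<lambda>i. k * c i)" if "f \<in> fib c" for f
        using that by (subst coset)
         (auto simp: fib_def lin_comb_scale dest!: subsetD[OF keys_scale])
      then show ?thesis using fib_ne[OF that]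
        by (auto simp: quot_algebra_def)
    qed
  qed (use assms in auto)
  then show "coord_algebra (quot_algebra (monoid_algebra M) I) J st (\<beta> \<one>\<^bsub>M\<^esub>)
    (\<lambda>c. {f. Poly_Mapping.keys f \<subseteq> carrier M \<and> lin_comb \<beta> f = c})"
    by (simp add: fib_def)
  show "\<And>f. Poly_Mapping.keys f \<subseteq> carrier M \<Longrightarrow>
      I +>\<^bsub>monoid_algebra M\<^esub> f = {g. Poly_Mapping.keys g \<subseteq> carrier M \<and> lin_comb \<beta> g = lin_comb \<beta> f}"
    using coset by (simp add: fib_def)
  show "\<And>c. c \<in> coords J \<Longrightarrow> {f. Poly_Mapping.keys f \<subseteq> carrier M \<and> lin_comb \<beta> f = c} \<noteq> {}"
    using fib_ne by (simp add: fib_def)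
qed

text \<open>The field has a one-point index set; with this the counit is evaluated by the same lemma
  as the comultiplication.\<close>

lemma coord_algebra_ground:
  "coord_algebra (ground_algebra :: ('k::field, 'k) module) {()} (\<lambda>_ _ _. 1) (\<lambda>_. 1) (\<lambda>c. c ())"
proof
  have "c \<in> (\<lambda>c. c ()) ` coords {()}" for c :: 'k
    by (rule image_eqI[of _ _ "\<lambda>_. c"]) (auto simp: coords_def)
  then show "carrier (ground_algebra :: ('k, 'k) module) = (\<lambda>c. c ()) ` coords {()}"
    by (auto simp: ground_algebra_def)
qed (auto simp: ground_algebra_def coords_def inj_on_def fun_eq_iff struct_mult_def)

section \<open>Tensor products in coordinates\<close>

definition tensor_coord :: "('i \<Rightarrow> 'k::field) \<Rightarrow> ('j \<Rightarrow> 'k) \<Rightarrow> 'i \<times> 'j \<Rightarrow> 'k" where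
  "tensor_coord c d = (\<lambda>(i, j). c i * d j)"

definition tensor_struct ::
    "('i \<Rightarrow> 'i \<Rightarrow> 'i \<Rightarrow> 'k::field) \<Rightarrow> ('j \<Rightarrow> 'j \<Rightarrow> 'j \<Rightarrow> 'k) \<Rightarrow>
      'i \<times> 'j \<Rightarrow> 'i \<times> 'j \<Rightarrow> 'i \<times> 'j \<Rightarrow> 'k" where
  "tensor_struct st st' = (\<lambda>(u, v) (u', v') (w, w'). st u u' w * st' v v' w')"

lemma tensor_coord_coords:
  "c \<in> coords J \<Longrightarrow> d \<in> coords K \<Longrightarrow> tensor_coord c d \<in> coords (J \<times> K)"
  by (auto simp: coords_def tensor_coord_def)

lemma tensor_coord_unit: "tensor_coord (unit_coord i) (unit_coord j) = unit_coord (i, j)"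
  by (auto simp: tensor_coord_def unit_coord_def fun_eq_iff)

lemma struct_mult_tensor_coord:
  "struct_mult (J \<times> K) (tensor_struct st st') (tensor_coord c d) (tensor_coord c' d') =
    tensor_coord (struct_mult J st c c') (struct_mult K st' d d')"
proof (rule ext, clarify)
  fix w w'
  have "struct_mult (J \<times> K) (tensor_struct st st') (tensor_coord c d) (tensor_coord c' d') (w, w') =
     (\<Sum>u\<in>J. \<Sum>v\<in>K. \<Sum>u'\<in>J. \<Sum>v'\<in>K. (c u * c' u' * st u u' w) * (d v * d' v' * st' v v' w'))"
    unfolding struct_mult_def tensor_coord_def tensor_struct_def
    by (simp add: sum.cartesian_product' case_prod_unfold mult_ac)
  also have "\<dots> = (\<Sum>u\<in>J. \<Sum>u'\<in>J. \<Sum>v\<in>K. \<Sum>v'\<in>K. (c u * c' u' * st u u' w) * (d v * d' v' * st' v v' w'))"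
    by (intro sum.cong refl sum.swap)
  also have "\<dots> = tensor_coord (struct_mult J st c c') (struct_mult K st' d d') (w, w')"
    unfolding struct_mult_def tensor_coord_def prod.case
    by (simp only: sum_distrib_right[symmetric] sum_distrib_left[symmetric])
  finally show "struct_mult (J \<times> K) (tensor_struct st st') (tensor_coord c d) (tensor_coord c' d') (w, w') =
    tensor_coord (struct_mult J st c c') (struct_mult K st' d d') (w, w')" .
qed

locale coord_tensor =
  A: coord_algebra A J st e fib + B: coord_algebra B K st' e' fib'
  for A :: "('k::field, 'a, 'm) module_scheme" and J :: "'i set" and st e fib
    and B :: "('k, 'b, 'n) module_scheme" and K :: "'j set" and st' e' fib'
begin

definition tcrd :: "'a \<times> 'b \<Rightarrow> 'i \<times> 'j \<Rightarrow> 'k" where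
  "tcrd = (\<lambda>(u, v). tensor_coord (A.crd u) (B.crd v))"

definition tfib :: "('i \<times> 'j \<Rightarrow> 'k) \<Rightarrow> ('a \<times> 'b \<Rightarrow>\<^sub>0 'k) set" where
  "tfib c = {F. Poly_Mapping.keys F \<subseteq> carrier (A \<times>\<times> B) \<and> lin_comb tcrd F = c}"

definition basis_tensor :: "'i \<times> 'j \<Rightarrow> 'k \<Rightarrow> 'a \<times> 'b \<Rightarrow>\<^sub>0 'k" where
  "basis_tensor = (\<lambda>(i, j). Poly_Mapping.single (fib (unit_coord i), fib' (unit_coord j)))"

text \<open>Each relation has coordinates 0. Conversely, modulo the relations a symbol
  \<open>(u, v)\<close> may be replaced by basis tensors weighted with its coordinates, so an
  element with coordinates 0 lies in the span of the relations.\<close>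

lemma tensor_null_eq: "tensor_null A B = tfib (\<lambda>_. 0)"
proof
  have crd_add: "A.crd (u \<oplus>\<^bsub>A\<^esub> u') = (\<lambda>i. A.crd u i + A.crd u' i)" "u \<oplus>\<^bsub>A\<^esub> u' \<in> carrier A"
    if uu: "u \<in> carrier A" "u' \<in> carrier A" for u u'
  proof -
    have "u \<oplus>\<^bsub>A\<^esub> u' = fib (\<lambda>i. A.crd u i + A.crd u' i)"
      using A.fib_add[of "A.crd u" "A.crd u'"] uu by simp
    then show "A.crd (u \<oplus>\<^bsub>A\<^esub> u') = (\<lambda>i. A.crd u i + A.crd u' i)" "u \<oplus>\<^bsub>A\<^esub> u' \<in> carrier A"
      using uu by (simp_all add: coords_add)
  qed
  have crd_add': "B.crd (u \<oplus>\<^bsub>B\<^esub> u') = (\<lambda>i. B.crd u i + B.crd u' i)" "u \<oplus>\<^bsub>B\<^esub> u' \<in> carrier B"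
    if uu: "u \<in> carrier B" "u' \<in> carrier B" for u u'
  proof -
    have "u \<oplus>\<^bsub>B\<^esub> u' = fib' (\<lambda>i. B.crd u i + B.crd u' i)"
      using B.fib_add[of "B.crd u" "B.crd u'"] uu by simp
    then show "B.crd (u \<oplus>\<^bsub>B\<^esub> u') = (\<lambda>i. B.crd u i + B.crd u' i)" "u \<oplus>\<^bsub>B\<^esub> u' \<in> carrier B"
      using uu by (simp_all add: coords_add)
  qed
  have crd_smult: "A.crd (k \<odot>\<^bsub>A\<^esub> u) = (\<lambda>i. k * A.crd u i)" "k \<odot>\<^bsub>A\<^esub> u \<in> carrier A"
    if uu: "u \<in> carrier A" for u k
  proof -
    have "k \<odot>\<^bsub>A\<^esub> u = fib (\<lambda>i. k * A.crd u i)"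
      using A.fib_smult[of "A.crd u" k] uu by simp
    then show "A.crd (k \<odot>\<^bsub>A\<^esub> u) = (\<lambda>i. k * A.crd u i)" "k \<odot>\<^bsub>A\<^esub> u \<in> carrier A"
      using uu by (simp_all add: coords_scale)
  qed
  have crd_smult': "B.crd (k \<odot>\<^bsub>B\<^esub> u) = (\<lambda>i. k * B.crd u i)" "k \<odot>\<^bsub>B\<^esub> u \<in> carrier B"
    if uu: "u \<in> carrier B" for u k
  proof -
    have "k \<odot>\<^bsub>B\<^esub> u = fib' (\<lambda>i. k * B.crd u i)"
      using B.fib_smult[of "B.crd u" k] uu by simp
    then show "B.crd (k \<odot>\<^bsub>B\<^esub> u) = (\<lambda>i. k * B.crd u i)" "k \<odot>\<^bsub>B\<^esub> u \<in> carrier B"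
      using uu by (simp_all add: coords_scale)
  qed
  have keys_diff: "Poly_Mapping.keys (f - g) \<subseteq> S"
    if "Poly_Mapping.keys f \<subseteq> S" "Poly_Mapping.keys g \<subseteq> S" for f g :: "'a \<times> 'b \<Rightarrow>\<^sub>0 'k" and S
    using Poly_Mapping.keys_add[of f "- g"] that by (auto simp: keys_uminus)
  have keys_plus: "Poly_Mapping.keys (f + g) \<subseteq> S"
    if "Poly_Mapping.keys f \<subseteq> S" "Poly_Mapping.keys g \<subseteq> S" for f g :: "'a \<times> 'b \<Rightarrow>\<^sub>0 'k" and S
    using Poly_Mapping.keys_add[of f g] that by auto
  have ks: "k_subspace (tfib (\<lambda>_. 0)) (monoid_algebra (A \<times>\<times> B))"
    unfolding k_subspace_monoid_algebra_iff tfib_def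
    by (auto simp: lin_comb_add lin_comb_scale dest!: set_mp[OF Poly_Mapping.keys_add] set_mp[OF keys_scale])
  show "tensor_null A B \<subseteq> tfib (\<lambda>_. 0)"
    unfolding tensor_null_def k_span_def
  proof (rule Inter_lower, rule CollectI, rule conjI[OF ks], intro Un_least subsetI; clarify)
  qed (auto simp: tfib_def lin_comb_diff lin_comb_add tcrd_def tensor_coord_def crd_add crd_add' crd_smult crd_smult'
        algebra_simps fun_eq_iff intro!: keys_diff keys_plus del: subsetI split: if_splits)
  show "tfib (\<lambda>_. 0) \<subseteq> tensor_null A B"
    unfolding tensor_null_def k_span_def
  proof (rule Inter_greatest, clarsimp)
    fix V F assume V: "k_subspace V (monoid_algebra (A \<times>\<times> B))" and F: "F \<in> tfib (\<lambda>_. 0)"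
      and add1: "{Poly_Mapping.single (u \<oplus>\<^bsub>A\<^esub> u', v) (1::'k) - Poly_Mapping.single (u, v) 1
        - Poly_Mapping.single (u', v) 1 | u u' v.
        u \<in> carrier A \<and> u' \<in> carrier A \<and> v \<in> carrier B} \<subseteq> V"
     and add2: "{Poly_Mapping.single (u, v \<oplus>\<^bsub>B\<^esub> v') (1::'k) - Poly_Mapping.single (u, v) 1
        - Poly_Mapping.single (u, v') 1 | u v v'.
        u \<in> carrier A \<and> v \<in> carrier B \<and> v' \<in> carrier B} \<subseteq> V"
     and sc1: "{Poly_Mapping.single (c \<odot>\<^bsub>A\<^esub> u, v) 1 - Poly_Mapping.single (u, v) c | c u v.
        u \<in> carrier A \<and> v \<in> carrier B} \<subseteq> V"
     and sc2: "{Poly_Mapping.single (u, c \<odot>\<^bsub>B\<^esub> v) 1 - Poly_Mapping.single (u, v) c | c u v.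
        u \<in> carrier A \<and> v \<in> carrier B} \<subseteq> V"
    note add1 = subsetD[OF add1, OF CollectI, OF exI, OF exI, OF exI, OF conjI, OF refl]
    note add2 = subsetD[OF add2, OF CollectI, OF exI, OF exI, OF exI, OF conjI, OF refl]
    note sc1 = subsetD[OF sc1, OF CollectI, OF exI, OF exI, OF exI, OF conjI, OF refl]
    note sc2 = subsetD[OF sc2, OF CollectI, OF exI, OF exI, OF exI, OF conjI, OF refl]
    have V0: "0 \<in> V" and Vadd: "\<And>f g. f \<in> V \<Longrightarrow> g \<in> V \<Longrightarrow> f + g \<in> V"
      and Vsc: "\<And>c f. f \<in> V \<Longrightarrow> Poly_Mapping.map ((*) c) f \<in> V"
      using V unfolding k_subspace_monoid_algebra_iff by blast+
    \<comment> \<open>Expansion of the left factor alone, one basis vector at a time.\<close>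
    have left: "Poly_Mapping.single (fib (\<lambda>j. \<Sum>i\<in>S. c i * unit_coord i j), v) 1 -
        (\<Sum>i\<in>S. Poly_Mapping.single (fib (unit_coord i), v) (c i)) \<in> V"
      if "finite S" "S \<subseteq> J" "v \<in> carrier B" for S c v
      using that
    proof (induction S rule: finite_induct)
      case empty
      \<comment> \<open>The scaling relation with scalar 0 puts the symbol \<open>(0, v)\<close>
        itself into \<open>V\<close>.\<close>
      have "Poly_Mapping.single (0 \<odot>\<^bsub>A\<^esub> fib (\<lambda>_. 0), v) 1 - Poly_Mapping.single (fib (\<lambda>_. 0), v) 0 \<in> V"
        using empty by (intro sc1) auto
      then show ?case by (simp add: A.fib_smult)
    next
      case (insert i S)
      let ?c = "\<lambda>j. c i * unit_coord i j" and ?d = "\<lambda>j. \<Sum>i\<in>S. c i * unit_coord i j"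
      let ?x3 = "Poly_Mapping.single (fib ?d, v) 1 - (\<Sum>i\<in>S. Poly_Mapping.single (fib (unit_coord i), v) (c i))"
      have co: "?c \<in> coords J" "?d \<in> coords J"
        using insert.prems by (auto intro!: coords_scale coords_sum)
      have "Poly_Mapping.single (fib ?c \<oplus>\<^bsub>A\<^esub> fib ?d, v) 1 - Poly_Mapping.single (fib ?c, v) 1 -
          Poly_Mapping.single (fib ?d, v) 1 \<in> V" (is "?x1 \<in> V")
        using insert.prems co by (intro add1) auto
      moreover have "Poly_Mapping.single (c i \<odot>\<^bsub>A\<^esub> fib (unit_coord i), v) 1 -
          Poly_Mapping.single (fib (unit_coord i), v) (c i) \<in> V" (is "?x2 \<in> V")
        using insert.prems by (intro sc1) auto
      \<comment> \<open>\<open>?x1\<close> splits off one summand, \<open>?x2\<close> pulls out its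
        scalar, and \<open>?x3\<close> is the induction hypothesis; the intermediate symbols
        cancel.\<close>
      ultimately have "?x1 + (?x2 + ?x3) \<in> V" using insert by (intro Vadd) auto
      then show ?case using insert co by (simp add: A.fib_add A.fib_smult algebra_simps)
    qed
    have right: "Poly_Mapping.single (u, fib' (\<lambda>j. \<Sum>i\<in>S. c i * unit_coord i j)) 1 -
        (\<Sum>i\<in>S. Poly_Mapping.single (u, fib' (unit_coord i)) (c i)) \<in> V"
      if "finite S" "S \<subseteq> K" "u \<in> carrier A" for S c u
      using that
    proof (induction S rule: finite_induct)
      case empty
      have "Poly_Mapping.single (u, 0 \<odot>\<^bsub>B\<^esub> fib' (\<lambda>_. 0)) 1 - Poly_Mapping.single (u, fib' (\<lambda>_. 0)) 0 \<in> V"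
        using empty by (intro sc2) auto
      then show ?case by (simp add: B.fib_smult)
    next
      case (insert i S)
      let ?c = "\<lambda>j. c i * unit_coord i j" and ?d = "\<lambda>j. \<Sum>i\<in>S. c i * unit_coord i j"
      let ?x3 = "Poly_Mapping.single (u, fib' ?d) 1 - (\<Sum>i\<in>S. Poly_Mapping.single (u, fib' (unit_coord i)) (c i))"
      have co: "?c \<in> coords K" "?d \<in> coords K"
        using insert.prems by (auto intro!: coords_scale coords_sum)
      have "Poly_Mapping.single (u, fib' ?c \<oplus>\<^bsub>B\<^esub> fib' ?d) 1 - Poly_Mapping.single (u, fib' ?c) 1 -
          Poly_Mapping.single (u, fib' ?d) 1 \<in> V" (is "?x1 \<in> V")
        using insert.prems co by (intro add2) auto
      moreover have "Poly_Mapping.single (u, c i \<odot>\<^bsub>B\<^esub> fib' (unit_coord i)) 1 -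
          Poly_Mapping.single (u, fib' (unit_coord i)) (c i) \<in> V" (is "?x2 \<in> V")
        using insert.prems by (intro sc2) auto
      ultimately have "?x1 + (?x2 + ?x3) \<in> V" using insert by (intro Vadd) auto
      then show ?case using insert co by (simp add: B.fib_add B.fib_smult algebra_simps)
    qed
    \<comment> \<open>The left factor is expanded first, then the right factor next to each basis
      vector obtained.\<close>
    have pair: "Poly_Mapping.single p 1 - (\<Sum>i\<in>J. \<Sum>j\<in>K. basis_tensor (i, j) (tcrd p (i, j))) \<in> V"
      if pp: "p \<in> carrier A \<times> carrier B" for p
    proof -
      obtain u v where p: "p = (u, v)" and u: "u \<in> carrier A" and v: "v \<in> carrier B"
        using pp by auto
      have u_eq: "fib (\<lambda>j. \<Sum>i\<in>J. A.crd u i * unit_coord i j) = u"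
        using u coords_sum_unit[OF A.finite_J A.crd_coords[OF u]] by simp
      have v_eq: "fib' (\<lambda>j. \<Sum>i\<in>K. B.crd v i * unit_coord i j) = v"
        using v coords_sum_unit[OF B.finite_J B.crd_coords[OF v]] by simp
      have "Poly_Mapping.map ((*) (A.crd u i)) (Poly_Mapping.single (fib (unit_coord i), v) 1 -
          (\<Sum>j\<in>K. Poly_Mapping.single (fib (unit_coord i), fib' (unit_coord j)) (B.crd v j))) \<in> V"
        if "i \<in> J" for i
        using right[OF B.finite_J subset_refl, of "fib (unit_coord i)" "B.crd v"] that
        by (intro Vsc) (simp add: v_eq)
      then have "(\<Sum>i\<in>J. Poly_Mapping.single (fib (unit_coord i), v) (A.crd u i) -
          (\<Sum>j\<in>K. basis_tensor (i, j) (tcrd p (i, j)))) \<in> V"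
        by (intro closed_sum[OF V0 Vadd])
          (auto simp: scale_diff scale_sum basis_tensor_def tcrd_def tensor_coord_def p)
      from Vadd[OF left[OF A.finite_J subset_refl v, of "A.crd u"] this] show ?thesis
        by (simp add: u_eq p sum_subtractf)
    qed
    have keysF: "Poly_Mapping.keys F \<subseteq> carrier A \<times> carrier B" and lin: "lin_comb tcrd F = (\<lambda>_. 0)"
      using F by (auto simp: tfib_def)
    let ?F = "Poly_Mapping.lookup F"
    have "(\<Sum>p\<in>Poly_Mapping.keys F. Poly_Mapping.map ((*) (?F p)) (Poly_Mapping.single p 1 -
        (\<Sum>i\<in>J. \<Sum>j\<in>K. basis_tensor (i, j) (tcrd p (i, j))))) \<in> V"
      by (intro closed_sum[OF V0 Vadd] Vsc pair) (use keysF in auto)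
    also have "(\<Sum>p\<in>Poly_Mapping.keys F. Poly_Mapping.map ((*) (?F p)) (Poly_Mapping.single p 1 -
        (\<Sum>i\<in>J. \<Sum>j\<in>K. basis_tensor (i, j) (tcrd p (i, j))))) =
        (\<Sum>p\<in>Poly_Mapping.keys F. Poly_Mapping.single p (?F p)) -
        (\<Sum>p\<in>Poly_Mapping.keys F. \<Sum>i\<in>J. \<Sum>j\<in>K. basis_tensor (i, j) (?F p * tcrd p (i, j)))"
      by (simp add: scale_diff scale_sum basis_tensor_def sum_subtractf)
    also have "(\<Sum>p\<in>Poly_Mapping.keys F. \<Sum>i\<in>J. \<Sum>j\<in>K. basis_tensor (i, j) (?F p * tcrd p (i, j))) =
       (\<Sum>i\<in>J. \<Sum>j\<in>K. \<Sum>p\<in>Poly_Mapping.keys F. basis_tensor (i, j) (?F p * tcrd p (i, j)))"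
      by (subst sum.swap, intro sum.cong refl sum.swap)
    \<comment> \<open>Collected by basis tensors, the coefficients are the coordinates of
      \<open>F\<close>, which vanish.\<close>
    also have "\<dots> = (\<Sum>i\<in>J. \<Sum>j\<in>K. basis_tensor (i, j) (lin_comb tcrd F (i, j)))"
      by (simp add: lin_comb_def basis_tensor_def single_sum)
    also have "\<dots> = 0" by (simp add: lin basis_tensor_def)
    finally show "F \<in> V" by (simp flip: poly_mapping_sum_single)
  qed
qed

lemma coord_algebra_tensor:
  "coord_algebra (tensor_algebra A B) (J \<times> K) (tensor_struct st st') (tensor_coord e e') tfib"
  and pure_tensor_fib: "\<And>c d. c \<in> coords J \<Longrightarrow> d \<in> coords K \<Longrightarrow>
    pure_tensor A B (fib c) (fib' d) = tfib (tensor_coord c d)"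
  and tfib_nonempty: "\<And>c. c \<in> coords (J \<times> K) \<Longrightarrow> tfib c \<noteq> {}"
proof -
  have A: "A.crd (u \<otimes>\<^bsub>A\<^esub> u') = struct_mult J st (A.crd u) (A.crd u')" "u \<otimes>\<^bsub>A\<^esub> u' \<in> carrier A"
    if uu: "u \<in> carrier A" "u' \<in> carrier A" for u u'
  proof -
    have "u \<otimes>\<^bsub>A\<^esub> u' = fib (struct_mult J st (A.crd u) (A.crd u'))"
      using A.fib_mult[of "A.crd u" "A.crd u'"] uu by simp
    then show "A.crd (u \<otimes>\<^bsub>A\<^esub> u') = struct_mult J st (A.crd u) (A.crd u')" "u \<otimes>\<^bsub>A\<^esub> u' \<in> carrier A"
      by simp_all
  qed
  have B: "B.crd (u \<otimes>\<^bsub>B\<^esub> u') = struct_mult K st' (B.crd u) (B.crd u')" "u \<otimes>\<^bsub>B\<^esub> u' \<in> carrier B"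
    if uu: "u \<in> carrier B" "u' \<in> carrier B" for u u'
  proof -
    have "u \<otimes>\<^bsub>B\<^esub> u' = fib' (struct_mult K st' (B.crd u) (B.crd u'))"
      using B.fib_mult[of "B.crd u" "B.crd u'"] uu by simp
    then show "B.crd (u \<otimes>\<^bsub>B\<^esub> u') = struct_mult K st' (B.crd u) (B.crd u')" "u \<otimes>\<^bsub>B\<^esub> u' \<in> carrier B"
      by simp_all
  qed
  have surj: "\<exists>w\<in>carrier (A \<times>\<times> B). tcrd w = unit_coord i" if "i \<in> J \<times> K" for i
    using that by (cases i, intro bexI[of _ "(fib (unit_coord (fst i)), fib' (unit_coord (snd i)))"])
      (auto simp: tcrd_def tensor_coord_unit)
  have outside: "\<And>u v w. w \<notin> J \<times> K \<Longrightarrow> tensor_struct st st' u v w = 0"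
    by (auto simp: tensor_struct_def) (metis A.st_outside, metis B.st_outside)
  have tcrd_coords: "\<And>w. w \<in> carrier (A \<times>\<times> B) \<Longrightarrow> tcrd w \<in> coords (J \<times> K)"
    by (auto simp: tcrd_def tensor_coord_coords)
  have tcrd_mult: "\<And>u v. u \<in> carrier (A \<times>\<times> B) \<Longrightarrow> v \<in> carrier (A \<times>\<times> B) \<Longrightarrow>
      tcrd (u \<otimes>\<^bsub>A \<times>\<times> B\<^esub> v) = struct_mult (J \<times> K) (tensor_struct st st') (tcrd u) (tcrd v)"
    by (auto simp: tcrd_def struct_mult_tensor_coord A B)
  have closed: "\<And>u v. u \<in> carrier (A \<times>\<times> B) \<Longrightarrow> v \<in> carrier (A \<times>\<times> B) \<Longrightarrow> u \<otimes>\<^bsub>A \<times>\<times> B\<^esub> v \<in> carrier (A \<times>\<times> B)"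
    "\<one>\<^bsub>A \<times>\<times> B\<^esub> \<in> carrier (A \<times>\<times> B)"
    using A.one_coords B.one_coords by (auto simp: A B A.fib_one B.fib_one)
  have null: "tensor_null A B = {f. Poly_Mapping.keys f \<subseteq> carrier (A \<times>\<times> B) \<and> lin_comb tcrd f = (\<lambda>_. 0)}"
    by (simp add: tensor_null_eq tfib_def)
  note * = coord_algebra_quot[OF finite_cartesian_product[OF A.finite_J B.finite_J] outside
      closed tcrd_coords tcrd_mult surj null]
  show "coord_algebra (tensor_algebra A B) (J \<times> K) (tensor_struct st st') (tensor_coord e e') tfib"
    using *(1) A.one_coords B.one_coords
    by (simp add: tensor_algebra_def tfib_def[abs_def] tcrd_def A.fib_one B.fib_one)
  show "pure_tensor A B (fib c) (fib' d) = tfib (tensor_coord c d)"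
    if "c \<in> coords J" "d \<in> coords K" for c d
    using *(2)[of "Poly_Mapping.single (fib c, fib' d) 1"] that
    by (simp add: pure_tensor_def tfib_def tcrd_def)
  show "\<And>c. c \<in> coords (J \<times> K) \<Longrightarrow> tfib c \<noteq> {}"
    using *(3) by (simp add: tfib_def)
qed

sublocale T: coord_algebra "tensor_algebra A B" "J \<times> K" "tensor_struct st st'" "tensor_coord e e'" tfib
  by (rule coord_algebra_tensor)

end

section \<open>The monomial basis\<close>

text \<open>The order 0 stands for infinite order, and 0 divides only 0, so the equivalence holds
  for every nonzero \<open>z\<close>.\<close>

lemma mult_order_pow_eq_1:
  fixes z :: "'k::field"
  assumes "z \<noteq> 0"
  shows "z ^ m = 1 \<longleftrightarrow> mult_order z dvd m"
proof -
  let ?R = "ring_of_type_algebra :: 'k ring"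
  interpret field ?R by (rule field_from_type_algebra)
  interpret U: group "units_of ?R" by (rule units_group)
  have z: "z \<in> carrier (units_of ?R)"
    using assms field_Units by (simp add: units_of_def) (simp add: ring_of_type_algebra_def)
  have "z [^]\<^bsub>units_of ?R\<^esub> m = z ^ m"
    by (induction m) (simp_all add: units_of_def ring_of_type_algebra_def nat_pow_def)
  then show ?thesis
    using U.pow_eq_id[OF z, of m] unfolding mult_order_def
    by (simp add: units_of_def ring_of_type_algebra_def)
qed

text \<open>Counts the pairs with an \<open>x\<close> before an \<open>a\<close>: sorting a word by
  \<open>x a = q a x\<close> costs one factor \<open>q\<close> per pair.\<close>

fun word_inversions :: "gen list \<Rightarrow> nat" where
  "word_inversions [] = 0"
| "word_inversions (Gen_a # w) = word_inversions w"
| "word_inversions (Gen_x # w) = count_list w Gen_a + word_inversions w"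

lemma word_inversions_append:
  "word_inversions (u @ v) = word_inversions u + word_inversions v + count_list u Gen_x * count_list v Gen_a"
  by (induction u rule: word_inversions.induct) (auto simp: algebra_simps)

lemma word_inversions_replicate [simp]:
  "word_inversions (replicate m Gen_a) = 0" "word_inversions (replicate m Gen_x) = 0"
  by (induction m) (auto simp: count_list_0_iff)

lemma count_list_replicate: "count_list (replicate m g) h = (if g = h then m else 0)"
  by (induction m) auto

section \<open>The defining ideal in the free algebra on \<open>a\<close> and
  \<open>x\<close>\<close>

abbreviation word_monoid :: "gen list monoid" where
  "word_monoid \<equiv> \<lparr>carrier = UNIV, monoid.mult = (@), one = []\<rparr>"

lemma monoid_word_monoid: "Group.monoid word_monoid"
  by (rule monoidI) auto

lemma ring_free_algebra: "ring (free_algebra :: ('k::field, gen list \<Rightarrow>\<^sub>0 'k) module)"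
  unfolding free_algebra_def by (rule ring_monoid_algebra[OF monoid_word_monoid])

lemma ideal_H_ideal: "ideal (H_ideal q N \<nu>) free_algebra"
proof -
  interpret ring "free_algebra :: ('a, gen list \<Rightarrow>\<^sub>0 'a) module" by (rule ring_free_algebra)
  show ?thesis unfolding H_ideal_def by (rule genideal_ideal) (auto simp: free_algebra_def)
qed

lemma H_relations_ideal: "H_relations q N \<nu> \<subseteq> H_ideal q N \<nu>"
proof -
  interpret ring "free_algebra :: ('a, gen list \<Rightarrow>\<^sub>0 'a) module" by (rule ring_free_algebra)
  show ?thesis unfolding H_ideal_def by (rule genideal_self) (auto simp: free_algebra_def)
qed

text \<open>The assumptions are put in a form that passes to \<open>q ^ d\<close>, \<open>s\<close>
  and \<open>\<nu> div d\<close>, where the locale is instantiated a second time.\<close>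

locale H_data =
  fixes q :: "'k::field" and N \<nu> :: nat
  assumes N_pos: "0 < N" and q_pow_N: "q ^ N = 1" and r_gt_1: "1 < mult_order (q ^ \<nu>)"
begin

abbreviation r :: nat where "r \<equiv> mult_order (q ^ \<nu>)"

definition idx :: "(int \<times> nat) set" where
  "idx = {0..<int N} \<times> {..<r}"

text \<open>The structure constants of
  \<open>(a^j x^i) (a^j' x^i') = q^(i j') a^(j + j') x^(i + i')\<close>. Exponents of
  \<open>a\<close> are integers, so that inverses are covered as well.\<close>

definition str :: "int \<times> nat \<Rightarrow> int \<times> nat \<Rightarrow> int \<times> nat \<Rightarrow> 'k" where
  "str = (\<lambda>(j, i) (j', i') w.
    if i + i' < r \<and> w = ((j + j') mod int N, i + i') then q powi (int i * j') else 0)"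

text \<open>The coordinates of \<open>a\<^sup>j x\<^sup>i\<close>: exponents of \<open>a\<close> count modulo \<open>N\<close>, and \<open>x\<^sup>r = 0\<close>.\<close>

definition mcoord :: "int \<Rightarrow> nat \<Rightarrow> int \<times> nat \<Rightarrow> 'k" where
  "mcoord j i = (if i < r then unit_coord (j mod int N, i) else (\<lambda>_. 0))"

definition word_coord :: "gen list \<Rightarrow> int \<times> nat \<Rightarrow> 'k" where
  "word_coord w = (\<lambda>m. q ^ word_inversions w * mcoord (int (count_list w Gen_a)) (count_list w Gen_x) m)"

definition normal_word :: "int \<times> nat \<Rightarrow> gen list" where
  "normal_word = (\<lambda>(j, i). replicate (nat j) Gen_a @ replicate i Gen_x)"

lemma q_nonzero [simp]: "q \<noteq> 0"
  using q_pow_N N_pos by (metis power_0_left zero_neq_one not_gr0)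

lemma finite_idx [simp]: "finite idx"
  by (simp add: idx_def)

lemma powi_mod [simp]: "q powi (j mod int N) = q powi j"
proof -
  have "q powi j = q powi (int N * (j div int N) + j mod int N)" by simp
  also have "\<dots> = (q powi int N) powi (j div int N) * q powi (j mod int N)"
    by (simp only: power_int_add power_int_mult q_nonzero simp_thms)
  finally show ?thesis by (simp add: q_pow_N)
qed

lemma powi_mult_mod [simp]: "q powi (k * (j mod int N)) = q powi (k * j)"
  by (simp only: mult.commute[of k] power_int_mult powi_mod)

lemma mcoord_mod [simp]: "mcoord (j mod int N) i = mcoord j i"
  by (simp add: mcoord_def)

lemma mcoord_coords [simp]: "mcoord j i \<in> coords idx"
  using N_pos by (auto simp: mcoord_def idx_def)

lemma unit_coord_eq_mcoord: "(j, i) \<in> idx \<Longrightarrow> unit_coord (j, i) = mcoord j i"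
  by (auto simp: mcoord_def idx_def)

lemma mcoord_zero: "r \<le> i \<Longrightarrow> mcoord j i = (\<lambda>_. 0)"
  by (simp add: mcoord_def)

text \<open>Valid for all exponents: \<open>mcoord\<close> absorbs the reduction modulo
  \<open>N\<close> and the truncation at \<open>r\<close>, and by \<open>q ^ N = 1\<close> the
  factor depends on \<open>j'\<close> only modulo \<open>N\<close>.\<close>

lemma mult_mcoord:
  "struct_mult idx str (mcoord j i) (mcoord j' i') = (\<lambda>m. q powi (int i * j') * mcoord (j + j') (i + i') m)"
proof (cases "i < r \<and> i' < r")
  case True
  then have "struct_mult idx str (mcoord j i) (mcoord j' i') = str (j mod int N, i) (j' mod int N, i')"
    unfolding mcoord_def using N_pos by (simp add: struct_mult_unit idx_def)
  also have "\<dots> = (\<lambda>m. q powi (int i * j') * mcoord (j + j') (i + i') m)"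
    by (auto simp: str_def mcoord_def unit_coord_def fun_eq_iff mod_add_eq)
  finally show ?thesis .
qed (auto simp: mcoord_def)

lemma word_coord_coords: "word_coord w \<in> coords idx"
  unfolding word_coord_def by (rule coords_scale) simp

text \<open>The inversions across the cut, the \<open>x\<close>s of \<open>u\<close> times the
  \<open>a\<close>s of \<open>v\<close>, are exactly the exponent of \<open>q\<close> in
  \<open>mult_mcoord\<close>.\<close>

lemma word_coord_append:
  "word_coord (u @ v) = struct_mult idx str (word_coord u) (word_coord v)"
  unfolding word_coord_def
  by (simp add: struct_mult_scale mult_mcoord word_inversions_append power_add power_int_mult
      mult_ac flip: power_mult)

lemma word_coord_normal_word:
  assumes "m \<in> idx"
  shows "word_coord (normal_word m) = unit_coord m"
  using assms by (cases m)
    (auto simp: word_coord_def normal_word_def word_inversions_append count_list_replicate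
      mcoord_def idx_def)

abbreviation free :: "('k, gen list \<Rightarrow>\<^sub>0 'k) module" where
  "free \<equiv> monoid_algebra word_monoid"

lemma word_coord_rels:
  assumes "f \<in> H_relations q N \<nu>"
  shows "lin_comb word_coord f = (\<lambda>_. 0)"
  using assms by (auto simp: H_relations_def lin_comb_diff word_coord_def count_list_replicate mcoord_def)

lemma word_coord_mult:
  "lin_comb word_coord (monoid_algebra_mult word_monoid f g) =
    struct_mult idx str (lin_comb word_coord f) (lin_comb word_coord g)"
  by (rule lin_comb_monoid_algebra_mult) (auto simp: word_coord_append)

text \<open>The kernel of a multiplicative linear map is an ideal, and it contains the relations.
  This half makes the monomials linearly independent modulo the ideal.\<close>

lemma H_ideal_subset: "H_ideal q N \<nu> \<subseteq> {f. lin_comb word_coord f = (\<lambda>_. 0)}" (is "_ \<subseteq> ?K")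
proof -
  have "k_subspace ?K free"
    by (auto simp: k_subspace_monoid_algebra_iff lin_comb_add lin_comb_scale)
  then have "subgroup ?K (add_monoid free)"
    by (auto simp: k_subspace_def submodule_def)
  then have "ideal ?K free"
    using ring_free_algebra[unfolded free_algebra_def]
    by (intro idealI) (auto simp: word_coord_mult)
  then show ?thesis
    unfolding H_ideal_def genideal_def free_algebra_def
    using word_coord_rels by (intro Inter_lower) auto
qed

section \<open>Reduction of words to normal form modulo the relations\<close>

definition normal_lift :: "(int \<times> nat \<Rightarrow> 'k) \<Rightarrow> gen list \<Rightarrow>\<^sub>0 'k" where
  "normal_lift c = (\<Sum>m\<in>idx. Poly_Mapping.single (normal_word m) (c m))"

lemma normal_lift_unit: "m \<in> idx \<Longrightarrow> normal_lift (unit_coord m) = Poly_Mapping.single (normal_word m) 1"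
proof -
  assume m: "m \<in> idx"
  have "normal_lift (unit_coord m) = (\<Sum>m'\<in>idx. if m' = m then Poly_Mapping.single (normal_word m) 1 else 0)"
    unfolding normal_lift_def by (rule sum.cong) (auto simp: unit_coord_def)
  then show ?thesis using m by simp
qed

lemma normal_lift_scale: "normal_lift (\<lambda>m. k * c m) = Poly_Mapping.map ((*) k) (normal_lift c)"
  by (simp add: normal_lift_def scale_sum)

lemma normal_lift_zero [simp]: "normal_lift (\<lambda>_. 0) = 0"
  by (simp add: normal_lift_def)

lemma normal_lift_sum: "(\<Sum>w\<in>W. normal_lift (F w)) = normal_lift (\<lambda>m. \<Sum>w\<in>W. F w m)"
  unfolding normal_lift_def by (subst sum.swap) (simp add: single_sum)

lemma H_ideal_closed:
  "0 \<in> H_ideal q N \<nu>"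
  "f \<in> H_ideal q N \<nu> \<Longrightarrow> g \<in> H_ideal q N \<nu> \<Longrightarrow> f + g \<in> H_ideal q N \<nu>"
  "f \<in> H_ideal q N \<nu> \<Longrightarrow> monoid_algebra_mult word_monoid g f \<in> H_ideal q N \<nu>"
  "f \<in> H_ideal q N \<nu> \<Longrightarrow> monoid_algebra_mult word_monoid f g \<in> H_ideal q N \<nu>"
  "f \<in> H_ideal q N \<nu> \<Longrightarrow> Poly_Mapping.map ((*) k) f \<in> H_ideal q N \<nu>"
proof -
  interpret ideal "H_ideal q N \<nu>" free by (rule ideal_H_ideal[unfolded free_algebra_def])
  show "0 \<in> H_ideal q N \<nu>" 
    "f \<in> H_ideal q N \<nu> \<Longrightarrow> g \<in> H_ideal q N \<nu> \<Longrightarrow> f + g \<in> H_ideal q N \<nu>"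
    and l: "f \<in> H_ideal q N \<nu> \<Longrightarrow> monoid_algebra_mult word_monoid g f \<in> H_ideal q N \<nu>"
    and "f \<in> H_ideal q N \<nu> \<Longrightarrow> monoid_algebra_mult word_monoid f g \<in> H_ideal q N \<nu>" for g
    using additive_subgroup.zero_closed[OF is_additive_subgroup] additive_subgroup.a_closed[OF is_additive_subgroup, of f g] I_l_closed I_r_closed by auto
  \<comment> \<open>A scalar acts as multiplication by a multiple of the empty word, so an ideal of
    the ring is a subspace.\<close>
  have "Poly_Mapping.map ((*) k) f = monoid_algebra_mult word_monoid (Poly_Mapping.single [] k) f"
    by (subst (1 2) poly_mapping_sum_single)
      (simp add: monoid_algebra_mult_sum_right scale_sum)
  with l[of "Poly_Mapping.single [] k"]
  show "f \<in> H_ideal q N \<nu> \<Longrightarrow> Poly_Mapping.map ((*) k) f \<in> H_ideal q N \<nu>" by simp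
qed

lemma x_past_a:
  "Poly_Mapping.single (Gen_x # replicate j Gen_a) 1 -
    Poly_Mapping.single (replicate j Gen_a @ [Gen_x]) (q ^ j) \<in> H_ideal q N \<nu>"
proof (induction j)
  case 0
  then show ?case using H_ideal_closed(1) by simp
next
  case (Suc j)
  let ?s = "Poly_Mapping.single :: gen list \<Rightarrow> 'k \<Rightarrow> _" and ?m = "monoid_algebra_mult word_monoid"
  have "?s [Gen_x, Gen_a] 1 - ?s [Gen_a, Gen_x] q \<in> H_ideal q N \<nu>"
    using H_relations_ideal by (auto simp: H_relations_def)
  \<comment> \<open>The hypothesis times \<open>a\<close> on the right, plus \<open>q^j a^j\<close>
    times the relation \<open>x a - q a x\<close>: the terms in \<open>a^j x a\<close>
    cancel.\<close>
  from H_ideal_closed(2)[OF H_ideal_closed(4)[OF Suc, of "?s [Gen_a] 1"]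
      H_ideal_closed(3)[OF this, of "?s (replicate j Gen_a) (q ^ j)"]]
  show ?case
    by (simp add: monoid_algebra_mult_diff_left monoid_algebra_mult_diff_right algebra_simps
        flip: replicate_append_same)
qed

text \<open>A new \<open>a\<close> calls for \<open>a^N = 1\<close> only when its exponent
  overflows. A new \<open>x\<close> is carried past all the \<open>a\<close>s, and
  \<open>x^r = 0\<close> takes over when its exponent reaches \<open>r\<close>.\<close>

lemma reduce_cons:
  assumes "m \<in> idx"
  shows "Poly_Mapping.single (g # normal_word m) 1 - normal_lift (word_coord (g # normal_word m)) \<in> H_ideal q N \<nu>"
proof -
  let ?s = "Poly_Mapping.single :: gen list \<Rightarrow> 'k \<Rightarrow> _" and ?m = "monoid_algebra_mult word_monoid"
  obtain j i where m: "m = (int j, i)" and j: "j < N" and i: "i < r"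
    using assms by (cases m) (auto simp: idx_def elim!: zero_le_imp_eq_int[THEN exE])
  have nw: "normal_word m = replicate j Gen_a @ replicate i Gen_x"
    by (simp add: m normal_word_def)
  show ?thesis
  proof (cases g)
    case Gen_a
    have wc: "word_coord (g # normal_word m) = mcoord (int j + 1) i"
      using Gen_a
      by (simp add: nw word_coord_def word_inversions_append count_list_replicate add.commute)
    show ?thesis
    proof (cases "Suc j < N")
      case True
      have "normal_lift (word_coord (g # normal_word m)) = ?s (g # normal_word m) 1"
        unfolding wc using True i Gen_a
        by (subst unit_coord_eq_mcoord[symmetric], simp add: idx_def, subst normal_lift_unit)
          (simp_all add: idx_def normal_word_def m nat_add_distrib)
      then show ?thesis using H_ideal_closed(1) by simp
    next
      case False
      then have jN: "Suc j = N" using j by simp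
      then have modN: "(int j + 1) mod int N = 0" by (simp add: add.commute flip: jN)
      have "normal_lift (word_coord (g # normal_word m)) = normal_lift (unit_coord (0, i))"
        unfolding wc using modN i by (simp add: mcoord_def)
      also have "\<dots> = ?s (replicate i Gen_x) 1"
        using N_pos i by (subst normal_lift_unit) (simp_all add: idx_def normal_word_def)
      finally have "?s (g # normal_word m) 1 - normal_lift (word_coord (g # normal_word m)) =
        ?m (?s (replicate N Gen_a) 1 - ?s [] 1) (?s (replicate i Gen_x) 1)"
        using Gen_a by (simp add: monoid_algebra_mult_diff_left nw flip: jN)
      also have "\<dots> \<in> H_ideal q N \<nu>"
        using H_relations_ideal by (intro H_ideal_closed(4)) (auto simp: H_relations_def)
      finally show ?thesis .
    qed
  next
    case Gen_x
    have wc: "word_coord (g # normal_word m) = (\<lambda>w. q ^ j * mcoord (int j) (Suc i) w)"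
      using Gen_x by (simp add: nw word_coord_def word_inversions_append count_list_replicate)
    have "?m (?s (Gen_x # replicate j Gen_a) 1 - ?s (replicate j Gen_a @ [Gen_x]) (q ^ j))
        (?s (replicate i Gen_x) 1) \<in> H_ideal q N \<nu>"
      by (intro H_ideal_closed(4) x_past_a)
    then have 1: "?s (g # normal_word m) 1 - ?s (replicate j Gen_a @ replicate (Suc i) Gen_x) (q ^ j) \<in> H_ideal q N \<nu>"
      by (simp add: monoid_algebra_mult_diff_left nw Gen_x)
    show ?thesis
    proof (cases "Suc i < r")
      case True
      have "normal_lift (word_coord (g # normal_word m)) = Poly_Mapping.map ((*) (q ^ j)) (normal_lift (unit_coord (int j, Suc i)))"
        unfolding wc normal_lift_scale using True j by (simp add: unit_coord_eq_mcoord idx_def)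
      also have "\<dots> = ?s (replicate j Gen_a @ replicate (Suc i) Gen_x) (q ^ j)"
        using True j by (subst normal_lift_unit) (simp_all add: idx_def normal_word_def)
      finally show ?thesis using 1 by simp
    next
      case False
      then have ir: "Suc i = r" using i by simp
      have "?m (?s (replicate j Gen_a) (q ^ j)) (?s (replicate r Gen_x) 1) \<in> H_ideal q N \<nu>"
        using H_relations_ideal by (intro H_ideal_closed(3)) (auto simp: H_relations_def)
      from H_ideal_closed(2)[OF 1 this] have "?s (g # normal_word m) 1 \<in> H_ideal q N \<nu>"
        by (simp add: ir)
      moreover have "word_coord (g # normal_word m) = (\<lambda>_. 0)"
        unfolding wc using ir by (simp add: mcoord_zero)
      ultimately show ?thesis by simp
    qed
  qed
qed

text \<open>By induction the tail is congruent to a multiple of a normal word, which leaves a single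
  letter in front of a normal word.\<close>

lemma reduce_word: "Poly_Mapping.single w 1 - normal_lift (word_coord w) \<in> H_ideal q N \<nu>"
proof (induction w)
  case Nil
  have "word_coord [] = unit_coord (0, 0)"
    using N_pos r_gt_1 by (simp add: word_coord_def mcoord_def)
  then show ?case using H_ideal_closed(1) N_pos r_gt_1
    by (simp add: normal_lift_unit idx_def normal_word_def)
next
  case (Cons g w)
  let ?s = "Poly_Mapping.single :: gen list \<Rightarrow> 'k \<Rightarrow> _" and ?m = "monoid_algebra_mult word_monoid"
  let ?j = "int (count_list w Gen_a) mod int N" and ?i = "count_list w Gen_x"
  let ?k = "q ^ word_inversions w"
  have 1: "?s (g # w) 1 - ?m (?s [g] 1) (normal_lift (word_coord w)) \<in> H_ideal q N \<nu>"
    using H_ideal_closed(3)[OF Cons, of "?s [g] 1"] by (simp add: monoid_algebra_mult_diff_right)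
  have cons: "word_coord (g # u) = struct_mult idx str (word_coord [g]) (word_coord u)" for u
    using word_coord_append[of "[g]" u] by simp
  show ?case
  proof (cases "?i < r")
    case True
    then have m: "(?j, ?i) \<in> idx" using N_pos by (simp add: idx_def)
    have w: "word_coord w = (\<lambda>m. ?k * unit_coord (?j, ?i) m)"
      using True by (simp add: word_coord_def mcoord_def)
    have e1: "normal_lift (word_coord w) = ?s (normal_word (?j, ?i)) ?k"
      unfolding w using m by (simp only: normal_lift_scale normal_lift_unit scale_single mult_1_right)
    have e2: "word_coord (g # w) = (\<lambda>m. ?k * word_coord (g # normal_word (?j, ?i)) m)"
      by (simp only: cons[of w] cons[of "normal_word (?j, ?i)"] w word_coord_normal_word[OF m] struct_mult_scale)
    have "Poly_Mapping.map ((*) ?k) (?s (g # normal_word (?j, ?i)) 1 -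
        normal_lift (word_coord (g # normal_word (?j, ?i)))) \<in> H_ideal q N \<nu>"
      by (intro H_ideal_closed(5) reduce_cons m)
    then have "?m (?s [g] 1) (normal_lift (word_coord w)) - normal_lift (word_coord (g # w)) \<in> H_ideal q N \<nu>"
      by (simp add: e1 e2 scale_diff normal_lift_scale)
    from H_ideal_closed(2)[OF 1 this] show ?thesis by simp
  next
    case False
    then have "word_coord w = (\<lambda>_. 0)" by (simp add: word_coord_def mcoord_def)
    then show ?thesis using 1 by (simp add: cons[of w])
  qed
qed

text \<open>Every \<open>f\<close> is congruent to the normal form with coordinates
  \<open>lin_comb word_coord f\<close>, so coordinates 0 force membership in the ideal.\<close>

lemma H_ideal_eq:
  "H_ideal q N \<nu> = {f. Poly_Mapping.keys f \<subseteq> carrier word_monoid \<and> lin_comb word_coord f = (\<lambda>_. 0)}"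
proof
  show "{f. Poly_Mapping.keys f \<subseteq> carrier word_monoid \<and> lin_comb word_coord f = (\<lambda>_. 0)} \<subseteq> H_ideal q N \<nu>"
  proof clarify
    fix f assume f: "lin_comb word_coord f = (\<lambda>_. 0)"
    let ?F = "Poly_Mapping.lookup f"
    have "(\<Sum>w\<in>Poly_Mapping.keys f. Poly_Mapping.map ((*) (?F w)) (Poly_Mapping.single w 1 - normal_lift (word_coord w))) \<in> H_ideal q N \<nu>"
      by (intro closed_sum H_ideal_closed reduce_word)
    also have "(\<Sum>w\<in>Poly_Mapping.keys f. Poly_Mapping.map ((*) (?F w)) (Poly_Mapping.single w 1 - normal_lift (word_coord w)))
      = (\<Sum>w\<in>Poly_Mapping.keys f. Poly_Mapping.single w (?F w)) - normal_lift (lin_comb word_coord f)"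
      by (simp add: scale_diff sum_subtractf lin_comb_def flip: normal_lift_scale normal_lift_sum)
    finally show "f \<in> H_ideal q N \<nu>" by (simp add: f flip: poly_mapping_sum_single)
  qed
qed (use H_ideal_subset in auto)

definition hfib :: "(int \<times> nat \<Rightarrow> 'k) \<Rightarrow> 'k H_elem" where
  "hfib c = {f. lin_comb word_coord f = c}"

lemma coord_algebra_H_algebra: "coord_algebra (H_algebra q N \<nu>) idx str (mcoord 0 0) hfib"
  and H_gen_eq: "H_gen q N \<nu> g = hfib (word_coord [g])"
  and hfib_nonempty: "c \<in> coords idx \<Longrightarrow> hfib c \<noteq> {}"
proof -
  have outside: "\<And>u v w. w \<notin> idx \<Longrightarrow> str u v w = 0"
    using N_pos by (auto simp: idx_def str_def split: if_splits)
  have closed: "\<And>u v. u \<in> carrier word_monoid \<Longrightarrow> v \<in> carrier word_monoid \<Longrightarrow>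
      u \<otimes>\<^bsub>word_monoid\<^esub> v \<in> carrier word_monoid" "\<one>\<^bsub>word_monoid\<^esub> \<in> carrier word_monoid"
    by auto
  have surj: "\<And>m. m \<in> idx \<Longrightarrow> \<exists>w\<in>carrier word_monoid. word_coord w = unit_coord m"
    using word_coord_normal_word by auto
  have mult: "\<And>u v. u \<in> carrier word_monoid \<Longrightarrow> v \<in> carrier word_monoid \<Longrightarrow>
      word_coord (u \<otimes>\<^bsub>word_monoid\<^esub> v) = struct_mult idx str (word_coord u) (word_coord v)"
    by (simp add: word_coord_append)
  note * = coord_algebra_quot[where M = word_monoid, OF finite_idx outside closed word_coord_coords mult surj H_ideal_eq]
  show "coord_algebra (H_algebra q N \<nu>) idx str (mcoord 0 0) hfib"
    using *(1) by (simp add: H_algebra_def free_algebra_def hfib_def[abs_def] word_coord_def)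
  show "H_gen q N \<nu> g = hfib (word_coord [g])"
    using *(2) by (simp add: H_gen_def free_algebra_def hfib_def)
  show "c \<in> coords idx \<Longrightarrow> hfib c \<noteq> {}"
    using *(3) by (simp add: hfib_def)
qed

end

section \<open>The Hopf structure in coordinates\<close>

text \<open>Gaussian binomial coefficients. The recursion avoids division, so it makes sense at
  roots of unity, and this version of Pascal's rule is the one produced by left multiplication with
  \<open>\<Delta>(x)\<close>.\<close>

fun qbinom :: "'k::field \<Rightarrow> nat \<Rightarrow> nat \<Rightarrow> 'k" where
  "qbinom p n 0 = 1"
| "qbinom p 0 (Suc k) = 0"
| "qbinom p (Suc n) (Suc k) = qbinom p n k + p ^ Suc k * qbinom p n (Suc k)"

lemma qbinom_eq_0: "n < k \<Longrightarrow> qbinom p n k = 0"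
  by (induction p n k rule: qbinom.induct) auto

lemma qbinom_self [simp]: "qbinom p n n = 1"
  by (induction n) (auto simp: qbinom_eq_0)

text \<open>The analogue of \<open>k * binom n k = n * binom (n - 1) (k - 1)\<close>, written
  without division; it decides which of the coefficients in use vanish at a root of unity.\<close>

lemma qbinom_absorb: "(p ^ Suc k - 1) * qbinom p (Suc n) (Suc k) = (p ^ Suc n - 1) * qbinom p n k"
proof (induction n arbitrary: k)
  case 0
  then show ?case by (cases k) auto
next
  case (Suc n)
  show ?case
  proof (cases k)
    case 0
    have "(p - 1) * qbinom p (Suc n) (Suc 0) = p ^ Suc n - 1" using Suc[of 0] by simp
    then have "p * ((p - 1) * qbinom p (Suc n) (Suc 0)) = p * (p ^ Suc n - 1)" by simp
    then show ?thesis by (simp add: 0 algebra_simps)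
  next
    case k: (Suc l)
    let ?a = "qbinom p (Suc n) (Suc l)" and ?b = "qbinom p (Suc n) (Suc (Suc l))"
    have 1: "(p ^ Suc l - 1) * ?a = (p ^ Suc n - 1) * qbinom p n l" by (rule Suc)
    have 2: "(p ^ Suc (Suc l) - 1) * ?b = (p ^ Suc n - 1) * qbinom p n (Suc l)" by (rule Suc)
    have 3: "?a = qbinom p n l + p ^ Suc l * qbinom p n (Suc l)" by simp
    \<comment> \<open>With \<open>P = p^(l+1)\<close> and \<open>R = p^(n+1)\<close>: adding
      \<open>P\<close> times the second hypothesis to the first lets Pascal's rule recombine the
      lower row into \<open>?a\<close>. What remains is a ring identity in \<open>p\<close>,
      \<open>P\<close>, \<open>R\<close>, \<open>?a\<close> and \<open>?b\<close>.\<close>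
    have "(p ^ Suc n - 1) * ?a = (p ^ Suc l - 1) * ?a + p ^ Suc l * ((p ^ Suc (Suc l) - 1) * ?b)"
      unfolding 1 2 by (subst 3) (simp add: algebra_simps)
    moreover have "(R - 1) * a = (P - 1) * a + P * ((p * P - 1) * b) \<Longrightarrow>
        (p * P - 1) * (a + p * P * b) = (p * R - 1) * a" for P R a b
      by (drule arg_cong[where f = "\<lambda>x. p * x"]) (simp add: algebra_simps)
    ultimately show ?thesis
      unfolding k qbinom.simps(3)[of p "Suc n"] power_Suc[of p "Suc l"] power_Suc[of p "Suc n"] by blast
  qed
qed

context H_data
begin

lemma H_hopf_simps:
  "carrier (H_hopf q N \<nu>) = carrier (H_algebra q N \<nu>)"
  "monoid.mult (H_hopf q N \<nu>) = monoid.mult (H_algebra q N \<nu>)"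
  "one (H_hopf q N \<nu>) = one (H_algebra q N \<nu>)"
  "ring.zero (H_hopf q N \<nu>) = ring.zero (H_algebra q N \<nu>)"
  "ring.add (H_hopf q N \<nu>) = ring.add (H_algebra q N \<nu>)"
  "module.smult (H_hopf q N \<nu>) = module.smult (H_algebra q N \<nu>)"
  by (simp_all add: H_hopf_def Let_def)

sublocale HA: coord_algebra "H_algebra q N \<nu>" idx str "mcoord 0 0" hfib
  by (rule coord_algebra_H_algebra)

sublocale H: coord_algebra "H_hopf q N \<nu>" idx str "mcoord 0 0" hfib
  by (rule coord_algebra.intro)
    (simp_all add: H_hopf_simps HA.finite_J HA.st_outside HA.carrier_eq HA.fib_inj HA.fib_zero
      HA.fib_one HA.fib_add HA.fib_mult HA.fib_smult)

sublocale HT: coord_tensor "H_hopf q N \<nu>" idx str "mcoord 0 0" hfib "H_hopf q N \<nu>" idx str "mcoord 0 0" hfib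
  by unfold_locales

text \<open>Associativity is inherited from the free algebra, since the coordinate description does
  not include it; powers and inverses rely on it.\<close>

lemma monoid_H: "Group.monoid (H_hopf q N \<nu>)"
proof -
  interpret ideal "H_ideal q N \<nu>" free by (rule ideal_H_ideal[unfolded free_algebra_def])
  interpret Q: ring "free Quot H_ideal q N \<nu>" by (rule quotient_is_ring)
  show ?thesis
    by (rule monoidI)
      (simp_all add: H_hopf_simps H_algebra_def quot_algebra_def free_algebra_def Q.m_assoc)
qed

text \<open>\<open>\<Delta>\<close> is defined through the tensor square of
  \<open>H_algebra\<close>, whereas Hopf subalgebras refer to that of \<open>H_hopf\<close>. Tensor
  products read only the algebra fields, so the two coincide.\<close>

lemma tensor_H_algebra:
  "tensor_algebra (H_algebra q N \<nu>) (H_algebra q N \<nu>) = tensor_algebra (H_hopf q N \<nu>) (H_hopf q N \<nu>)"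
  "pure_tensor (H_algebra q N \<nu>) (H_algebra q N \<nu>) = pure_tensor (H_hopf q N \<nu>) (H_hopf q N \<nu>)"
proof -
  have "H_algebra q N \<nu> \<times>\<times> H_algebra q N \<nu> = H_hopf q N \<nu> \<times>\<times> H_hopf q N \<nu>"
    by (simp add: DirProd_def H_hopf_simps)
  then show "tensor_algebra (H_algebra q N \<nu>) (H_algebra q N \<nu>) = tensor_algebra (H_hopf q N \<nu>) (H_hopf q N \<nu>)"
    "pure_tensor (H_algebra q N \<nu>) (H_algebra q N \<nu>) = pure_tensor (H_hopf q N \<nu>) (H_hopf q N \<nu>)"
    by (simp_all add: tensor_algebra_def pure_tensor_def[abs_def] tensor_null_def H_hopf_simps)
qed

lemma H_a_eq: "H_a q N \<nu> = hfib (mcoord 1 0)" and H_x_eq: "H_x q N \<nu> = hfib (mcoord 0 1)"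
  by (simp_all add: H_gen_eq word_coord_def)

lemma hfib_mcoord_mult:
  "hfib (mcoord j i) \<otimes>\<^bsub>H_hopf q N \<nu>\<^esub> hfib (mcoord j' i') =
    hfib (\<lambda>m. q powi (int i * j') * mcoord (j + j') (i + i') m)"
  by (simp add: H.fib_mult mult_mcoord)

lemma hfib_mcoord_pow: "hfib (mcoord j 0) [^]\<^bsub>H_hopf q N \<nu>\<^esub> (m::nat) = hfib (mcoord (int m * j) 0)"
proof -
  interpret Group.monoid "H_hopf q N \<nu>" by (rule monoid_H)
  show ?thesis
    by (induction m) (simp_all add: H.fib_one hfib_mcoord_mult algebra_simps)
qed

lemma H_a_pow: "H_a q N \<nu> [^]\<^bsub>H_hopf q N \<nu>\<^esub> (m::nat) = hfib (mcoord (int m) 0)"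
  by (simp add: H_a_eq hfib_mcoord_pow)

lemma hfib_mcoord_inv: "inv\<^bsub>H_hopf q N \<nu>\<^esub> hfib (mcoord j 0) = hfib (mcoord (- j) 0)"
proof -
  interpret Group.monoid "H_hopf q N \<nu>" by (rule monoid_H)
  show ?thesis
    by (rule inv_unique'[symmetric]) (simp_all add: hfib_mcoord_mult H.fib_one)
qed

lemma inv_H_algebra: "m_inv (H_algebra q N \<nu>) = m_inv (H_hopf q N \<nu>)"
  by (simp add: m_inv_def[abs_def] H_hopf_simps)

lemma pow_H_algebra: "g [^]\<^bsub>H_algebra q N \<nu>\<^esub> (m::nat) = g [^]\<^bsub>H_hopf q N \<nu>\<^esub> m"
  by (simp add: nat_pow_def H_hopf_simps)

section \<open>The comultiplication\<close>

abbreviation tmcoord :: "int \<Rightarrow> nat \<Rightarrow> int \<Rightarrow> nat \<Rightarrow> (int \<times> nat) \<times> (int \<times> nat) \<Rightarrow> 'k" where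
  "tmcoord j i j' i' \<equiv> tensor_coord (mcoord j i) (mcoord j' i')"

lemma mult_tmcoord:
  "struct_mult (idx \<times> idx) (tensor_struct str str) (tmcoord a b a' b') (tmcoord j i j' i') =
    (\<lambda>m. q powi (int b * j + int b' * j') * tmcoord (a + j) (b + i) (a' + j') (b' + i') m)"
  unfolding struct_mult_tensor_coord mult_mcoord
  by (auto simp: tensor_coord_def power_int_add fun_eq_iff mult_ac)

definition comult_gen :: "gen \<Rightarrow> (int \<times> nat) \<times> (int \<times> nat) \<Rightarrow> 'k" where
  "comult_gen = case_gen (tmcoord 1 0 1 0) (\<lambda>m. tmcoord 0 1 (int \<nu>) 0 m + tmcoord 0 0 0 1 m)"

text \<open>Used for every \<open>i\<close>, so that the induction over words needs no case
  distinction at \<open>r\<close>; that it vanishes from \<open>r\<close> on is proved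
  separately.\<close>

definition comult_basis :: "int \<Rightarrow> nat \<Rightarrow> (int \<times> nat) \<times> (int \<times> nat) \<Rightarrow> 'k" where
  "comult_basis j i = (\<lambda>m. \<Sum>t\<le>i. qbinom (q ^ \<nu>) i t * tmcoord j t (j + int \<nu> * int t) (i - t) m)"

text \<open>From \<open>\<Delta>(a\<^sup>j x\<^sup>m) = (\<Sum>t\<le>m. qbinom (q ^ \<nu>) m t a\<^sup>j x\<^sup>t \<otimes> a\<^bsup>j + \<nu> t\<^esup> x\<^bsup>m - t\<^esup>)\<close>: each basis tensor
  occurs in \<open>\<Delta>\<close> of at most one monomial.\<close>

definition comult_coord :: "(int \<times> nat \<Rightarrow> 'k) \<Rightarrow> (int \<times> nat) \<times> (int \<times> nat) \<Rightarrow> 'k" where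
  "comult_coord c = (\<lambda>((j, i), (j', i')).
    if (j, i) \<in> idx \<and> (j', i') \<in> idx \<and> j' = (j + int \<nu> * int i) mod int N \<and> i + i' < r
    then qbinom (q ^ \<nu>) (i + i') i * c (j, i + i') else 0)"

lemma comult_gen_coords: "comult_gen g \<in> coords (idx \<times> idx)"
  by (cases g) (auto simp: comult_gen_def intro!: coords_add tensor_coord_coords)

lemma comult_basis_a:
  "struct_mult (idx \<times> idx) (tensor_struct str str) (comult_gen Gen_a) (comult_basis j i) = comult_basis (j + 1) i"
  unfolding comult_basis_def struct_mult_sum_right
  by (simp add: comult_gen_def mult_tmcoord algebra_simps)

text \<open>The summand \<open>x \<otimes> a^\<nu>\<close> of \<open>\<Delta>(x)\<close> raises
  \<open>t\<close> by one at the cost of \<open>q^j\<close>; the summand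
  \<open>1 \<otimes> x\<close> passes \<open>a^(j + \<nu> t)\<close> at the cost of
  \<open>q^(j + \<nu> t)\<close>. Up to the common \<open>q^j\<close> this is Pascal's rule at
  \<open>q ^ \<nu>\<close>.\<close>

lemma comult_basis_x:
  "struct_mult (idx \<times> idx) (tensor_struct str str) (comult_gen Gen_x) (comult_basis j i) =
    (\<lambda>m. q powi j * comult_basis j (Suc i) m)"
proof
  fix m
  let ?t = "\<lambda>t. tmcoord j t (j + int \<nu> * int t) (Suc i - t) m"
  let ?qb = "qbinom (q ^ \<nu>)"
  have pow: "q powi (int \<nu> * int t) = (q ^ \<nu>) ^ t" "q powi (int t * int \<nu>) = (q ^ \<nu>) ^ t" for t
    unfolding mult.commute[of "int t"] by (simp_all only: power_int_mult power_int_of_nat)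
  have "struct_mult (idx \<times> idx) (tensor_struct str str) (comult_gen Gen_x) (comult_basis j i) m =
    (\<Sum>t\<le>i. ?qb i t * (q powi j * ?t (Suc t))) + (\<Sum>t\<le>i. ?qb i t * (q powi (j + int \<nu> * int t) * ?t t))"
    unfolding comult_basis_def struct_mult_sum_right sum.distrib[symmetric]
    by (intro sum.cong refl)
      (simp add: comult_gen_def struct_mult_add_left mult_tmcoord Suc_diff_le algebra_simps)
  also have "\<dots> = q powi j * ((\<Sum>t\<le>i. ?qb i t * ?t (Suc t)) + (\<Sum>t\<le>i. (q ^ \<nu>) ^ t * ?qb i t * ?t t))"
    by (simp add: power_int_add pow distrib_left sum_distrib_left mult_ac)
  \<comment> \<open>The added term at \<open>Suc i\<close> is 0 because \<open>qbinom\<close>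
    vanishes there; splitting off \<open>t = 0\<close> then aligns the two sums.\<close>
  also have "(\<Sum>t\<le>i. (q ^ \<nu>) ^ t * ?qb i t * ?t t) = (\<Sum>t\<le>Suc i. (q ^ \<nu>) ^ t * ?qb i t * ?t t)"
    by (simp add: qbinom_eq_0)
  also have "\<dots> = ?t 0 + (\<Sum>t\<le>i. (q ^ \<nu>) ^ Suc t * ?qb i (Suc t) * ?t (Suc t))"
    by (subst sum.atMost_Suc_shift) simp
  also have "(\<Sum>t\<le>i. ?qb i t * ?t (Suc t)) + \<dots> = ?t 0 + (\<Sum>t\<le>i. ?qb (Suc i) (Suc t) * ?t (Suc t))"
    by (simp add: sum.distrib algebra_simps)
  also have "\<dots> = comult_basis j (Suc i) m"
    unfolding comult_basis_def by (subst sum.atMost_Suc_shift) simp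
  finally show "struct_mult (idx \<times> idx) (tensor_struct str str) (comult_gen Gen_x) (comult_basis j i) m =
    q powi j * comult_basis j (Suc i) m" .
qed

lemma p_pow_eq_1: "(q ^ \<nu>) ^ m = 1 \<longleftrightarrow> r dvd m"
  by (rule mult_order_pow_eq_1) simp

text \<open>In the absorption identity the factor \<open>p^r - 1\<close> on the right is 0, while
  \<open>p^t - 1\<close> on the left is nonzero below the order.\<close>

lemma qbinom_r:
  assumes "0 < t" "t < r"
  shows "qbinom (q ^ \<nu>) r t = 0"
proof -
  obtain s k where rt: "r = Suc s" "t = Suc k" using assms by (cases r; cases t) auto
  have "((q ^ \<nu>) ^ t - 1) * qbinom (q ^ \<nu>) r t = ((q ^ \<nu>) ^ r - 1) * qbinom (q ^ \<nu>) s k"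
    unfolding rt by (rule qbinom_absorb)
  moreover have "(q ^ \<nu>) ^ r = 1" by (simp only: p_pow_eq_1 dvd_refl)
  moreover have "(q ^ \<nu>) ^ t \<noteq> 1"
    using assms by (simp only: p_pow_eq_1 nat_dvd_not_less not_False_eq_True)
  ultimately show ?thesis by simp
qed

text \<open>Here \<open>(p - 1) * qbinom p i 1 = p^i - 1\<close>, which is nonzero below the order.
  This is what makes \<open>a^j x\<close> accessible from \<open>a^j x^i\<close>.\<close>

lemma qbinom_1_nonzero:
  assumes "0 < i" "i < r"
  shows "qbinom (q ^ \<nu>) i 1 \<noteq> 0"
proof -
  obtain s where "i = Suc s" using assms by (cases i) auto
  then have "(q ^ \<nu> - 1) * qbinom (q ^ \<nu>) i 1 = (q ^ \<nu>) ^ i - 1"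
    using qbinom_absorb[of "q ^ \<nu>" 0 s] by simp
  moreover have "(q ^ \<nu>) ^ i \<noteq> 1"
    using assms by (simp only: p_pow_eq_1 nat_dvd_not_less not_False_eq_True)
  ultimately show ?thesis by auto
qed

text \<open>This is the compatibility of \<open>\<Delta>\<close> with \<open>x\<^sup>r = 0\<close>: \<open>q ^ \<nu>\<close> is a primitive \<open>r\<close>-th root of unity.\<close>

lemma comult_basis_r: "r \<le> i \<Longrightarrow> comult_basis j i = (\<lambda>_. 0)"
proof (induction i rule: dec_induct)
  case base
  have z: "qbinom (q ^ \<nu>) r t * tmcoord j t (j + int \<nu> * int t) (r - t) m = 0" if "t \<le> r" for t m
  proof (cases "t = 0 \<or> t = r")
    \<comment> \<open>At either end one tensor factor carries \<open>x^r\<close>, which is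
      0.\<close>
    case True
    then show ?thesis by (auto simp: mcoord_def tensor_coord_def split: prod.splits)
  qed (use qbinom_r that in auto)
  show ?case unfolding comult_basis_def by (rule ext, rule sum.neutral, rule ballI, rule z) simp
next
  case (step i)
  then have "(\<lambda>m. q powi j * comult_basis j (Suc i) m) = (\<lambda>_. 0)"
    using comult_basis_x[of j i] by simp
  then show ?case by (simp add: fun_eq_iff)
qed

text \<open>The exponent of \<open>x\<close> on the left equals \<open>t\<close>, so a given
  position receives at most the term with \<open>t = i1\<close>. From \<open>r\<close> on both sides
  vanish.\<close>

lemma comult_coord_mcoord: "comult_coord (mcoord j i) = comult_basis j i"
proof (cases "i < r")
  case True
  show ?thesis
  proof (rule ext, clarify)
    fix j1 i1 j2 i2
    have "comult_basis j i ((j1, i1), (j2, i2)) = (\<Sum>t\<le>i. if t = i1 then qbinom (q ^ \<nu>) i i1 *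
        (if j1 = j mod int N \<and> j2 = (j + int \<nu> * int i1) mod int N \<and> i2 = i - i1 then 1 else 0) else 0)"
      unfolding comult_basis_def using True
      by (intro sum.cong) (auto simp: tensor_coord_def mcoord_def unit_coord_def)
    also have "\<dots> = comult_coord (mcoord j i) ((j1, i1), (j2, i2))"
    proof (cases "j1 = j mod int N \<and> j2 = (j + int \<nu> * int i1) mod int N \<and> i1 + i2 = i")
      case D: True
      then have "j2 = (j1 + int \<nu> * int i1) mod int N" by (simp add: mod_add_left_eq)
      moreover have "(j1, i1) \<in> idx" "(j2, i2) \<in> idx" using D True N_pos by (auto simp: idx_def)
      moreover have "mcoord j i (j1, i1 + i2) = 1" using D True by (simp add: mcoord_def unit_coord_def)
      ultimately have "comult_coord (mcoord j i) ((j1, i1), (j2, i2)) = qbinom (q ^ \<nu>) i i1"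
        using D True by (simp only: comult_coord_def prod.case) simp
      then show ?thesis using D by (simp only: sum.delta finite_atMost) auto
    next
      case D: False
      have "comult_coord (mcoord j i) ((j1, i1), (j2, i2)) = 0"
      proof (rule ccontr)
        assume nz: "comult_coord (mcoord j i) ((j1, i1), (j2, i2)) \<noteq> 0"
        then have 1: "j2 = (j1 + int \<nu> * int i1) mod int N"
          unfolding comult_coord_def prod.case by presburger
        from nz have "mcoord j i (j1, i1 + i2) \<noteq> 0"
          unfolding comult_coord_def prod.case by (metis mult_zero_right)
        then have "j1 = j mod int N" "i1 + i2 = i"
          by (simp_all add: mcoord_def unit_coord_def split: if_splits)
        with 1 D show False by (simp add: mod_add_left_eq)
      qed
      moreover have "\<not> (j1 = j mod int N \<and> j2 = (j + int \<nu> * int i1) mod int N \<and> i2 = i - i1)" if "i1 \<le> i"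
        using D that by auto
      ultimately show ?thesis by (simp only: sum.delta finite_atMost atMost_iff) auto
    qed
    finally show "comult_coord (mcoord j i) ((j1, i1), (j2, i2)) = comult_basis j i ((j1, i1), (j2, i2))" ..
  qed
qed (auto simp: comult_basis_r mcoord_zero comult_coord_def)

lemma comult_coord_scale: "comult_coord (\<lambda>m. k * c m) = (\<lambda>m. k * comult_coord c m)"
  by (auto simp: comult_coord_def)

lemma comult_coord_lin_comb: "lin_comb (\<lambda>w. comult_coord (\<beta> w)) f = comult_coord (lin_comb \<beta> f)"
proof (rule ext, clarify)
  fix j i j' i'
  let ?C = "(j, i) \<in> idx \<and> (j', i') \<in> idx \<and> j' = (j + int \<nu> * int i) mod int N \<and> i + i' < r"
  show "lin_comb (\<lambda>w. comult_coord (\<beta> w)) f ((j, i), (j', i')) = comult_coord (lin_comb \<beta> f) ((j, i), (j', i'))"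
  proof (cases ?C)
    case True
    then have "comult_coord c ((j, i), (j', i')) = qbinom (q ^ \<nu>) (i + i') i * c (j, i + i')" for c
      unfolding comult_coord_def prod.case by (rule if_P)
    then show ?thesis by (simp add: lin_comb_def sum_distrib_left mult_ac)
  next
    case False
    then have "comult_coord c ((j, i), (j', i')) = 0" for c
      unfolding comult_coord_def prod.case by (rule if_not_P)
    then show ?thesis by (simp add: lin_comb_def)
  qed
qed

lemma comult_coord_coords: "comult_coord c \<in> coords (idx \<times> idx)"
  by (auto simp: comult_coord_def coords_def)

text \<open>The right side sees a word only through its coordinates, which is what makes the map
  defining \<open>\<Delta>\<close> constant on cosets.\<close>

lemma word_prod_comult: "HT.T.word_prod comult_gen w = comult_coord (word_coord w)"
proof -
  have "HT.T.word_prod comult_gen w = (\<lambda>m. q ^ word_inversions w *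
    comult_basis (int (count_list w Gen_a)) (count_list w Gen_x) m)"
  proof (induction w)
    case Nil
    show ?case by (simp add: comult_basis_def fun_eq_iff)
  next
    case (Cons g w)
    then show ?case
      by (cases g) (simp_all add: struct_mult_scale comult_basis_a comult_basis_x power_add add.commute mult_ac)
  qed
  then show ?thesis
    by (simp add: word_coord_def comult_coord_scale comult_coord_mcoord)
qed

lemma comult_H:
  assumes "c \<in> coords idx"
  shows "comult (H_hopf q N \<nu>) (hfib c) = HT.tfib (comult_coord c)"
proof -
  let ?H = "H_hopf q N \<nu>"
  let ?\<psi> = "case_gen (pure_tensor ?H ?H (H_a q N \<nu>) (H_a q N \<nu>))
    (pure_tensor ?H ?H (H_x q N \<nu>) (H_a q N \<nu> [^]\<^bsub>?H\<^esub> \<nu>) \<oplus>\<^bsub>tensor_algebra ?H ?H\<^esub>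
      pure_tensor ?H ?H \<one>\<^bsub>?H\<^esub> (H_x q N \<nu>))"
  have def: "comult ?H = quot_map (free_ext (tensor_algebra ?H ?H) ?\<psi>)"
    by (subst H_hopf_def) (simp add: Let_def tensor_H_algebra pow_H_algebra H_hopf_simps)
  have \<psi>: "?\<psi> g = HT.tfib (comult_gen g)" for g
    by (cases g) (simp_all add: hfib_mcoord_pow H_a_eq H_x_eq H.fib_one HT.pure_tensor_fib comult_gen_def
        HT.T.fib_add tensor_coord_coords)
  have "free_ext (tensor_algebra ?H ?H) ?\<psi> f = HT.tfib (comult_coord c)" if "f \<in> hfib c" for f
    using HT.T.free_ext_fib[OF comult_gen_coords \<psi>, where f = f] that
    by (simp add: word_prod_comult[abs_def] comult_coord_lin_comb hfib_def)
  then show ?thesis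
    unfolding def by (intro quot_map_eqI hfib_nonempty assms)
qed

section \<open>The counit\<close>

definition counit_coord :: "(int \<times> nat \<Rightarrow> 'k) \<Rightarrow> 'k" where
  "counit_coord c = (\<Sum>j\<in>{0..<int N}. c (j, 0))"

lemma counit_coord_mcoord: "counit_coord (mcoord j i) = (if i = 0 then 1 else 0)"
proof -
  have "counit_coord (mcoord j i) = (\<Sum>j'\<in>{0..<int N}. if j' = j mod int N then (if i = 0 then 1 else 0) else 0)"
    unfolding counit_coord_def using r_gt_1 by (intro sum.cong) (auto simp: mcoord_def unit_coord_def)
  then show ?thesis using N_pos by simp
qed

lemma counit_coord_scale: "counit_coord (\<lambda>m. k * c m) = k * counit_coord c"
  by (simp add: counit_coord_def sum_distrib_left)

lemma counit_coord_lin_comb: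
  "counit_coord (lin_comb \<beta> f) = (\<Sum>w\<in>Poly_Mapping.keys f. Poly_Mapping.lookup f w * counit_coord (\<beta> w))"
  unfolding counit_coord_def lin_comb_def by (subst sum.swap) (simp add: sum_distrib_left)

lemma counit_H:
  assumes "c \<in> coords idx"
  shows "counit (H_hopf q N \<nu>) (hfib c) = counit_coord c"
proof -
  interpret G: coord_algebra "ground_algebra :: ('k, 'k) module" "{()}" "\<lambda>_ _ _. 1" "\<lambda>_. 1" "\<lambda>c. c ()"
    by (rule coord_algebra_ground)
  have def: "counit (H_hopf q N \<nu>) = quot_map (free_ext ground_algebra (case_gen 1 0))"
    by (simp add: H_hopf_def Let_def)
  define \<delta> :: "gen \<Rightarrow> unit \<Rightarrow> 'k" where "\<delta> = (\<lambda>g _. case_gen 1 0 g)"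
  have cw: "counit_coord (word_coord w) = (if count_list w Gen_x = 0 then q ^ word_inversions w else 0)" for w
    by (simp add: word_coord_def counit_coord_scale counit_coord_mcoord)
  have wp: "G.word_prod \<delta> w = (\<lambda>_. if count_list w Gen_x = 0 then q ^ word_inversions w else 0)" for w
  proof (induction w)
    case (Cons g w)
    then show ?case by (cases g) (auto simp: \<delta>_def struct_mult_def)
  qed simp
  have "free_ext ground_algebra (case_gen 1 0) f = counit_coord c" if "f \<in> hfib c" for f
  proof -
    have "free_ext ground_algebra (case_gen 1 0) f = lin_comb (G.word_prod \<delta>) f ()"
      by (rule G.free_ext_fib) (auto simp: \<delta>_def coords_def)
    also have "\<dots> = (\<Sum>w\<in>Poly_Mapping.keys f. Poly_Mapping.lookup f w * counit_coord (word_coord w))"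
      by (simp add: lin_comb_def wp cw)
    also have "\<dots> = counit_coord (lin_comb word_coord f)"
      by (simp add: counit_coord_lin_comb)
    finally show ?thesis using that by (simp add: hfib_def)
  qed
  then show ?thesis
    unfolding def by (intro quot_map_eqI hfib_nonempty assms)
qed

section \<open>The antipode\<close>

definition antipode_scalar :: "nat \<Rightarrow> 'k" where
  "antipode_scalar i = (\<Prod>t<i. - (q powi (- (int \<nu> * int (Suc t)))))"

text \<open>The antipode sends \<open>a^j x^i\<close> to a multiple of
  \<open>a^(- j - \<nu> i) x^i\<close>. For fixed \<open>i\<close> this substitution on exponents is
  an involution, so the coefficient at \<open>(j, i)\<close> is read off at
  \<open>- j - \<nu> i\<close>.\<close>

definition antipode_coord :: "(int \<times> nat \<Rightarrow> 'k) \<Rightarrow> int \<times> nat \<Rightarrow> 'k" where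
  "antipode_coord c = (\<lambda>(j, i). if (j, i) \<in> idx
    then antipode_scalar i * q powi (int i * (j + int \<nu> * int i)) * c ((- j - int \<nu> * int i) mod int N, i) else 0)"

text \<open>The value \<open>s(x)^i s(a)^j\<close>, in reversed order. Moving \<open>x^i\<close>
  past \<open>a^(- j)\<close> contributes \<open>q^(- i j)\<close>; \<open>antipode_scalar i\<close>
  gathers the signs and powers of \<open>q\<close> from writing \<open>s(x)^i\<close> as a multiple
  of \<open>a^(- \<nu> i) x^i\<close>.\<close>

definition antipode_basis :: "int \<Rightarrow> nat \<Rightarrow> int \<times> nat \<Rightarrow> 'k" where
  "antipode_basis j i = (\<lambda>m. antipode_scalar i * q powi (- (int i * j)) * mcoord (- j - int \<nu> * int i) i m)"

definition antipode_gen :: "gen \<Rightarrow> int \<times> nat \<Rightarrow> 'k" where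
  "antipode_gen = case_gen (mcoord (-1) 0) (\<lambda>m. - (q powi (- int \<nu>)) * mcoord (- int \<nu>) 1 m)"

lemma antipode_coord_mcoord: "antipode_coord (mcoord j i) = antipode_basis j i"
proof (cases "i < r")
  case True
  have *: "(- j1 - int \<nu> * int i) mod int N = j mod int N \<longleftrightarrow> j1 = (- j - int \<nu> * int i) mod int N"
    if "j1 \<in> {0..<int N}" for j1
  proof -
    have "(- j1 - int \<nu> * int i) mod int N = j mod int N \<longleftrightarrow> int N dvd - (- j1 - int \<nu> * int i - j)"
      unfolding mod_eq_dvd_iff dvd_minus_iff ..
    also have "- (- j1 - int \<nu> * int i - j) = j1 - (- j - int \<nu> * int i)" by simp
    also have "int N dvd \<dots> \<longleftrightarrow> j1 mod int N = (- j - int \<nu> * int i) mod int N"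
      by (rule mod_eq_dvd_iff[symmetric])
    finally show ?thesis using that by simp
  qed
  have powi: "q powi (int i * (j1 + int \<nu> * int i)) = q powi (- (int i * j))"
    if "j1 = (- j - int \<nu> * int i) mod int N" for j1
  proof -
    have "q powi (int i * ((- j - int \<nu> * int i) mod int N + int \<nu> * int i)) =
       q powi (int i * (((- j - int \<nu> * int i) mod int N + int \<nu> * int i) mod int N))" by simp
    also have "((- j - int \<nu> * int i) mod int N + int \<nu> * int i) mod int N = (- j) mod int N"
      by (simp add: mod_simps)
    also have "q powi (int i * ((- j) mod int N)) = q powi (int i * (- j))" by (rule powi_mult_mod)
    finally show ?thesis using that by simp
  qed
  show ?thesis
  proof (rule ext, clarify)
    fix j1 i1
    show "antipode_coord (mcoord j i) (j1, i1) = antipode_basis j i (j1, i1)"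
      using True N_pos *[of j1] powi[of j1]
      by (auto simp: antipode_coord_def antipode_basis_def mcoord_def unit_coord_def idx_def)
  qed
qed (auto simp: antipode_coord_def antipode_basis_def mcoord_zero)

lemma antipode_basis_a:
  "struct_mult idx str (antipode_basis j i) (antipode_gen Gen_a) = antipode_basis (j + 1) i"
proof -
  have "q powi (- (int i * j)) * q powi (int i * -1) = q powi (- (int i * (j + 1)))"
    by (simp only: power_int_add[symmetric] q_nonzero simp_thms) (simp add: algebra_simps)
  moreover have "- j - int \<nu> * int i + -1 = - (j + 1) - int \<nu> * int i" by simp
  ultimately show ?thesis
    unfolding antipode_basis_def antipode_gen_def gen.case struct_mult_scale mult_mcoord
    by (simp only: mult.assoc add_0_right) (simp only: mult.assoc[symmetric])
qed

text \<open>A new first letter of the word is multiplied on the right, as the product is the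
  opposite one; \<open>q^j\<close> is the cost of sorting \<open>x a^j x^i\<close>.\<close>

lemma antipode_basis_x:
  "struct_mult idx str (antipode_basis j i) (antipode_gen Gen_x) = (\<lambda>m. q powi j * antipode_basis j (Suc i) m)"
proof
  fix m
  have "q powi (- (int i * j)) * (q powi (- int \<nu>) * q powi (int i * - int \<nu>)) =
      q powi j * (q powi (- (int \<nu> * int (Suc i))) * q powi (- (int (Suc i) * j)))"
    by (simp only: power_int_add[symmetric] q_nonzero simp_thms) (simp add: algebra_simps)
  \<comment> \<open>The powers of \<open>q\<close> were matched just before; this rearrangement
    carries the sign and the other factors along.\<close>
  moreover have "u * (v * w) = a * (b * c) \<Longrightarrow> s * u * (- v * (w * x)) = a * (s * - b * c * x)"
    for s u v w a b c x :: 'k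
    by (drule arg_cong[where f = "\<lambda>y. - (s * x * y)"]) (simp add: mult_ac)
  moreover have "- j - int \<nu> * int i + - int \<nu> = - j - int \<nu> * int (Suc i)"
    by (simp add: algebra_simps)
  moreover have "antipode_scalar (Suc i) = antipode_scalar i * - (q powi (- (int \<nu> * int (Suc i))))"
    by (simp add: antipode_scalar_def)
  ultimately show "struct_mult idx str (antipode_basis j i) (antipode_gen Gen_x) m =
      q powi j * antipode_basis j (Suc i) m"
    unfolding antipode_basis_def antipode_gen_def gen.case struct_mult_scale mult_mcoord
    by (simp only: add_Suc_right add_0_right One_nat_def)
qed

lemma antipode_coord_scale: "antipode_coord (\<lambda>m. k * c m) = (\<lambda>m. k * antipode_coord c m)"
  by (auto simp: antipode_coord_def)

lemma antipode_coord_lin_comb: "lin_comb (\<lambda>w. antipode_coord (\<beta> w)) f = antipode_coord (lin_comb \<beta> f)"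
  by (auto simp: antipode_coord_def lin_comb_def fun_eq_iff sum_distrib_left mult_ac)

lemma antipode_coord_coords: "antipode_coord c \<in> coords idx"
  by (auto simp: antipode_coord_def coords_def)

lemma antipode_H:
  assumes "c \<in> coords idx"
  shows "antipode (H_hopf q N \<nu>) (hfib c) = hfib (antipode_coord c)"
proof -
  let ?H = "H_hopf q N \<nu>" and ?A = "H_algebra q N \<nu>"
  interpret O: coord_algebra "opposite_algebra ?A" idx "\<lambda>u v. str v u" "mcoord 0 0" hfib
    by (rule HA.coord_algebra_opposite)
  let ?\<psi> = "case_gen (inv\<^bsub>?H\<^esub> H_a q N \<nu>)
    ((- inverse (q ^ \<nu>)) \<odot>\<^bsub>?H\<^esub> ((inv\<^bsub>?H\<^esub> H_a q N \<nu>) [^]\<^bsub>?H\<^esub> \<nu> \<otimes>\<^bsub>?H\<^esub> H_x q N \<nu>))"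
  have def: "antipode ?H = quot_map (free_ext (opposite_algebra ?A) ?\<psi>)"
    by (subst H_hopf_def) (simp add: Let_def pow_H_algebra inv_H_algebra H_hopf_simps)
  have gen: "antipode_gen g \<in> coords idx" for g
    by (cases g) (auto simp: antipode_gen_def coords_uminus coords_scale)
  have \<psi>: "?\<psi> g = hfib (antipode_gen g)" for g
    by (cases g) (simp_all add: H_a_eq H_x_eq hfib_mcoord_inv hfib_mcoord_pow hfib_mcoord_mult
        H.fib_smult antipode_gen_def power_int_minus)
  have op: "struct_mult idx (\<lambda>u v. str v u) c d = struct_mult idx str d c" for c d
    unfolding struct_mult_def by (subst sum.swap) (simp add: mult_ac)
  have "O.word_prod antipode_gen w = (\<lambda>m. q ^ word_inversions w *
    antipode_basis (int (count_list w Gen_a)) (count_list w Gen_x) m)" for w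
  proof (induction w)
    case Nil
    show ?case by (simp add: antipode_basis_def antipode_scalar_def fun_eq_iff)
  next
    case (Cons g w)
    then show ?case
      by (cases g) (simp_all add: op struct_mult_scale antipode_basis_a antipode_basis_x power_add add.commute mult_ac)
  qed
  then have wp: "O.word_prod antipode_gen = (\<lambda>w. antipode_coord (word_coord w))"
    by (simp add: word_coord_def antipode_coord_scale antipode_coord_mcoord fun_eq_iff)
  have "free_ext (opposite_algebra ?A) ?\<psi> f = hfib (antipode_coord c)" if "f \<in> hfib c" for f
    using O.free_ext_fib[OF gen \<psi>, where f = f] that
    by (simp add: wp antipode_coord_lin_comb hfib_def)
  then show ?thesis
    unfolding def by (intro quot_map_eqI hfib_nonempty assms)
qed

end

section \<open>Hopf subalgebras\<close>

lemma k_subalgebraD: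
  assumes "k_subalgebra V A"
  shows "k_subspace V A" "\<one>\<^bsub>A\<^esub> \<in> V" "\<And>u v. u \<in> V \<Longrightarrow> v \<in> V \<Longrightarrow> u \<otimes>\<^bsub>A\<^esub> v \<in> V"
  using assms by (auto simp: k_subalgebra_def subring_def submonoid_def)

context H_data
begin

abbreviation mon :: "int \<Rightarrow> nat \<Rightarrow> 'k H_elem" where
  "mon j i \<equiv> hfib (mcoord j i)"

text \<open>The factor \<open>q^(i j')\<close> from reordering is invertible and is divided
  out.\<close>

lemma mon_mult:
  assumes "k_subalgebra V (H_hopf q N \<nu>)" "mon j i \<in> V" "mon j' i' \<in> V"
  shows "mon (j + j') (i + i') \<in> V"
proof -
  have "hfib (\<lambda>m. q powi (int i * j') * mcoord (j + j') (i + i') m) \<in> V"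
    using k_subalgebraD(3)[OF assms] by (simp add: hfib_mcoord_mult)
  then have "hfib (\<lambda>m. inverse (q powi (int i * j')) * (q powi (int i * j') * mcoord (j + j') (i + i') m)) \<in> V"
    by (rule H.k_subspaceD(4)[OF k_subalgebraD(1)[OF assms(1)], rotated]) (simp add: coords_scale)
  then show ?thesis by (simp add: mult.assoc[symmetric])
qed

lemma mon_pow:
  assumes "k_subalgebra V (H_hopf q N \<nu>)" "mon j i \<in> V"
  shows "mon (int m * j) (m * i) \<in> V"
proof (induction m)
  case 0
  then show ?case using k_subalgebraD(2)[OF assms(1)] by (simp add: H.fib_one)
next
  case (Suc m)
  then show ?case using mon_mult[OF assms(1) assms(2) Suc] by (simp add: algebra_simps)
qed

lemma hfib_eq_sum_mon:
  assumes "c \<in> coords idx"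
  shows "hfib c = hfib (\<lambda>w. \<Sum>(j, i)\<in>idx. c (j, i) * mcoord j i w)"
proof -
  have "c = (\<lambda>w. \<Sum>m\<in>idx. c m * unit_coord m w)"
    by (rule coords_sum_unit) (use assms in auto)
  also have "\<dots> = (\<lambda>w. \<Sum>(j, i)\<in>idx. c (j, i) * mcoord j i w)"
    by (intro ext sum.cong refl) (auto simp: unit_coord_eq_mcoord)
  finally show ?thesis by simp
qed

lemma hfib_in_subspace:
  assumes "k_subspace V (H_hopf q N \<nu>)" "c \<in> coords idx" "\<And>j i. c (j, i) \<noteq> 0 \<Longrightarrow> mon j i \<in> V"
  shows "hfib c \<in> V"
proof -
  have "hfib (\<lambda>w. c m * (case m of (j, i) \<Rightarrow> mcoord j i) w) \<in> V" for m
  proof (cases m)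
    case (Pair j i)
    show ?thesis
    proof (cases "c m = 0")
      case True
      then show ?thesis using H.k_subspaceD(2)[OF assms(1)] by simp
    next
      case False
      then show ?thesis using assms(3)[of j i]
        by (intro H.k_subspaceD(4)[OF assms(1)]) (auto simp: Pair)
    qed
  qed
  then have "hfib (\<lambda>w. \<Sum>m\<in>idx. c m * (case m of (j, i) \<Rightarrow> mcoord j i) w) \<in> V"
    by (intro H.k_subspace_sum[OF assms(1)] coords_scale) (auto split: prod.splits)
  also have "hfib (\<lambda>w. \<Sum>m\<in>idx. c m * (case m of (j, i) \<Rightarrow> mcoord j i) w) = hfib c"
    unfolding hfib_eq_sum_mon[OF assms(2)] by (intro arg_cong[of _ _ hfib] ext sum.cong) auto
  finally show ?thesis .
qed

text \<open>As \<open>q ^ N = 1\<close>, congruent exponents give equal powers of \<open>q\<close>,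
  so \<open>(q ^ \<nu>) ^ i = (q ^ \<nu>) ^ i'\<close>, and powers below the order are
  distinct.\<close>

lemma \<nu>_mult_inj:
  assumes "i < r" "i' < r" "(j + int \<nu> * int i) mod int N = (j + int \<nu> * int i') mod int N"
  shows "i = i'"
  using assms
proof (induction i i' rule: linorder_wlog)
  case (le i i')
  have "q powi (j + int \<nu> * int i) = q powi (j + int \<nu> * int i')"
    using powi_mod[of "j + int \<nu> * int i"] powi_mod[of "j + int \<nu> * int i'"] le by simp
  then have "(q ^ \<nu>) ^ i = (q ^ \<nu>) ^ i'"
    by (simp add: power_int_add power_int_mult)
  also have "\<dots> = (q ^ \<nu>) ^ i * (q ^ \<nu>) ^ (i' - i)"
    using le by (simp flip: power_add)
  finally have "(q ^ \<nu>) ^ (i' - i) = 1" by simp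
  then have "r dvd i' - i" by (simp only: p_pow_eq_1)
  then have "i' - i = 0" using le by (metis dvd_imp_le less_imp_diff_less not_gr0 not_less)
  then show ?case using le by simp
qed (metis)

lemma comult_mon: "comult (H_hopf q N \<nu>) (mon j i) = HT.tfib (comult_basis j i)"
  by (simp add: comult_H comult_coord_mcoord)

lemma antipode_mon_0: "antipode (H_hopf q N \<nu>) (mon j 0) = mon (- j) 0"
  by (simp add: antipode_H antipode_coord_mcoord antipode_basis_def antipode_scalar_def)

section \<open>Units and grouplike elements\<close>

lemma mon_unit: "mon j 0 \<in> carrier (units_of (H_hopf q N \<nu>))"
proof -
  have "mon (- j) 0 \<otimes>\<^bsub>H_hopf q N \<nu>\<^esub> mon j 0 = \<one>\<^bsub>H_hopf q N \<nu>\<^esub>"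
    "mon j 0 \<otimes>\<^bsub>H_hopf q N \<nu>\<^esub> mon (- j) 0 = \<one>\<^bsub>H_hopf q N \<nu>\<^esub>"
    by (simp_all add: hfib_mcoord_mult H.fib_one)
  then show ?thesis by (auto simp: units_of_def Units_def)
qed

lemma mon_in_cyclic:
  "mon j 0 \<in> carrier (subgroup_generated (units_of (H_hopf q N \<nu>)) {H_a q N \<nu>})"
proof -
  let ?U = "units_of (H_hopf q N \<nu>)"
  interpret Group.monoid "H_hopf q N \<nu>" by (rule monoid_H)
  interpret U: group ?U by (rule units_group)
  have a: "H_a q N \<nu> \<in> carrier ?U" using mon_unit by (simp add: H_a_eq)
  \<comment> \<open>The representative of \<open>j\<close> modulo \<open>N\<close> avoids negative
    powers.\<close>
  have "H_a q N \<nu> [^]\<^bsub>?U\<^esub> int (nat (j mod int N)) = H_a q N \<nu> [^]\<^bsub>H_hopf q N \<nu>\<^esub> nat (j mod int N)"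
    unfolding int_pow_int by (simp add: nat_pow_def units_of_def)
  also have "\<dots> = mon j 0"
    using N_pos by (simp add: H_a_pow)
  finally show ?thesis
    unfolding U.carrier_subgroup_generated_by_singleton[OF a] by (metis rangeI)
qed

text \<open>Comparing \<open>\<Delta>(c)\<close> with \<open>c \<otimes> c\<close> on the powers of
  \<open>a\<close> makes the coefficients orthogonal idempotents of a field: at most one is nonzero,
  and it is 1. The counit condition excludes that all vanish.\<close>

lemma grouplike_mon:
  assumes "c \<in> coords idx" "comult_coord c = tensor_coord c c" "counit_coord c = 1"
    and supp: "\<And>j i. c (j, i) \<noteq> 0 \<Longrightarrow> i = 0"
  shows "\<exists>j. c = mcoord j 0"
proof -
  have diag: "c (j, 0) * c (j', 0) = (if j' = j then c (j, 0) else 0)" if "(j, 0) \<in> idx" "(j', 0) \<in> idx" for j j'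
  proof -
    have "c (j, 0) * c (j', 0) = comult_coord c ((j, 0), (j', 0))"
      by (simp add: assms(2) tensor_coord_def)
    also have "\<dots> = (if j' = j then c (j, 0) else 0)"
      using that by (auto simp: comult_coord_def idx_def)
    finally show ?thesis .
  qed
  obtain j where j: "j \<in> {0..<int N}" "c (j, 0) \<noteq> 0"
    using assms(3) unfolding counit_coord_def by (metis sum.neutral zero_neq_one)
  have jdx: "(j', 0) \<in> idx" if "j' \<in> {0..<int N}" for j'
    using that r_gt_1 by (auto simp: idx_def)
  have "c (j, 0) = 1" using diag[of j j] jdx j by auto
  moreover have "c (j', 0) = 0" if "j' \<noteq> j" for j'
  proof (cases "(j', 0) \<in> idx")
    case True
    then show ?thesis using diag[of j j'] jdx[of j] j that by auto
  next
    case False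
    then show ?thesis using assms(1) by (auto simp: coords_def)
  qed
  ultimately have "c = mcoord j 0"
    using j supp r_gt_1 by (auto simp: mcoord_def unit_coord_def fun_eq_iff)
  then show ?thesis ..
qed

lemma mon_grouplike:
  assumes "mon j 0 \<in> B"
  shows "mon j 0 \<in> grouplikes (H_hopf q N \<nu>) B"
  using assms by (simp add: grouplikes_def comult_mon HT.pure_tensor_fib comult_basis_def
      counit_H counit_coord_mcoord)

definition div_coords :: "nat \<Rightarrow> (int \<times> nat \<Rightarrow> 'k) set" where
  "div_coords d = {c \<in> coords idx. \<forall>j i. c (j, i) \<noteq> 0 \<longrightarrow> int d dvd j}"

text \<open>Serves twice: with \<open>V = B\<close>, and with an arbitrary \<open>V\<close>, where
  it shows that \<open>B\<close> is the least subalgebra containing the generators.\<close>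

lemma div_coords_in_subalgebra:
  assumes V: "k_subalgebra V (H_hopf q N \<nu>)" "mon (int d) 0 \<in> V" "mon 0 1 \<in> V"
    and c: "c \<in> div_coords d"
  shows "hfib c \<in> V"
proof (rule hfib_in_subspace[OF k_subalgebraD(1)[OF V(1)]])
  show "c \<in> coords idx" using c by (simp add: div_coords_def)
  fix j i assume nz: "c (j, i) \<noteq> 0"
  then have "(j, i) \<in> idx" "int d dvd j" using c by (auto simp: div_coords_def coords_def)
  then obtain k where k: "j = int d * k" "0 \<le> j" by (auto simp: idx_def)
  \<comment> \<open>A negative \<open>k\<close> with \<open>0 \<le> d * k\<close> forces
    \<open>d = 0\<close> and hence \<open>j = 0\<close>, for \<open>d\<close> may be 0 here.\<close>
  then have kd: "j = int (nat k) * int d \<or> j = 0"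
    by (cases "0 \<le> k") (auto simp: mult_less_0_iff not_le zero_le_mult_iff)
  have "mon j 0 \<in> V"
    using kd mon_pow[OF V(1,2), of "nat k"] mon_pow[OF V(1,2), of 0] by auto
  moreover have "mon 0 i \<in> V" using mon_pow[OF V(1,3), of i] by simp
  ultimately show "mon j i \<in> V" using mon_mult[OF V(1)] by fastforce
qed

end

locale H_hopf_subalgebra = H_data +
  fixes B :: "'a H_elem set"
  assumes hopf_subalgebra: "hopf_subalgebra B (H_hopf q N \<nu>)"
begin

lemma subalgebra: "k_subalgebra B (H_hopf q N \<nu>)"
  and comult_closed: "b \<in> B \<Longrightarrow> comult (H_hopf q N \<nu>) b \<in>
    k_span (tensor_algebra (H_hopf q N \<nu>) (H_hopf q N \<nu>))
      {pure_tensor (H_hopf q N \<nu>) (H_hopf q N \<nu>) u v | u v. u \<in> B \<and> v \<in> B}"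
  and antipode_closed: "b \<in> B \<Longrightarrow> antipode (H_hopf q N \<nu>) b \<in> B"
  using hopf_subalgebra by (auto simp: hopf_subalgebra_def)

lemmas subspace = k_subalgebraD(1)[OF subalgebra]

text \<open>Contracting one tensor factor with a coordinate functional maps \<open>B \<otimes> B\<close> into \<open>B\<close>.\<close>

lemma slices:
  assumes c: "c \<in> coords idx" "hfib c \<in> B"
  shows "hfib (\<lambda>m. comult_coord c (m, m')) \<in> B" "hfib (\<lambda>m. comult_coord c (m', m)) \<in> B"
proof -
  \<comment> \<open>The tensors all of whose slices lie in \<open>B\<close> form a subspace
    containing \<open>u \<otimes> v\<close> for \<open>u\<close>, \<open>v\<close> in
    \<open>B\<close>, hence the whole span in which \<open>\<Delta>(b)\<close> lies.\<close>
  define W where "W = {t \<in> coords (idx \<times> idx).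
    \<forall>m'. hfib (\<lambda>m. t (m, m')) \<in> B \<and> hfib (\<lambda>m. t (m', m)) \<in> B}"
  have slice_coords: "(\<lambda>m. t (m, m')) \<in> coords idx" "(\<lambda>m. t (m', m)) \<in> coords idx"
    if "t \<in> coords (idx \<times> idx)" for t :: "(int \<times> nat) \<times> (int \<times> nat) \<Rightarrow> 'a" and m'
    using that by (cases m'; auto simp: coords_def)+
  have "k_subspace (HT.tfib ` W) (tensor_algebra (H_hopf q N \<nu>) (H_hopf q N \<nu>))"
  proof (rule HT.T.k_subspace_fibI)
    show "(\<lambda>_. 0) \<in> W" using H.k_subspaceD(2)[OF subspace] by (simp add: W_def)
    show "(\<lambda>i. c i + d i) \<in> W" if "c \<in> W" "d \<in> W" for c d
      using that by (auto simp: W_def coords_add intro!: H.k_subspaceD(3)[OF subspace] slice_coords)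
    show "(\<lambda>i. k * c i) \<in> W" if "c \<in> W" for c k
      using that by (auto simp: W_def coords_scale intro!: H.k_subspaceD(4)[OF subspace] slice_coords)
  qed (auto simp: W_def)
  moreover have "pure_tensor (H_hopf q N \<nu>) (H_hopf q N \<nu>) u v \<in> HT.tfib ` W" if uv: "u \<in> B" "v \<in> B" for u v
  proof -
    have "u \<in> hfib ` coords idx" "v \<in> hfib ` coords idx"
      using uv H.k_subspaceD(1)[OF subspace] by (auto simp: H.carrier_eq)
    then obtain a b where ab: "a \<in> coords idx" "b \<in> coords idx" "u = hfib a" "v = hfib b"
      by blast
    have sc: "hfib (\<lambda>m. k * b m) \<in> B" "hfib (\<lambda>m. a m * k) \<in> B" for k
      using ab uv H.k_subspaceD(4)[OF subspace, of _ k] by (simp_all add: mult.commute[of _ k])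
    have "tensor_coord a b \<in> W"
      unfolding W_def using ab sc
      by (intro CollectI conjI allI tensor_coord_coords) (simp_all add: tensor_coord_def)
    then show ?thesis using ab by (auto simp: HT.pure_tensor_fib)
  qed
  ultimately have "comult (H_hopf q N \<nu>) (hfib c) \<in> HT.tfib ` W"
    using comult_closed[OF c(2)] unfolding k_span_def by blast
  then have "comult_coord c \<in> W"
    using c HT.T.fib_eq_iff[OF comult_coord_coords] by (auto simp: comult_H W_def)
  then show "hfib (\<lambda>m. comult_coord c (m, m')) \<in> B" "hfib (\<lambda>m. comult_coord c (m', m)) \<in> B"
    unfolding W_def by blast+
qed

text \<open>The left contraction isolates the power of \<open>a\<close>; the right one then isolates the power of \<open>x\<close>,
  as \<open>\<nu> i\<close> is determined modulo \<open>N\<close> by \<open>i < r\<close> and conversely.\<close>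

lemma mon_of_support:
  assumes c: "c \<in> coords idx" "hfib c \<in> B" and nz: "c (j, i) \<noteq> 0"
  shows "mon j i \<in> B"
proof -
  have ji: "(j, i) \<in> idx" using c nz by (auto simp: coords_def)
  then have r: "0 \<le> j" "j < int N" "i < r" by (auto simp: idx_def)
  \<comment> \<open>Slicing at \<open>a^j\<close> on the left keeps the term \<open>t = 0\<close> of
    each \<open>\<Delta>(a^j x^i')\<close>, with coefficient 1 and right factor
    \<open>a^j x^i'\<close>.\<close>
  define d where "d = (\<lambda>m. comult_coord c ((j, 0), m))"
  have d: "d (j', i') = (if j' = j then c (j, i') else 0)" for j' i'
  proof (cases "i' < r")
    case True
    then show ?thesis using r by (auto simp: d_def comult_coord_def idx_def)
  next
    case False
    then have "(j, i') \<notin> idx" by (simp add: idx_def)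
    then show ?thesis using c False by (auto simp: d_def comult_coord_def coords_def)
  qed
  have dB: "hfib d \<in> B" unfolding d_def by (rule slices[OF c])
  have dc: "d \<in> coords idx"
    using c by (auto simp: coords_def d)
  \<comment> \<open>The term \<open>t = i\<close> of \<open>\<Delta>(a^j x^i)\<close> has
    coefficient 1 and right factor \<open>a^(j + \<nu> i)\<close>, so slicing at
    \<open>(?l, 0)\<close> returns its left factor \<open>a^j x^i\<close>.\<close>
  let ?l = "(j + int \<nu> * int i) mod int N"
  have "comult_coord d (m, (?l, 0)) = c (j, i) * mcoord j i m" for m
  proof (cases m)
    case (Pair j' i')
    show ?thesis
    proof (cases "j' = j \<and> i' = i")
      case True
      then show ?thesis using r N_pos
        by (simp add: Pair comult_coord_def d mcoord_def unit_coord_def idx_def)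
    next
      case False
      have "comult_coord d ((j', i'), (?l, 0)) = 0"
      proof (rule ccontr)
        assume nz: "comult_coord d ((j', i'), (?l, 0)) \<noteq> 0"
        then have *: "i' < r \<and> ?l = (j' + int \<nu> * int i') mod int N \<and> d (j', i') \<noteq> 0"
          unfolding comult_coord_def prod.case
          by (smt (verit) SigmaE2 add.right_neutral idx_def lessThan_iff mult_zero_right)
        then have "j' = j" by (simp add: d split: if_splits)
        with * False \<nu>_mult_inj[of i i' j] r show False by auto
      qed
      moreover have "mcoord j i (j', i') = 0" using False r by (auto simp: mcoord_def unit_coord_def)
      ultimately show ?thesis by (simp add: Pair)
    qed
  qed
  with slices(1)[OF dc dB, of "(?l, 0)"] have "hfib (\<lambda>m. c (j, i) * mcoord j i m) \<in> B" by simp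
  then have "hfib (\<lambda>m. inverse (c (j, i)) * (c (j, i) * mcoord j i m)) \<in> B"
    by (rule H.k_subspaceD(4)[OF subspace, rotated]) (simp add: coords_scale)
  then show ?thesis using nz by (simp add: mult.assoc[symmetric])
qed

text \<open>The binomial factor is kept. In the uses below it is harmless: it is 1 for
  \<open>t = 0\<close> and \<open>t = i\<close>, and for \<open>t = 1\<close> it is nonzero by
  \<open>qbinom_1_nonzero\<close>.\<close>

lemma mon_slices:
  assumes "mon j i \<in> B" "t \<le> i" "i < r"
  shows "hfib (\<lambda>m. qbinom (q ^ \<nu>) i t * mcoord j t m) \<in> B"
    and "hfib (\<lambda>m. qbinom (q ^ \<nu>) i t * mcoord (j + int \<nu> * int t) (i - t) m) \<in> B"
proof -
  have "comult_basis j i (m, ((j + int \<nu> * int t) mod int N, i - t)) = qbinom (q ^ \<nu>) i t * mcoord j t m" for m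
  proof -
    have "comult_basis j i (m, ((j + int \<nu> * int t) mod int N, i - t)) =
      (\<Sum>t'\<le>i. if t' = t then qbinom (q ^ \<nu>) i t * mcoord j t m else 0)"
      unfolding comult_basis_def tensor_coord_def prod.case
    proof (intro sum.cong refl)
      fix t' assume "t' \<in> {..i}"
      then have "i - t' = i - t \<longleftrightarrow> t' = t" using assms(2) by auto
      then have "mcoord (j + int \<nu> * int t') (i - t') ((j + int \<nu> * int t) mod int N, i - t) = (if t' = t then 1 else 0)"
        using assms(3) by (cases "t' = t") (simp_all add: mcoord_def unit_coord_def)
      then show "qbinom (q ^ \<nu>) i t' * (mcoord j t' m * mcoord (j + int \<nu> * int t') (i - t') ((j + int \<nu> * int t) mod int N, i - t)) =
        (if t' = t then qbinom (q ^ \<nu>) i t * mcoord j t m else 0)" by simp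
    qed
    then show ?thesis using assms by simp
  qed
  then show "hfib (\<lambda>m. qbinom (q ^ \<nu>) i t * mcoord j t m) \<in> B"
    using slices(1)[OF _ assms(1), of "((j + int \<nu> * int t) mod int N, i - t)"]
    by (simp add: comult_coord_mcoord)
  have "comult_basis j i ((j mod int N, t), m) = qbinom (q ^ \<nu>) i t * mcoord (j + int \<nu> * int t) (i - t) m" for m
  proof -
    have "comult_basis j i ((j mod int N, t), m) =
      (\<Sum>t'\<le>i. if t' = t then qbinom (q ^ \<nu>) i t * mcoord (j + int \<nu> * int t) (i - t) m else 0)"
      unfolding comult_basis_def tensor_coord_def prod.case
    proof (intro sum.cong refl)
      fix t' assume "t' \<in> {..i}"
      then have "t' < r" using assms(3) by simp
      then have "mcoord j t' (j mod int N, t) = (if t' = t then 1 else 0)"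
        by (cases "t' = t") (simp_all add: mcoord_def unit_coord_def)
      then show "qbinom (q ^ \<nu>) i t' * (mcoord j t' (j mod int N, t) * mcoord (j + int \<nu> * int t') (i - t') m) =
        (if t' = t then qbinom (q ^ \<nu>) i t * mcoord (j + int \<nu> * int t) (i - t) m else 0)" by simp
    qed
    then show ?thesis using assms by simp
  qed
  then show "hfib (\<lambda>m. qbinom (q ^ \<nu>) i t * mcoord (j + int \<nu> * int t) (i - t) m) \<in> B"
    using slices(2)[OF _ assms(1), of "(j mod int N, t)"]
    by (simp add: comult_coord_mcoord)
qed

lemma mon_0:
  assumes "mon j i \<in> B" "i < r"
  shows "mon j 0 \<in> B"
  using mon_slices(1)[OF assms(1), of 0] assms(2) by simp

lemma mon_1:
  assumes "mon j i \<in> B" "0 < i" "i < r"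
  shows "mon j 1 \<in> B"
proof -
  let ?k = "qbinom (q ^ \<nu>) i 1"
  have k: "?k \<noteq> 0" using qbinom_1_nonzero assms by blast
  have "hfib (\<lambda>m. ?k * mcoord j 1 m) \<in> B"
    using mon_slices(1)[OF assms(1), of 1] assms by simp
  then have "hfib (\<lambda>m. inverse ?k * (?k * mcoord j 1 m)) \<in> B"
    by (rule H.k_subspaceD(4)[OF subspace, rotated]) (simp add: coords_scale)
  then show ?thesis by (simp only: mult.assoc[symmetric] left_inverse[OF k] mult_1_left)
qed

lemma mon_minus: "mon j 0 \<in> B \<Longrightarrow> mon (- j) 0 \<in> B"
  using antipode_closed[of "mon j 0"] by (simp add: antipode_mon_0)

section \<open>The two kinds of Hopf subalgebras\<close>

lemma group_algebra_case:
  assumes no_x: "\<And>j i. mon j i \<in> B \<Longrightarrow> i < r \<Longrightarrow> i = 0"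
  shows "B = k_span (H_hopf q N \<nu>) (grouplikes (H_hopf q N \<nu>) B)"
    and "subgroup (grouplikes (H_hopf q N \<nu>) B)
        (subgroup_generated (units_of (H_hopf q N \<nu>)) {H_a q N \<nu>})"
proof -
  let ?H = "H_hopf q N \<nu>" and ?G = "grouplikes (H_hopf q N \<nu>) B"
  let ?U = "units_of ?H"
  interpret M: Group.monoid ?H by (rule monoid_H)
  interpret U: group ?U by (rule M.units_group)
  have supp: "i = 0" if "c \<in> coords idx" "hfib c \<in> B" "c (j, i) \<noteq> 0" for c j i
  proof -
    have "i < r" using that by (auto simp: coords_def idx_def)
    then show ?thesis using mon_of_support[OF that] no_x by blast
  qed
  show "B = k_span ?H ?G"
  proof
    show "k_span ?H ?G \<subseteq> B"
      unfolding k_span_def using subspace by (intro Inter_lower) (auto simp: grouplikes_def)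
    show "B \<subseteq> k_span ?H ?G"
      unfolding k_span_def
    proof (intro subsetI InterI, clarify)
      fix b V assume b: "b \<in> B" and V: "k_subspace V ?H" "?G \<subseteq> V"
      have "b \<in> hfib ` coords idx" using b H.k_subspaceD(1)[OF subspace] by (auto simp: H.carrier_eq)
      then obtain c where c: "c \<in> coords idx" "b = hfib c" by blast
      show "b \<in> V" unfolding c(2)
      proof (rule hfib_in_subspace[OF V(1) c(1)])
        fix j i assume nz: "c (j, i) \<noteq> 0"
        have "i = 0" "mon j i \<in> B" using supp[OF c(1) _ nz] mon_of_support[OF c(1) _ nz] b c(2) by auto
        then show "mon j i \<in> V" using mon_grouplike V(2) by blast
      qed
    qed
  qed
  have G: "\<exists>j. g = mon j 0 \<and> mon j 0 \<in> B" if g: "g \<in> ?G" for g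
  proof -
    have gB: "g \<in> B" "comult ?H g = pure_tensor ?H ?H g g" "counit ?H g = 1"
      using g by (auto simp: grouplikes_def)
    have "g \<in> hfib ` coords idx" using gB H.k_subspaceD(1)[OF subspace] by (auto simp: H.carrier_eq)
    then obtain c where c: "c \<in> coords idx" "g = hfib c" by blast
    have "comult_coord c = tensor_coord c c"
      using gB(2) c HT.T.fib_eq_iff[OF comult_coord_coords tensor_coord_coords]
      by (simp add: comult_H HT.pure_tensor_fib)
    moreover have "counit_coord c = 1" using gB(3) c by (simp add: counit_H)
    \<comment> \<open>\<open>supp\<close> excludes powers of \<open>x\<close> from elements of
      \<open>B\<close>, as \<open>grouplike_mon\<close> requires.\<close>
    ultimately obtain j where "c = mcoord j 0"
      using grouplike_mon[OF c(1)] supp[OF c(1)] gB(1) c(2) by blast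
    then show ?thesis using c gB(1) by blast
  qed
  have "subgroup ?G ?U"
  proof (rule U.subgroupI)
    show "?G \<subseteq> carrier ?U" using G mon_unit by blast
    have "mon 0 0 \<in> B" using k_subalgebraD(2)[OF subalgebra] by (simp add: H.fib_one)
    then show "?G \<noteq> {}" using mon_grouplike by blast
    show "inv\<^bsub>?U\<^esub> g \<in> ?G" if g: "g \<in> ?G" for g
    proof -
      obtain j where j: "g = mon j 0" "mon j 0 \<in> B" using G[OF g] by blast
      have "inv\<^bsub>?U\<^esub> g = mon (- j) 0"
        by (rule U.inv_equality) (use mon_unit in \<open>auto simp: j units_of_mult units_of_one hfib_mcoord_mult H.fib_one\<close>)
      then show ?thesis using mon_minus[OF j(2)] mon_grouplike by simp
    qed
    show "g \<otimes>\<^bsub>?U\<^esub> h \<in> ?G" if gh: "g \<in> ?G" "h \<in> ?G" for g h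
    proof -
      obtain j l where j: "g = mon j 0" "mon j 0 \<in> B" "h = mon l 0" "mon l 0 \<in> B"
        using G gh by blast
      have "g \<otimes>\<^bsub>?U\<^esub> h = mon (j + l) 0" by (simp add: j units_of_mult hfib_mcoord_mult)
      then show ?thesis using mon_mult[OF subalgebra j(2) j(4)] mon_grouplike by simp
    qed
  qed
  moreover have "?G \<subseteq> carrier (subgroup_generated ?U {H_a q N \<nu>})"
    using G mon_in_cyclic by blast
  ultimately show "subgroup ?G (subgroup_generated ?U {H_a q N \<nu>})"
    by (simp add: U.subgroup_subgroup_generated_iff)
qed

lemma x_case:
  assumes "mon j i \<in> B" "0 < i" "i < r"
  obtains d where "0 < d" "d dvd N" "d dvd \<nu>" "mon (int d) 0 \<in> B" "mon 0 1 \<in> B"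
    "B = hfib ` div_coords d"
proof -
  have r: "0 < r" using r_gt_1 by simp
  have add: "mon (j + l) 0 \<in> B" if "mon j 0 \<in> B" "mon l 0 \<in> B" for j l
    using mon_mult[OF subalgebra that] by simp
  \<comment> \<open>\<open>x\<close> is obtained as \<open>a^(- j)\<close> times
    \<open>a^j x\<close>; the inverse comes from the antipode.\<close>
  have "mon (- j) 0 \<in> B" using mon_0 mon_minus assms by blast
  from mon_mult[OF subalgebra this mon_1[OF assms]] have x: "mon 0 1 \<in> B" by simp
  \<comment> \<open>\<open>a^\<nu>\<close> is the right factor of the summand
    \<open>x \<otimes> a^\<nu>\<close> of \<open>\<Delta>(x)\<close>.\<close>
  have \<nu>: "mon (int \<nu>) 0 \<in> B"
    using mon_slices(2)[OF x, of 1] r_gt_1 by simp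
  \<comment> \<open>This is the unit, since \<open>a^N = 1\<close>. It yields a positive exponent to
    minimise over, and later \<open>d dvd N\<close>.\<close>
  have N: "mon (int N) 0 \<in> B"
    using k_subalgebraD(2)[OF subalgebra] mcoord_mod[of "int N" 0] by (simp add: H.fib_one)
  \<comment> \<open>The positive generator of the group of exponents; division with remainder shows
    that it divides every other member.\<close>
  define d where "d = (LEAST d. 0 < d \<and> mon (int d) 0 \<in> B)"
  have d: "0 < d \<and> mon (int d) 0 \<in> B"
    unfolding d_def by (rule LeastI[of _ N]) (use N N_pos in simp)
  have least: "d \<le> m" if "0 < m" "mon (int m) 0 \<in> B" for m
    unfolding d_def by (rule Least_le) (use that in simp)
  have mult: "mon (k * int d) 0 \<in> B" for k
  proof (cases "0 \<le> k")
    case True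
    then show ?thesis using mon_pow[OF subalgebra conjunct2[OF d], of "nat k"] by simp
  next
    case False
    then have "mon (- k * int d) 0 \<in> B" using mon_pow[OF subalgebra conjunct2[OF d], of "nat (- k)"] by simp
    then show ?thesis using mon_minus by fastforce
  qed
  have dvd: "int d dvd l" if "mon l 0 \<in> B" for l
  proof -
    have "l mod int d = l + (- (l div int d)) * int d" by (simp add: minus_div_mult_eq_mod[symmetric])
    then have in_B: "mon (l mod int d) 0 \<in> B" using add[OF that mult[of "- (l div int d)"]] by simp
    have "l mod int d = 0"
    proof (rule ccontr)
      assume nz: "l mod int d \<noteq> 0"
      have "0 \<le> l mod int d" "l mod int d < int d" using d by simp_all
      then show False using least[of "nat (l mod int d)"] in_B nz by auto
    qed
    then show ?thesis by (rule mod_0_imp_dvd)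
  qed
  have "B = hfib ` div_coords d"
  proof
    show "hfib ` div_coords d \<subseteq> B"
      using div_coords_in_subalgebra[OF subalgebra conjunct2[OF d] x] by blast
    show "B \<subseteq> hfib ` div_coords d"
    proof
      fix b assume b: "b \<in> B"
      have "b \<in> hfib ` coords idx" using b H.k_subspaceD(1)[OF subspace] by (auto simp: H.carrier_eq)
      then obtain c where c: "c \<in> coords idx" "b = hfib c" by blast
      have "int d dvd j" if nz: "c (j, i) \<noteq> 0" for j i
      proof -
        have "i < r" using c(1) nz by (auto simp: coords_def idx_def)
        moreover have "mon j i \<in> B" using mon_of_support[OF c(1) _ nz] b c(2) by simp
        ultimately show ?thesis using mon_0 dvd by blast
      qed
      then show "b \<in> hfib ` div_coords d" using c by (auto simp: div_coords_def)
    qed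
  qed
  with that[of d] d dvd[OF N] dvd[OF \<nu>] x show thesis by simp
qed

lemma subalgebra_generated_eq:
  assumes "mon (int d) 0 \<in> B" "mon 0 1 \<in> B" "B = hfib ` div_coords d"
  shows "B = k_subalgebra_generated (H_hopf q N \<nu>) {H_a q N \<nu> [^]\<^bsub>H_hopf q N \<nu>\<^esub> d, H_x q N \<nu>}"
proof
  show "k_subalgebra_generated (H_hopf q N \<nu>) {H_a q N \<nu> [^]\<^bsub>H_hopf q N \<nu>\<^esub> d, H_x q N \<nu>} \<subseteq> B"
    unfolding k_subalgebra_generated_def
    by (rule Inter_lower) (use assms(1,2) subalgebra in \<open>simp add: H_a_pow H_x_eq\<close>)
  show "B \<subseteq> k_subalgebra_generated (H_hopf q N \<nu>) {H_a q N \<nu> [^]\<^bsub>H_hopf q N \<nu>\<^esub> d, H_x q N \<nu>}"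
    unfolding k_subalgebra_generated_def H_a_pow H_x_eq
  proof (rule Inter_greatest)
    fix V assume V: "V \<in> {V. k_subalgebra V (H_hopf q N \<nu>) \<and> {mon (int d) 0, mon 0 1} \<subseteq> V}"
    show "B \<subseteq> V"
    proof
      fix b assume "b \<in> B"
      then obtain c where "c \<in> div_coords d" "b = hfib c" using assms(3) by blast
      then show "b \<in> V" using V div_coords_in_subalgebra[of V d c] by simp
    qed
  qed
qed

end

section \<open>Subalgebras generated by a power of \<open>a\<close> and \<open>x\<close>\<close>

locale H_embedding = H_data +
  fixes s d :: nat
  assumes N_eq: "N = s * d" and d_dvd: "d dvd \<nu>"
begin

lemma sd_pos: "0 < s" "0 < d"
  using N_eq N_pos by auto

text \<open>Both Hopf algebras thus have the same \<open>r\<close> and the same binomial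
  coefficients.\<close>

lemma p_eq: "(q ^ d) ^ (\<nu> div d) = q ^ \<nu>"
  using d_dvd by (simp flip: power_mult)

sublocale K: H_data "q ^ d" s "\<nu> div d"
proof
  show "(q ^ d) ^ s = 1" using q_pow_N by (simp add: N_eq mult.commute flip: power_mult)
qed (use sd_pos r_gt_1 in \<open>simp_all add: p_eq\<close>)

section \<open>The embedding \<open>a \<mapsto> a^d\<close>, \<open>x \<mapsto> x\<close> on
  coordinates\<close>

definition emb :: "(int \<times> nat \<Rightarrow> 'a) \<Rightarrow> int \<times> nat \<Rightarrow> 'a" where
  "emb c = (\<lambda>(j, i). if int d dvd j then c (j div int d, i) else 0)"

definition emb2 :: "((int \<times> nat) \<times> (int \<times> nat) \<Rightarrow> 'a) \<Rightarrow> (int \<times> nat) \<times> (int \<times> nat) \<Rightarrow> 'a" where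
  "emb2 t = (\<lambda>((j, i), (j', i')). if int d dvd j \<and> int d dvd j' then t ((j div int d, i), (j' div int d, i')) else 0)"

lemma emb_lin_comb: "emb (lin_comb \<beta> f) = lin_comb (\<lambda>w. emb (\<beta> w)) f"
  by (auto simp: emb_def lin_comb_def fun_eq_iff)

lemma emb_scale: "emb (\<lambda>m. k * c m) = (\<lambda>m. k * emb c m)"
  by (auto simp: emb_def)

lemma emb_tensor: "emb2 (tensor_coord c c') = tensor_coord (emb c) (emb c')"
  by (auto simp: emb_def emb2_def tensor_coord_def fun_eq_iff)

text \<open>As \<open>N = s * d\<close>, reducing \<open>d j\<close> modulo \<open>N\<close> is
  \<open>d\<close> times reducing \<open>j\<close> modulo \<open>s\<close>, so the two periodicities
  agree.\<close>

lemma emb_mcoord: "emb (K.mcoord j i) = mcoord (int d * j) i"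
proof (rule ext, clarify)
  fix j' i'
  have "int N = int d * int s" by (simp add: N_eq)
  then have mod: "(int d * j) mod int N = int d * (j mod int s)"
    by (simp only: mult_mod_right)
  show "emb (K.mcoord j i) (j', i') = mcoord (int d * j) i (j', i')"
  proof (cases "i < r")
    case True
    then have K: "K.mcoord j i (k, i') = (if k = j mod int s \<and> i' = i then 1 else 0)" for k
      unfolding K.mcoord_def p_eq unit_coord_def by simp
    have H: "mcoord (int d * j) i (j', i') = (if j' = int d * (j mod int s) \<and> i' = i then 1 else 0)"
      using True unfolding mcoord_def unit_coord_def mod by simp
    show ?thesis
    proof (cases "j' = int d * (j mod int s)")
      case True
      then have "int d dvd j'" "j' div int d = j mod int s" using sd_pos by simp_all
      then show ?thesis unfolding H emb_def prod.case K using True by simp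
    next
      case False
      then have "\<not> (int d dvd j' \<and> j' div int d = j mod int s)" by auto
      then show ?thesis unfolding H emb_def prod.case K using False by auto
    qed
  next
    case False
    then show ?thesis unfolding emb_def K.mcoord_def p_eq mcoord_def by simp
  qed
qed

lemma K_idx_iff: "(int d * j, i) \<in> idx \<longleftrightarrow> (j, i) \<in> K.idx"
proof -
  have "0 \<le> int d * j \<longleftrightarrow> 0 \<le> j" "int d * j < int N \<longleftrightarrow> j < int s"
    using sd_pos by (simp_all add: N_eq zero_le_mult_iff mult.commute[of "int s"])
  then show ?thesis by (simp add: idx_def K.idx_def p_eq)
qed

lemma emb_surj: "emb ` coords K.idx = div_coords d"
proof
  show "emb ` coords K.idx \<subseteq> div_coords d"
  proof clarify
    fix c :: "int \<times> nat \<Rightarrow> 'a" assume c: "c \<in> coords K.idx"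
    have "int d dvd j \<and> (j, i) \<in> idx" if nz: "emb c (j, i) \<noteq> 0" for j i
    proof -
      from nz have dj: "int d dvd j" "c (j div int d, i) \<noteq> 0" by (auto simp: emb_def split: if_splits)
      then have "(j div int d, i) \<in> K.idx" using c by (auto simp: coords_def)
      then show ?thesis using dj(1) K_idx_iff[of "j div int d" i] by simp
    qed
    then show "emb c \<in> div_coords d" by (auto simp: div_coords_def coords_def)
  qed
  show "div_coords d \<subseteq> emb ` coords K.idx"
  proof
    fix c assume c: "c \<in> div_coords d"
    define c' where "c' = (\<lambda>(j, i). c (int d * j, i))"
    have "c' \<in> coords K.idx"
      using c by (auto simp: c'_def coords_def div_coords_def K_idx_iff[symmetric])
    moreover have "c (j, i) = emb c' (j, i)" for j i
      using c by (auto simp: c'_def emb_def div_coords_def)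
    then have "c = emb c'" by (auto simp: fun_eq_iff)
    ultimately show "c \<in> emb ` coords K.idx" by blast
  qed
qed

lemma emb_inj: "inj_on emb (coords K.idx)"
proof (rule inj_onI)
  fix c c' assume *: "emb c = emb c'"
  have "c (j, i) = c' (j, i)" for j i
    using fun_cong[OF *, of "(int d * j, i)"] sd_pos by (simp add: emb_def)
  then show "c = c'" by (auto simp: fun_eq_iff)
qed

text \<open>Coordinates of words span all vectors and are multiples of monomials, so compatibility
  of \<open>emb\<close> with the structure maps is tested on monomials.\<close>

lemma K_word_comb:
  assumes "c \<in> coords K.idx"
  obtains f where "c = lin_comb K.word_coord f"
  using K.hfib_nonempty[OF assms] by (auto simp: K.hfib_def)

lemma emb_div_coords: "c \<in> coords K.idx \<Longrightarrow> emb c \<in> div_coords d"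
  using emb_surj by blast

lemma emb_coords: "c \<in> coords K.idx \<Longrightarrow> emb c \<in> coords idx"
  using emb_div_coords by (auto simp: div_coords_def)

lemma qd_powi: "(q ^ d) powi k = q powi (int d * k)"
  by (simp add: power_int_mult)

text \<open>Sorting costs \<open>(q ^ d)^(i j')\<close> on one side and \<open>q^(i (d j'))\<close>
  on the other.\<close>

lemma emb_mult_word:
  "emb (struct_mult K.idx K.str (K.word_coord u) (K.word_coord v)) =
    struct_mult idx str (emb (K.word_coord u)) (emb (K.word_coord v))"
  unfolding K.word_coord_def struct_mult_scale K.mult_mcoord emb_scale emb_mcoord mult_mcoord
  by (simp add: qd_powi algebra_simps)

lemma emb_mult:
  assumes "c \<in> coords K.idx" "c' \<in> coords K.idx"
  shows "emb (struct_mult K.idx K.str c c') = struct_mult idx str (emb c) (emb c')"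
proof (rule ext, clarify)
  fix j i
  obtain f f' where f: "c = lin_comb K.word_coord f" "c' = lin_comb K.word_coord f'"
    using K_word_comb assms by metis
  have "emb (struct_mult K.idx K.str c c') (j, i) = (\<Sum>u\<in>Poly_Mapping.keys f. \<Sum>v\<in>Poly_Mapping.keys f'.
      Poly_Mapping.lookup f u * Poly_Mapping.lookup f' v *
      emb (struct_mult K.idx K.str (K.word_coord u) (K.word_coord v)) (j, i))"
    unfolding f by (simp add: emb_def struct_mult_lin_comb)
  also have "\<dots> = struct_mult idx str (emb c) (emb c') (j, i)"
    unfolding f emb_lin_comb struct_mult_lin_comb emb_mult_word ..
  finally show "emb (struct_mult K.idx K.str c c') (j, i) = struct_mult idx str (emb c) (emb c') (j, i)" .
qed

lemma emb2_lin_comb: "emb2 (lin_comb \<beta> f) = lin_comb (\<lambda>w. emb2 (\<beta> w)) f"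
proof (rule ext, clarify)
  fix j i j' i'
  show "emb2 (lin_comb \<beta> f) ((j, i), (j', i')) = lin_comb (\<lambda>w. emb2 (\<beta> w)) f ((j, i), (j', i'))"
    by (cases "int d dvd j \<and> int d dvd j'") (simp_all only: emb2_def lin_comb_def prod.case if_True if_False
        simp_thms mult_zero_right sum.neutral_const)
qed

text \<open>By \<open>p_eq\<close> the binomial coefficients are the same, and
  \<open>d * (\<nu> div d) = \<nu>\<close> matches the exponents of \<open>a\<close>.\<close>

lemma emb2_comult_basis: "emb2 (K.comult_basis j i) = comult_basis (int d * j) i"
proof -
  have "emb2 (K.comult_basis j i) = (\<lambda>m. \<Sum>t\<le>i. qbinom (q ^ \<nu>) i t *
      emb2 (K.tmcoord j t (j + int (\<nu> div d) * int t) (i - t)) m)"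
    unfolding K.comult_basis_def p_eq
  proof (rule ext, clarify)
    fix j1 i1 j2 i2
    show "emb2 (\<lambda>m. \<Sum>t\<le>i. qbinom (q ^ \<nu>) i t * K.tmcoord j t (j + int (\<nu> div d) * int t) (i - t) m) ((j1, i1), (j2, i2)) =
      (\<Sum>t\<le>i. qbinom (q ^ \<nu>) i t * emb2 (K.tmcoord j t (j + int (\<nu> div d) * int t) (i - t)) ((j1, i1), (j2, i2)))"
      by (cases "int d dvd j1 \<and> int d dvd j2") (simp_all only: emb2_def prod.case if_True if_False
        simp_thms mult_zero_right sum.neutral_const)
  qed
  also have "\<dots> = comult_basis (int d * j) i"
    using d_dvd unfolding comult_basis_def emb_tensor emb_mcoord
    by (auto simp: algebra_simps simp flip: of_nat_mult)
  finally show ?thesis .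
qed

lemma emb2_scale: "emb2 (\<lambda>m. k * t m) = (\<lambda>m. k * emb2 t m)"
  by (auto simp: emb2_def)

lemma emb_comult:
  assumes "c \<in> coords K.idx"
  shows "emb2 (K.comult_coord c) = comult_coord (emb c)"
proof -
  obtain f where f: "c = lin_comb K.word_coord f" using K_word_comb[OF assms] .
  have "emb2 (K.comult_coord (K.word_coord w)) = comult_coord (emb (K.word_coord w))" for w
    unfolding K.word_coord_def K.comult_coord_scale K.comult_coord_mcoord emb2_scale emb2_comult_basis
      emb_scale emb_mcoord comult_coord_scale comult_coord_mcoord ..
  then show ?thesis
    unfolding f K.comult_coord_lin_comb[symmetric] emb2_lin_comb emb_lin_comb comult_coord_lin_comb[symmetric]
    by simp
qed

lemma emb_counit:
  assumes "c \<in> coords K.idx"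
  shows "counit_coord (emb c) = K.counit_coord c"
proof -
  obtain f where f: "c = lin_comb K.word_coord f" using K_word_comb[OF assms] .
  show ?thesis
    unfolding f emb_lin_comb counit_coord_lin_comb K.counit_coord_lin_comb K.word_coord_def
      emb_scale emb_mcoord counit_coord_scale counit_coord_mcoord K.counit_coord_scale K.counit_coord_mcoord ..
qed

lemma emb_antipode:
  assumes "c \<in> coords K.idx"
  shows "emb (K.antipode_coord c) = antipode_coord (emb c)"
proof -
  obtain f where f: "c = lin_comb K.word_coord f" using K_word_comb[OF assms] .
  have \<nu>: "int d * int (\<nu> div d) = int \<nu>" using d_dvd by (simp flip: of_nat_mult)
  have sc: "K.antipode_scalar i = antipode_scalar i" for i
  proof -
    have "(q ^ d) powi (- (int (\<nu> div d) * int (Suc t))) = q powi (- (int \<nu> * int (Suc t)))" for t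
      unfolding qd_powi \<nu>[symmetric] by (simp only: mult_minus_right mult.assoc)
    then show ?thesis unfolding K.antipode_scalar_def antipode_scalar_def by (simp only:)
  qed
  have "emb (K.antipode_basis j i) = antipode_basis (int d * j) i" for j i
  proof -
    have 1: "int d * - (int i * j) = - (int i * (int d * j))" by simp
    have 2: "int d * (- j - int (\<nu> div d) * int i) = - (int d * j) - int \<nu> * int i"
      unfolding \<nu>[symmetric] by (simp add: algebra_simps)
    show ?thesis
      unfolding K.antipode_basis_def antipode_basis_def emb_scale emb_mcoord sc qd_powi 1 2 ..
  qed
  then have "emb (K.antipode_coord (K.word_coord w)) = antipode_coord (emb (K.word_coord w))" for w
    unfolding K.word_coord_def K.antipode_coord_scale K.antipode_coord_mcoord
      emb_scale emb_mcoord antipode_coord_scale antipode_coord_mcoord by simp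
  then show ?thesis
    unfolding f K.antipode_coord_lin_comb[symmetric] emb_lin_comb antipode_coord_lin_comb[symmetric]
    by simp
qed

section \<open>The isomorphism onto the subalgebra\<close>

definition phi :: "'a H_elem \<Rightarrow> 'a H_elem" where
  "phi h = hfib (emb (K.H.crd h))"

lemma phi_hfib: "c \<in> coords K.idx \<Longrightarrow> phi (K.hfib c) = hfib (emb c)"
  by (simp add: phi_def)

text \<open>The induced map on the tensor square is evaluated on an arbitrary representative
  \<open>F\<close>; the value depends only on its tensor coordinates, hence is constant on the
  coset.\<close>

lemma phi_comult:
  assumes c: "c \<in> coords K.idx"
  shows "comult (H_hopf q N \<nu>) (phi (K.hfib c)) =
    quot_map (lin_ext (tensor_algebra (H_hopf q N \<nu>) (H_hopf q N \<nu>))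
      (\<lambda>(u, v). pure_tensor (H_hopf q N \<nu>) (H_hopf q N \<nu>) (phi u) (phi v)))
      (comult (H_hopf (q ^ d) s (\<nu> div d)) (K.hfib c))"
proof -
  let ?b = "\<lambda>(u, v). pure_tensor (H_hopf q N \<nu>) (H_hopf q N \<nu>) (phi u) (phi v)"
  have "lin_ext (tensor_algebra (H_hopf q N \<nu>) (H_hopf q N \<nu>)) ?b F = HT.tfib (emb2 (K.comult_coord c))"
    if F: "F \<in> K.HT.tfib (K.comult_coord c)" for F
  proof -
    have keys: "u \<in> carrier (H_hopf (q ^ d) s (\<nu> div d))" "v \<in> carrier (H_hopf (q ^ d) s (\<nu> div d))"
      if "(u, v) \<in> Poly_Mapping.keys F" for u v
      using F that by (auto simp: K.HT.tfib_def)
    have "lin_ext (tensor_algebra (H_hopf q N \<nu>) (H_hopf q N \<nu>)) ?b F =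
        HT.tfib (lin_comb (\<lambda>w. emb2 (K.HT.tcrd w)) F)"
    proof (rule HT.T.lin_ext_fib; clarify)
      fix u v assume uv: "(u, v) \<in> Poly_Mapping.keys F"
      have co: "emb (K.H.crd u) \<in> coords idx" "emb (K.H.crd v) \<in> coords idx"
        using keys[OF uv] by (auto intro!: emb_coords)
      show "emb2 (K.HT.tcrd (u, v)) \<in> coords (idx \<times> idx)"
        using co by (simp add: K.HT.tcrd_def emb_tensor tensor_coord_coords)
      show "pure_tensor (H_hopf q N \<nu>) (H_hopf q N \<nu>) (phi u) (phi v) = HT.tfib (emb2 (K.HT.tcrd (u, v)))"
        using co by (simp add: K.HT.tcrd_def emb_tensor phi_def HT.pure_tensor_fib)
    qed
    also have "lin_comb (\<lambda>w. emb2 (K.HT.tcrd w)) F = emb2 (K.comult_coord c)"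
      using F unfolding emb2_lin_comb[symmetric] by (simp add: K.HT.tfib_def)
    finally show ?thesis .
  qed
  then have "quot_map (lin_ext (tensor_algebra (H_hopf q N \<nu>) (H_hopf q N \<nu>)) ?b) (K.HT.tfib (K.comult_coord c)) =
      HT.tfib (emb2 (K.comult_coord c))"
    by (intro quot_map_eqI K.HT.tfib_nonempty K.comult_coord_coords)
  then show ?thesis
    using c by (simp only: phi_hfib comult_H emb_coords K.comult_H emb_comult)
qed

lemma phi_iso:
  "phi \<in> hopf_iso_onto (H_hopf (q ^ d) s (\<nu> div d)) (H_hopf q N \<nu>) (hfib ` div_coords d)"
proof -
  let ?K = "H_hopf (q ^ d) s (\<nu> div d)" and ?H = "H_hopf q N \<nu>"
  have carr: "\<exists>c. c \<in> coords K.idx \<and> h = K.hfib c" if "h \<in> carrier ?K" for h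
    using that by (auto simp: K.H.carrier_eq)
  have "phi \<in> ring_hom ?K ?H"
  proof (rule ring_hom_memI)
    fix g h assume "g \<in> carrier ?K" "h \<in> carrier ?K"
    then obtain c c' where c: "c \<in> coords K.idx" "g = K.hfib c" "c' \<in> coords K.idx" "h = K.hfib c'"
      using carr by metis
    show "phi g \<in> carrier ?H" using c by (simp add: phi_hfib emb_coords)
    show "phi (g \<otimes>\<^bsub>?K\<^esub> h) = phi g \<otimes>\<^bsub>?H\<^esub> phi h"
      using c by (simp add: K.H.fib_mult phi_hfib emb_coords H.fib_mult emb_mult)
    have "emb (\<lambda>i. c i + c' i) = (\<lambda>i. emb c i + emb c' i)" by (auto simp: emb_def)
    then show "phi (g \<oplus>\<^bsub>?K\<^esub> h) = phi g \<oplus>\<^bsub>?H\<^esub> phi h"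
      using c by (simp add: K.H.fib_add phi_hfib emb_coords H.fib_add coords_add)
  qed (simp add: K.H.fib_one H.fib_one phi_hfib emb_mcoord)
  moreover have "phi (c \<odot>\<^bsub>?K\<^esub> h) = c \<odot>\<^bsub>?H\<^esub> phi h \<and>
    comult ?H (phi h) = quot_map (lin_ext (tensor_algebra ?H ?H) (\<lambda>(u, v). pure_tensor ?H ?H (phi u) (phi v))) (comult ?K h) \<and>
    counit ?H (phi h) = counit ?K h \<and> antipode ?H (phi h) = phi (antipode ?K h)"
    if h: "h \<in> carrier ?K" for h c
  proof -
    obtain c' where c': "c' \<in> coords K.idx" "h = K.hfib c'" using carr[OF h] by blast
    have "phi (c \<odot>\<^bsub>?K\<^esub> h) = c \<odot>\<^bsub>?H\<^esub> phi h"
      using c' by (simp add: K.H.fib_smult phi_hfib H.fib_smult emb_coords coords_scale emb_scale)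
    moreover have "counit ?H (phi h) = counit ?K h"
      using c' by (simp add: phi_hfib counit_H emb_coords K.counit_H emb_counit)
    moreover have "antipode ?H (phi h) = phi (antipode ?K h)"
      using c' by (simp add: phi_hfib antipode_H emb_coords K.antipode_H emb_antipode K.antipode_coord_coords)
    ultimately show ?thesis using phi_comult[OF c'(1)] c'(2) by blast
  qed
  moreover have "bij_betw phi (carrier ?K) (hfib ` div_coords d)"
  proof (rule bij_betw_imageI)
    show "inj_on phi (carrier ?K)"
    proof (rule inj_onI)
      fix g h assume gh: "g \<in> carrier ?K" "h \<in> carrier ?K" "phi g = phi h"
      then obtain c c' where c: "c \<in> coords K.idx" "g = K.hfib c" "c' \<in> coords K.idx" "h = K.hfib c'"
        using carr by metis
      then have "emb c = emb c'" using gh(3) by (simp add: phi_hfib H.fib_eq_iff emb_coords)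
      then show "g = h" using c inj_onD[OF emb_inj] by blast
    qed
    show "phi ` carrier ?K = hfib ` div_coords d"
      unfolding emb_surj[symmetric] K.H.carrier_eq image_image
      by (rule image_cong) (simp_all add: phi_hfib)
  qed
  ultimately show ?thesis by (simp add: hopf_iso_onto_def hopf_hom_def)
qed

lemma phi_gens:
  "phi (H_a (q ^ d) s (\<nu> div d)) = H_a q N \<nu> [^]\<^bsub>H_hopf q N \<nu>\<^esub> d"
  "phi (H_x (q ^ d) s (\<nu> div d)) = H_x q N \<nu>"
  by (simp_all add: K.H_a_eq K.H_x_eq H_x_eq H_a_pow phi_hfib emb_mcoord)

end

text \<open>The order of \<open>q ^ d\<close> is \<open>n div gcd n d\<close>: this number is
  coprime to \<open>d div gcd n d\<close>, so it divides \<open>m\<close> exactly when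
  \<open>n dvd d * m\<close>.\<close>

lemma H_params_quotient:
  assumes "H_params n q N \<nu>" and N: "N = s * d" and d: "d dvd \<nu>"
  shows "H_params (n div gcd n d) (q ^ d) s (\<nu> div d)"
proof -
  have n: "0 < n" "n dvd N" and \<nu>: "1 \<le> \<nu>" "\<nu> < N" and q: "q ^ n = 1"
    and prim: "\<And>m. 0 < m \<Longrightarrow> m < n \<Longrightarrow> q ^ m \<noteq> 1" and "0 < N"
    using assms(1) by (auto simp: H_params_def primitive_root_of_unity_def)
  have pos: "0 < s" "0 < d" using \<open>0 < N\<close> N by auto
  have dvd: "n dvd m" if "q ^ m = 1" for m
  proof -
    have "q ^ m = (q ^ n) ^ (m div n) * q ^ (m mod n)"
      by (simp flip: power_mult power_add)
    then have "q ^ (m mod n) = 1" using q that by simp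
    then show ?thesis using prim[of "m mod n"] n(1) by (metis mod_less_divisor mod_0_imp_dvd not_gr0)
  qed
  let ?g = "gcd n d"
  have g: "0 < ?g" "?g dvd n" "?g dvd d" using n(1) by auto
  have cop: "coprime (n div ?g) (d div ?g)" using n(1) by (intro div_gcd_coprime) auto
  have *: "n div ?g dvd m \<longleftrightarrow> n dvd d * m" for m
  proof -
    have "n dvd d * m \<longleftrightarrow> ?g * (n div ?g) dvd ?g * ((d div ?g) * m)"
      by (simp only: mult.assoc[symmetric] dvd_mult_div_cancel g)
    also have "\<dots> \<longleftrightarrow> n div ?g dvd (d div ?g) * m" by (rule nat_mult_dvd_cancel1[OF g(1)])
    also have "\<dots> \<longleftrightarrow> n div ?g dvd m" using cop by (simp add: coprime_dvd_mult_right_iff)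
    finally show ?thesis ..
  qed
  have "n div ?g dvd s" using n(2) N * by (simp add: mult.commute)
  moreover have "0 < n div ?g" using n(1) g by (simp add: div_greater_zero_iff dvd_imp_le)
  moreover have "(q ^ d) ^ (n div ?g) = 1"
  proof -
    have "n dvd d * (n div ?g)" by (simp only: *[symmetric] dvd_refl)
    then obtain k where k: "d * (n div ?g) = n * k" ..
    have "(q ^ d) ^ (n div ?g) = (q ^ n) ^ k" by (simp only: power_mult[symmetric] k)
    then show ?thesis using q by simp
  qed
  moreover have "(q ^ d) ^ m \<noteq> 1" if "0 < m" "m < n div ?g" for m
  proof
    assume "(q ^ d) ^ m = 1"
    then have "n dvd d * m" by (intro dvd) (simp add: power_mult)
    then show False using that * by (meson nat_dvd_not_less)
  qed
  moreover have "1 \<le> \<nu> div d" using \<nu>(1) d pos(2) by (simp add: Suc_le_eq div_greater_zero_iff dvd_imp_le)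
  moreover have "\<nu> div d < s" using \<nu>(2) N pos(2) by (simp add: less_mult_imp_div_less)
  ultimately show ?thesis using pos by (simp add: H_params_def primitive_root_of_unity_def)
qed

text \<open>For order 1 the relation \<open>x^r = 0\<close> reads \<open>x = 0\<close>. The
  contrapositive turns the hypothesis that \<open>x\<close> is nonzero into
  \<open>r \<noteq> 1\<close>.\<close>

lemma H_x_eq_zero:
  assumes "mult_order (q ^ \<nu>) = 1"
  shows "H_x q N \<nu> = \<zero>\<^bsub>H_hopf q N \<nu>\<^esub>"
proof -
  interpret ideal "H_ideal q N \<nu>" "free_algebra" by (rule ideal_H_ideal)
  have "Poly_Mapping.single [Gen_x] 1 \<in> H_ideal q N \<nu>"
    using H_relations_ideal[of q N \<nu>] assms by (auto simp: H_relations_def)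
  then have "H_x q N \<nu> = H_ideal q N \<nu>"
    unfolding H_gen_def by (rule a_rcos_const)
  then show ?thesis by (simp add: H_hopf_def H_algebra_def quot_algebra_def FactRing_def Let_def)
qed

theorem lemma2p8:
  fixes q :: "'k::field" and n N \<nu> :: nat and B :: "'k H_elem set"
  assumes "H_params n q N \<nu>"
    and "H_x q N \<nu> \<noteq> \<zero>\<^bsub>H_hopf q N \<nu>\<^esub>"
    and "hopf_subalgebra B (H_hopf q N \<nu>)"
  shows
    "(B = k_span (H_hopf q N \<nu>) (grouplikes (H_hopf q N \<nu>) B) \<and>
      subgroup (grouplikes (H_hopf q N \<nu>) B)
        (subgroup_generated (units_of (H_hopf q N \<nu>)) {H_a q N \<nu>})) \<or>
     (\<exists>s. 1 \<le> s \<and> s \<le> N \<and> s dvd N \<and> (N div s) dvd \<nu> \<and>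
        B = k_subalgebra_generated (H_hopf q N \<nu>)
              {H_a q N \<nu> [^]\<^bsub>H_hopf q N \<nu>\<^esub> (N div s), H_x q N \<nu>} \<and>
        H_params (n div gcd n (N div s)) (q ^ (N div s)) s (\<nu> div (N div s)) \<and>
        (\<exists>\<phi> \<in> hopf_iso_onto (H_hopf (q ^ (N div s)) s (\<nu> div (N div s))) (H_hopf q N \<nu>) B.
           \<phi> (H_a (q ^ (N div s)) s (\<nu> div (N div s))) =
             H_a q N \<nu> [^]\<^bsub>H_hopf q N \<nu>\<^esub> (N div s) \<and>
           \<phi> (H_x (q ^ (N div s)) s (\<nu> div (N div s))) = H_x q N \<nu>))"
proof -
  have N: "0 < N" "n dvd N" and qn: "q ^ n = 1"
    using assms(1) by (auto simp: H_params_def primitive_root_of_unity_def)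
  have qN: "q ^ N = 1" using N(2) qn by (auto simp: power_mult elim!: dvdE)
  have "q \<noteq> 0" using qN N(1) by (metis power_0_left zero_neq_one not_gr0)
  have "(q ^ \<nu>) ^ N = 1" using qN by (metis power_mult mult.commute power_one)
  \<comment> \<open>Dividing the positive \<open>N\<close>, the order cannot be 0; together with
    \<open>r \<noteq> 1\<close> this gives \<open>1 < r\<close>.\<close>
  then have "mult_order (q ^ \<nu>) dvd N" using mult_order_pow_eq_1[of "q ^ \<nu>" N] \<open>q \<noteq> 0\<close> by simp
  then have "mult_order (q ^ \<nu>) \<noteq> 0" using N(1) by auto
  moreover have "mult_order (q ^ \<nu>) \<noteq> 1" using H_x_eq_zero assms(2) by blast
  ultimately interpret H_hopf_subalgebra q N \<nu> B
    by unfold_locales (use N qN assms(3) in auto)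
  show ?thesis
  proof (cases "\<exists>j i. mon j i \<in> B \<and> 0 < i \<and> i < r")
    case False
    then have "i = 0" if "mon j i \<in> B" "i < r" for j i using that by auto
    from group_algebra_case[OF this] show ?thesis by (intro disjI1 conjI)
  next
    case True
    then obtain j i where "mon j i \<in> B" "0 < i" "i < r" by blast
    then obtain d where d: "0 < d" "d dvd N" "d dvd \<nu>" "mon (int d) 0 \<in> B" "mon 0 1 \<in> B"
      "B = hfib ` div_coords d" by (rule x_case)
    \<comment> \<open>The complementary divisor: \<open>N div s\<close> is \<open>d\<close> again,
      so the claim can be read with \<open>d\<close> for \<open>N div s\<close>.\<close>
    define s where "s = N div d"
    have sd: "N = s * d" "N div s = d" using d N(1) by (auto simp: s_def)
    interpret E: H_embedding q N \<nu> s d by unfold_locales (use sd d in auto)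
    have s: "1 \<le> s" "s \<le> N" "s dvd N" using sd(1) N(1) E.sd_pos by auto
    show ?thesis
    proof (rule disjI2, rule exI[of _ s], unfold sd(2), intro conjI bexI[of _ E.phi])
      show "B = k_subalgebra_generated (H_hopf q N \<nu>) {H_a q N \<nu> [^]\<^bsub>H_hopf q N \<nu>\<^esub> d, H_x q N \<nu>}"
        by (rule subalgebra_generated_eq[OF d(4-6)])
      show "H_params (n div gcd n d) (q ^ d) s (\<nu> div d)"
        by (rule H_params_quotient[OF assms(1) sd(1) d(3)])
      show "E.phi \<in> hopf_iso_onto (H_hopf (q ^ d) s (\<nu> div d)) (H_hopf q N \<nu>) B"
        unfolding d(6) by (rule E.phi_iso)
    qed (fact s d(3) E.phi_gens)+
  qed
qed

end
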